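(* Let $m\in\mathbb{R}$, $m\neq0$, and for $s=2,\dots,7$ let $S_s$ be a solvable Lie group with Lie algebra $\mathfrak{cp}_s^m$ (structure equations in the context, with respect to a basis $\{e^1,\dots,e^7\}$ of left-invariant $1$-forms). In each case the following family of left-invariant $\mathrm{G}_2$-structures on $S_s$ is a solution of the Laplacian LCP-flow $$\frac{d}{dt}\varphi(t)=\Delta_t\varphi(t),\qquad \varphi(t)\ \text{locally conformal parallel for every } t.$$ $\mathfrak{cp}_2^m$: for $t\in(-\infty,\frac{3}{10m^2})$, $$\varphi(t)=(1-\tfrac{10}{3}m^2t)^{\frac{11}{5}}(e^{127}-e^{236})+(1-\tfrac{10}{3}m^2t)^{2}(e^{347}+e^{567})+(1-\tfrac{10}{3}m^2t)^{\frac{12}{5}}(e^{135}-e^{146}-e^{245}).$$ $\mathfrak{cp}_3^m$: for $t\in(-\infty,\frac{1}{3m^2})$, $$\varphi(t)=(1-3m^2t)^{\frac{7}{3}}(e^{127}-e^{236}-e^{245})+(1-3m^2t)^{2}(e^{347}+e^{567})+(1-3m^2t)^{\frac{5}{2}}(e^{135}-e^{146}).$$ $\mathfrak{cp}_4^m$: for $t\in(-\infty,\frac{5}{14m^2})$, $$\varphi(t)=(1-\tfrac{14}{5}m^2t)^{\frac{17}{7}}(e^{127}-e^{146}-e^{236}-e^{245})+(1-\tfrac{14}{5}m^2t)^{2}(e^{347}+e^{567})+(1-\tfrac{14}{5}m^2t)^{\frac{18}{7}}e^{135}.$$ $\mathfrak{cp}_5^m$: for $t\in(-\infty,\frac{1}{3m^2})$,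 $$\varphi(t)=(1-3m^2t)^{\frac{7}{3}}(e^{127}-e^{146}-e^{245})+(1-3m^2t)^{2}(e^{347}+e^{567})+(1-3m^2t)^{\frac{5}{2}}(e^{135}-e^{236}).$$ $\mathfrak{cp}_6^m$: for $t\in(-\infty,\frac{3}{8m^2})$, $$\varphi(t)=(1-\tfrac{8}{3}m^2t)^{\frac{5}{2}}(e^{127}+e^{135}-e^{146}-e^{236}-e^{245})+(1-\tfrac{8}{3}m^2t)^{2}(e^{347}+e^{567}).$$ $\mathfrak{cp}_7^m$: for $t\in(-\infty,\frac{5}{14m^2})$, $$\varphi(t)=(1-\tfrac{14}{5}m^2t)^{\frac{15}{7}}(e^{127}+e^{347}+e^{567}-e^{236})+(1-\tfrac{14}{5}m^2t)^{\frac{18}{7}}(e^{135}-e^{146}-e^{245}).$$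
   Context: Notation: $e^{i_1\dots i_k}=e^{i_1}\wedge\dots\wedge e^{i_k}$. A Lie algebra is described by the tuple $(de^1,\dots,de^7)$ of exterior derivatives of a basis of its dual: \begin{align*} \mathfrak{cp}^m_2 &= \big(-\tfrac43m e^{17}+\tfrac23me^{36}, -m e^{27}, -\tfrac23me^{37}, -m e^{47}, -me^{57}, -\tfrac23 m e^{67}, 0\big);\\ \mathfrak{cp}^m_3 &= \big(-\tfrac32m e^{17}+\tfrac12 m e^{36}+\tfrac12 m e^{45}, -m e^{27}, -\tfrac34me^{37}, -\tfrac34 m e^{47}, -\tfrac34me^{57}, -\tfrac34m e^{67}, 0\big);\\ \mathfrak{cp}^m_4 &= \big(-\tfrac75m e^{17}+\tfrac25 m e^{36}+\tfrac25 m e^{45}, -\tfrac65m e^{27}-\tfrac25m e^{46}, -\tfrac45me^{37}, -\tfrac35 m e^{47}, -\tfrac45me^{57},-\tfrac35m e^{67}, 0\big);\\ \mathfrak{cp}^m_5 &= \big(-\tfrac54 m e^{17}+\tfrac12 m e^{45}, -\tfrac54m e^{27}-\tfrac12m e^{46}, -me^{37}, -\tfrac12 m e^{47}, -\tfrac34me^{57}, -\tfrac34m e^{67}, 0\big);\\ \mathfrak{cp}^m_6 &= \big(-\tfrac43m e^{17}+\tfrac13 m e^{36}+\tfrac13 m e^{45}, -\tfrac43m e^{27}+\tfrac13m e^{35}-\tfrac13 m e^{46}, -\tfrac23me^{37}, -\tfrac23 m e^{47}, -\tfrac23me^{57}, -\tfrac23m e^{67}, 0\big);\\ \mathfrak{cp}^m_7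 &= \big(-\tfrac65m e^{17}+\tfrac25 m e^{36}, -\tfrac35m e^{27}, -\tfrac35me^{37}, \tfrac25 m e^{26}-\tfrac65 m e^{47}, \tfrac25 m e^{23}-\tfrac65me^{57}, -\tfrac35m e^{67}, 0\big). \end{align*} A $\mathrm{G}_2$-structure on a $7$-manifold is given by a $3$-form $\varphi$ which, with respect to some local basis of $1$-forms $\{x^1,\dots,x^7\}$ (an adapted basis), is $\varphi=x^{127}+x^{347}+x^{567}+x^{135}-x^{146}-x^{236}-x^{245}$. It induces the Riemannian metric $g_\varphi$ and the orientation for which $\{x^1,\dots,x^7\}$ is an oriented orthonormal coframe. $\Delta_t$ denotes the Hodge Laplacian $dd^{*}+d^{*}d$ of the metric $g_{\varphi(t)}$. A $\mathrm{G}_2$-structure $\varphi$ is locally conformal parallel (LCP, class $\mathcal{X}_4$) if there is a $1$-form $\tau$ (the Lee form) with $d\varphi=3\,\tau\wedge\varphi$ and $d{\ast}\varphi=4\,\tau\wedge{\ast}\varphi$, where $\ast$ is the Hodge star of $g_\varphi$. *)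

theory Defs
  imports
    "HOL-Analysis.Analysis"
    "HOL-Library.Function_Algebras"
    "HOL-Algebra.Solvable_Groups"
begin

text \<open>
  Smooth 7-manifolds are given by atlases on a topological space, and a differential form is the
  family of its local expressions, one for each chart of the atlas, subject to the usual
  transformation law. Sums and differences of forms are pointwise (\<open>Function_Algebras\<close>).
\<close>

section \<open>Multilinear algebra on the model space\<close>

text \<open>
  A multilinear form is a function on lists of vectors; a form of degree \<open>k\<close> vanishes on all lists
  whose length is not \<open>k\<close>. In particular a covector \<open>\<alpha>\<close> is evaluated as \<open>\<alpha> [v]\<close>.
\<close>

type_synonym ext = "(real^7) list \<Rightarrow> real"

definition alternating_form :: "nat \<Rightarrow> ext \<Rightarrow> bool" where
  "alternating_form k \<alpha> \<longleftrightarrow>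
     (\<forall>vs. length vs \<noteq> k \<longrightarrow> \<alpha> vs = 0) \<and>
     (\<forall>vs. \<forall>i<k. length vs = k \<longrightarrow> linear (\<lambda>v. \<alpha> (vs[i := v]))) \<and>
     (\<forall>vs i j. length vs = k \<and> i < j \<and> j < k \<and> vs ! i = vs ! j \<longrightarrow> \<alpha> vs = 0)"

text \<open>
  Exterior product of a covector with a form of arbitrary degree, in the normalization
  \<open>(\<alpha> \<and> \<beta>)(u, v) = \<alpha>(u) \<beta>(v) - \<alpha>(v) \<beta>(u)\<close>. By associativity this is all that is needed:
  \<open>x\<^sup>i \<and> x\<^sup>j \<and> x\<^sup>k\<close> is \<open>x\<^sup>i \<and> (x\<^sup>j \<and> x\<^sup>k)\<close>.
\<close>

definition wedge1 :: "ext \<Rightarrow> ext \<Rightarrow> ext" where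
  "wedge1 \<alpha> \<omega> = (\<lambda>vs. \<Sum>i<length vs. (-1) ^ i * \<alpha> [vs ! i] * \<omega> (take i vs @ drop (Suc i) vs))"

definition ext_one :: ext where
  "ext_one = (\<lambda>vs. if vs = [] then 1 else 0)"

definition ext_mono :: "(nat \<Rightarrow> ext) \<Rightarrow> nat list \<Rightarrow> ext" where
  "ext_mono x is = foldr (\<lambda>i \<omega>. wedge1 (x i) \<omega>) is ext_one"

definition covector_basis :: "(nat \<Rightarrow> ext) \<Rightarrow> bool" where
  "covector_basis x \<longleftrightarrow>
     (\<forall>i\<in>{1..7}. alternating_form 1 (x i)) \<and>
     (\<forall>a :: nat \<Rightarrow> real. (\<forall>v. (\<Sum>i=1..7. a i * x i [v]) = 0) \<longrightarrow> (\<forall>i\<in>{1..7}. a i = 0))"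

definition g2_form :: "(nat \<Rightarrow> ext) \<Rightarrow> ext" where
  "g2_form x = ext_mono x [1,2,7] + ext_mono x [3,4,7] + ext_mono x [5,6,7] + ext_mono x [1,3,5]
     - ext_mono x [1,4,6] - ext_mono x [2,3,6] - ext_mono x [2,4,5]"

definition adapted :: "(nat \<Rightarrow> ext) \<Rightarrow> ext \<Rightarrow> bool" where
  "adapted x \<phi> \<longleftrightarrow> covector_basis x \<and> \<phi> = g2_form x"

text \<open>
  The metric, and the volume form (hence the orientation), for which adapted coframes are oriented
  and orthonormal. They do not depend on the adapted coframe, because the stabilizer of the model
  form lies in \<open>SO(7)\<close>.
\<close>

definition g2_metric :: "ext \<Rightarrow> real^7 \<Rightarrow> real^7 \<Rightarrow> real" where
  "g2_metric \<phi> = (THE g. \<exists>x. adapted x \<phi> \<and> g = (\<lambda>u v. \<Sum>i=1..7. x i [u] * x i [v]))"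

definition g2_volume :: "ext \<Rightarrow> ext" where
  "g2_volume \<phi> = (THE \<nu>. \<exists>x. adapted x \<phi> \<and> \<nu> = ext_mono x [1,2,3,4,5,6,7])"

definition flat :: "(real^7 \<Rightarrow> real^7 \<Rightarrow> real) \<Rightarrow> real^7 \<Rightarrow> ext" where
  "flat g u = (\<lambda>vs. if length vs = 1 then g u (vs ! 0) else 0)"

text \<open>
  Hodge star on \<open>k\<close>-forms: the form \<open>\<gamma>\<close> of degree \<open>7 - k\<close> with \<open>\<alpha> \<and> \<gamma> = \<langle>\<alpha>, \<beta>\<rangle> \<nu>\<close> for all \<open>k\<close>-forms \<open>\<alpha>\<close>,
  where it suffices to let \<open>\<alpha>\<close> range over the spanning set of the products
  \<open>u\<^sub>1\<^sup>\<flat> \<and> \<dots> \<and> u\<^sub>k\<^sup>\<flat>\<close>, for which \<open>\<langle>\<alpha>, \<beta>\<rangle> = \<beta>(u\<^sub>1, \<dots>, u\<^sub>k)\<close>.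
\<close>

definition hodge :: "(real^7 \<Rightarrow> real^7 \<Rightarrow> real) \<Rightarrow> ext \<Rightarrow> nat \<Rightarrow> ext \<Rightarrow> ext" where
  "hodge g \<nu> k \<beta> = (THE \<gamma>. alternating_form (7 - k) \<gamma> \<and>
     (\<forall>us. length us = k \<longrightarrow>
        foldr (\<lambda>u \<omega>. wedge1 (flat g u) \<omega>) us \<gamma> = (\<lambda>vs. \<beta> us * \<nu> vs)))"


section \<open>Smooth maps, smooth manifolds, Lie groups\<close>

text \<open>\<open>C\<^sup>k\<close> maps on an open subset \<open>S\<close> of a Euclidean space.\<close>

primrec Ck_on ::
  "nat \<Rightarrow> 'a::euclidean_space set \<Rightarrow> ('a \<Rightarrow> 'b::real_normed_vector) \<Rightarrow> bool" where
  "Ck_on 0 S f \<longleftrightarrow> continuous_on S f"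
| "Ck_on (Suc k) S f \<longleftrightarrow> (\<forall>x\<in>S. f differentiable (at x)) \<and>
     (\<forall>v. Ck_on k S (\<lambda>x. frechet_derivative f (at x) v))"

definition smooth_on :: "'a::euclidean_space set \<Rightarrow> ('a \<Rightarrow> 'b::real_normed_vector) \<Rightarrow> bool" where
  "smooth_on S f \<longleftrightarrow> (\<forall>k. Ck_on k S f)"

text \<open>A chart is a pair of its domain and its coordinate map.\<close>

type_synonym 'a chart = "'a set \<times> ('a \<Rightarrow> real^7)"

definition smooth_atlas :: "'a::topological_space chart set \<Rightarrow> bool" where
  "smooth_atlas \<A> \<longleftrightarrow>
     (\<forall>(U, c)\<in>\<A>. open U \<and> open (c ` U) \<and> homeomorphism U (c ` U) c (inv_into U c)) \<and>
     (\<Union>(U, c)\<in>\<A>. U) = UNIV \<and>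
     (\<forall>(U, c)\<in>\<A>. \<forall>(V, d)\<in>\<A>. smooth_on (c ` (U \<inter> V)) (d \<circ> inv_into U c))"

definition lie_group ::
  "'a::{t2_space, second_countable_topology} chart set \<Rightarrow> 'a monoid \<Rightarrow> bool" where
  "lie_group \<A> G \<longleftrightarrow> smooth_atlas \<A> \<and> group G \<and> carrier G = UNIV \<and>
     continuous_on UNIV (\<lambda>(p, q). p \<otimes>\<^bsub>G\<^esub> q) \<and>
     continuous_on UNIV (\<lambda>p. inv\<^bsub>G\<^esub> p) \<and>
     (\<forall>(U, c)\<in>\<A>. \<forall>(V, d)\<in>\<A>. \<forall>(W, b)\<in>\<A>.
        smooth_on {(c p, d q) | p q. p \<in> U \<and> q \<in> V \<and> p \<otimes>\<^bsub>G\<^esub> q \<in> W}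
          (\<lambda>(x, y). b (inv_into U c x \<otimes>\<^bsub>G\<^esub> inv_into V d y))) \<and>
     (\<forall>(U, c)\<in>\<A>. \<forall>(V, d)\<in>\<A>.
        smooth_on {c p | p. p \<in> U \<and> inv\<^bsub>G\<^esub> p \<in> V} (\<lambda>x. d (inv\<^bsub>G\<^esub> (inv_into U c x))))"


section \<open>Differential forms\<close>

text \<open>
  \<open>\<omega> (U, c) x\<close> is the value at the point with coordinates \<open>x \<in> c ` U\<close> of the local expression of \<open>\<omega>\<close>
  in the chart \<open>(U, c)\<close>; tangent vectors are given by their coordinates in that chart. Values at
  \<open>x \<notin> c ` U\<close>, or for charts outside the atlas, are meaningless, so that forms have to be compared
  by \<open>form_eq\<close>.
\<close>

type_synonym 'a form = "'a chart \<Rightarrow> real^7 \<Rightarrow> ext"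

definition form_eq :: "'a chart set \<Rightarrow> 'a form \<Rightarrow> 'a form \<Rightarrow> bool" where
  "form_eq \<A> \<omega> \<eta> \<longleftrightarrow> (\<forall>(U, c)\<in>\<A>. \<forall>x\<in>c ` U. \<omega> (U, c) x = \<eta> (U, c) x)"

definition form_scale :: "real \<Rightarrow> 'a form \<Rightarrow> 'a form" (infixr \<open>*\<^sub>f\<close> 75) where
  "r *\<^sub>f \<omega> = (\<lambda>C x vs. r * \<omega> C x vs)"

definition form_wedge1 :: "'a form \<Rightarrow> 'a form \<Rightarrow> 'a form" where
  "form_wedge1 \<tau> \<omega> = (\<lambda>C x. wedge1 (\<tau> C x) (\<omega> C x))"

text \<open>\<open>e \<up> [1, 2, 7]\<close> is \<open>e\<^sup>1 \<and> e\<^sup>2 \<and> e\<^sup>7\<close>.\<close>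

definition form_mono :: "(nat \<Rightarrow> 'a form) \<Rightarrow> nat list \<Rightarrow> 'a form" (infixl \<open>\<up>\<close> 90) where
  "e \<up> is = (\<lambda>C x. ext_mono (\<lambda>i. e i C x) is)"

text \<open>Smooth \<open>k\<close>-forms on an open subset \<open>W\<close> of the manifold.\<close>

definition diff_form :: "'a chart set \<Rightarrow> 'a set \<Rightarrow> nat \<Rightarrow> 'a form \<Rightarrow> bool" where
  "diff_form \<A> W k \<omega> \<longleftrightarrow>
     (\<forall>(U, c)\<in>\<A>. (\<forall>x\<in>c ` (U \<inter> W). alternating_form k (\<omega> (U, c) x)) \<and>
        (\<forall>vs. smooth_on (c ` (U \<inter> W)) (\<lambda>x. \<omega> (U, c) x vs))) \<and>
     (\<forall>(U, c)\<in>\<A>. \<forall>(V, d)\<in>\<A>. \<forall>p\<in>U \<inter> V \<inter> W. \<forall>vs.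
        \<omega> (U, c) (c p) vs =
        \<omega> (V, d) (d p) (map (frechet_derivative (d \<circ> inv_into U c) (at (c p))) vs))"

definition ext_deriv :: "'a form \<Rightarrow> 'a form" where
  "ext_deriv \<omega> = (\<lambda>C x vs. \<Sum>i<length vs.
     (-1) ^ i * frechet_derivative (\<lambda>y. \<omega> C y (take i vs @ drop (Suc i) vs)) (at x) (vs ! i))"

text \<open>Invariance under the pullback by every left translation \<open>p \<mapsto> g \<otimes> p\<close>.\<close>

definition left_invariant :: "'a chart set \<Rightarrow> 'a monoid \<Rightarrow> 'a form \<Rightarrow> bool" where
  "left_invariant \<A> G \<omega> \<longleftrightarrow>
     (\<forall>g. \<forall>(U, c)\<in>\<A>. \<forall>(V, d)\<in>\<A>. \<forall>p\<in>U. \<forall>vs. g \<otimes>\<^bsub>G\<^esub> p \<in> V \<longrightarrow>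
        \<omega> (U, c) (c p) vs =
        \<omega> (V, d) (d (g \<otimes>\<^bsub>G\<^esub> p))
          (map (frechet_derivative (\<lambda>x. d (g \<otimes>\<^bsub>G\<^esub> inv_into U c x)) (at (c p))) vs))"

definition left_invariant_basis :: "'a chart set \<Rightarrow> 'a monoid \<Rightarrow> (nat \<Rightarrow> 'a form) \<Rightarrow> bool" where
  "left_invariant_basis \<A> G e \<longleftrightarrow>
     (\<forall>i\<in>{1..7}. diff_form \<A> UNIV 1 (e i) \<and> left_invariant \<A> G (e i)) \<and>
     (\<forall>a. form_eq \<A> (\<Sum>i=1..7. a i *\<^sub>f e i) 0 \<longrightarrow> (\<forall>i\<in>{1..7}. a i = 0)) \<and>
     (\<forall>\<omega>. diff_form \<A> UNIV 1 \<omega> \<and> left_invariant \<A> G \<omega> \<longrightarrow>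
        (\<exists>a. form_eq \<A> \<omega> (\<Sum>i=1..7. a i *\<^sub>f e i)))"


section \<open>\<open>G\<^sub>2\<close>-structures and the Laplacian flow\<close>

definition g2_structure :: "'a::topological_space chart set \<Rightarrow> 'a form \<Rightarrow> bool" where
  "g2_structure \<A> \<phi> \<longleftrightarrow> diff_form \<A> UNIV 3 \<phi> \<and>
     (\<forall>p. \<exists>W x. open W \<and> p \<in> W \<and> (\<forall>i\<in>{1..7}. diff_form \<A> W 1 (x i)) \<and>
        (\<forall>(U, c)\<in>\<A>. \<forall>y\<in>c ` (U \<inter> W). adapted (\<lambda>i. x i (U, c) y) (\<phi> (U, c) y)))"

text \<open>The Hodge star, on \<open>k\<close>-forms, of the metric and orientation induced by \<open>\<phi>\<close>.\<close>

definition star :: "'a form \<Rightarrow> nat \<Rightarrow> 'a form \<Rightarrow> 'a form" where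
  "star \<phi> k \<omega> = (\<lambda>C x. hodge (g2_metric (\<phi> C x)) (g2_volume (\<phi> C x)) k (\<omega> C x))"

text \<open>
  On \<open>k\<close>-forms of an oriented Riemannian \<open>n\<close>-manifold, \<open>d\<^sup>*\<close> is \<open>\<star> d \<star>\<close> up to the sign
  \<open>(-1) ^ (n * (k + 1) + 1)\<close>, and \<open>d \<star> \<omega>\<close> has degree \<open>n - k + 1\<close>.
\<close>

definition codiff :: "'a form \<Rightarrow> nat \<Rightarrow> 'a form \<Rightarrow> 'a form" where
  "codiff \<phi> k \<omega> = (-1) ^ (7 * (k + 1) + 1) *\<^sub>f star \<phi> (8 - k) (ext_deriv (star \<phi> k \<omega>))"

definition hodge_laplacian :: "'a form \<Rightarrow> nat \<Rightarrow> 'a form \<Rightarrow> 'a form" where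
  "hodge_laplacian \<phi> k \<omega> = ext_deriv (codiff \<phi> k \<omega>) + codiff \<phi> (k + 1) (ext_deriv \<omega>)"

definition locally_conformal_parallel :: "'a::topological_space chart set \<Rightarrow> 'a form \<Rightarrow> bool" where
  "locally_conformal_parallel \<A> \<phi> \<longleftrightarrow> g2_structure \<A> \<phi> \<and>
     (\<exists>\<tau>. diff_form \<A> UNIV 1 \<tau> \<and>
        form_eq \<A> (ext_deriv \<phi>) (3 *\<^sub>f form_wedge1 \<tau> \<phi>) \<and>
        form_eq \<A> (ext_deriv (star \<phi> 3 \<phi>)) (4 *\<^sub>f form_wedge1 \<tau> (star \<phi> 3 \<phi>)))"

definition laplacian_LCP_flow ::
  "'a::topological_space chart set \<Rightarrow> real set \<Rightarrow> (real \<Rightarrow> 'a form) \<Rightarrow> bool" where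
  "laplacian_LCP_flow \<A> I \<phi> \<longleftrightarrow> (\<forall>t\<in>I.
     locally_conformal_parallel \<A> (\<phi> t) \<and>
     (\<forall>(U, c)\<in>\<A>. \<forall>x\<in>c ` U. \<forall>vs.
        ((\<lambda>s. \<phi> s (U, c) x vs) has_real_derivative
           hodge_laplacian (\<phi> t) 3 (\<phi> t) (U, c) x vs) (at t within I)))"

definition left_invariant_LCP_solution ::
  "'a::topological_space chart set \<Rightarrow> 'a monoid \<Rightarrow> real set \<Rightarrow> (real \<Rightarrow> 'a form) \<Rightarrow> bool" where
  "left_invariant_LCP_solution \<A> G I \<phi> \<longleftrightarrow>
     (\<forall>t\<in>I. g2_structure \<A> (\<phi> t) \<and> left_invariant \<A> G (\<phi> t)) \<and> laplacian_LCP_flow \<A> I \<phi>"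


section \<open>Structure equations\<close>

definition structure_eqs :: "'a chart set \<Rightarrow> (nat \<Rightarrow> 'a form) \<Rightarrow> 'a form list \<Rightarrow> bool" where
  "structure_eqs \<A> e ds \<longleftrightarrow>
     length ds = 7 \<and> (\<forall>i\<in>{1..7}. form_eq \<A> (ext_deriv (e i)) (ds ! (i - 1)))"

definition cp2 :: "real \<Rightarrow> (nat \<Rightarrow> 'a form) \<Rightarrow> 'a form list" where
  "cp2 m e =
    [(- (4/3) * m) *\<^sub>f e\<up>[1,7] + (2/3 * m) *\<^sub>f e\<up>[3,6],
     (- m) *\<^sub>f e\<up>[2,7],
     (- (2/3) * m) *\<^sub>f e\<up>[3,7],
     (- m) *\<^sub>f e\<up>[4,7],
     (- m) *\<^sub>f e\<up>[5,7],
     (- (2/3) * m) *\<^sub>f e\<up>[6,7],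
     0]"

definition cp3 :: "real \<Rightarrow> (nat \<Rightarrow> 'a form) \<Rightarrow> 'a form list" where
  "cp3 m e =
    [(- (3/2) * m) *\<^sub>f e\<up>[1,7] + (1/2 * m) *\<^sub>f e\<up>[3,6] + (1/2 * m) *\<^sub>f e\<up>[4,5],
     (- m) *\<^sub>f e\<up>[2,7],
     (- (3/4) * m) *\<^sub>f e\<up>[3,7],
     (- (3/4) * m) *\<^sub>f e\<up>[4,7],
     (- (3/4) * m) *\<^sub>f e\<up>[5,7],
     (- (3/4) * m) *\<^sub>f e\<up>[6,7],
     0]"

definition cp4 :: "real \<Rightarrow> (nat \<Rightarrow> 'a form) \<Rightarrow> 'a form list" where
  "cp4 m e =
    [(- (7/5) * m) *\<^sub>f e\<up>[1,7] + (2/5 * m) *\<^sub>f e\<up>[3,6] + (2/5 * m) *\<^sub>f e\<up>[4,5],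
     (- (6/5) * m) *\<^sub>f e\<up>[2,7] - (2/5 * m) *\<^sub>f e\<up>[4,6],
     (- (4/5) * m) *\<^sub>f e\<up>[3,7],
     (- (3/5) * m) *\<^sub>f e\<up>[4,7],
     (- (4/5) * m) *\<^sub>f e\<up>[5,7],
     (- (3/5) * m) *\<^sub>f e\<up>[6,7],
     0]"

definition cp5 :: "real \<Rightarrow> (nat \<Rightarrow> 'a form) \<Rightarrow> 'a form list" where
  "cp5 m e =
    [(- (5/4) * m) *\<^sub>f e\<up>[1,7] + (1/2 * m) *\<^sub>f e\<up>[4,5],
     (- (5/4) * m) *\<^sub>f e\<up>[2,7] - (1/2 * m) *\<^sub>f e\<up>[4,6],
     (- m) *\<^sub>f e\<up>[3,7],
     (- (1/2) * m) *\<^sub>f e\<up>[4,7],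
     (- (3/4) * m) *\<^sub>f e\<up>[5,7],
     (- (3/4) * m) *\<^sub>f e\<up>[6,7],
     0]"

definition cp6 :: "real \<Rightarrow> (nat \<Rightarrow> 'a form) \<Rightarrow> 'a form list" where
  "cp6 m e =
    [(- (4/3) * m) *\<^sub>f e\<up>[1,7] + (1/3 * m) *\<^sub>f e\<up>[3,6] + (1/3 * m) *\<^sub>f e\<up>[4,5],
     (- (4/3) * m) *\<^sub>f e\<up>[2,7] + (1/3 * m) *\<^sub>f e\<up>[3,5] - (1/3 * m) *\<^sub>f e\<up>[4,6],
     (- (2/3) * m) *\<^sub>f e\<up>[3,7],
     (- (2/3) * m) *\<^sub>f e\<up>[4,7],
     (- (2/3) * m) *\<^sub>f e\<up>[5,7],
     (- (2/3) * m) *\<^sub>f e\<up>[6,7],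
     0]"

definition cp7 :: "real \<Rightarrow> (nat \<Rightarrow> 'a form) \<Rightarrow> 'a form list" where
  "cp7 m e =
    [(- (6/5) * m) *\<^sub>f e\<up>[1,7] + (2/5 * m) *\<^sub>f e\<up>[3,6],
     (- (3/5) * m) *\<^sub>f e\<up>[2,7],
     (- (3/5) * m) *\<^sub>f e\<up>[3,7],
     (2/5 * m) *\<^sub>f e\<up>[2,6] - (6/5 * m) *\<^sub>f e\<up>[4,7],
     (2/5 * m) *\<^sub>f e\<up>[2,3] - (6/5 * m) *\<^sub>f e\<up>[5,7],
     (- (3/5) * m) *\<^sub>f e\<up>[6,7],
     0]"

end

theory Submission
  imports Defs
begin

text \<open>
  Along the flow the coframe \<open>x\<^sup>i = s\<^bsup>q\<^sub>i\<^esup> e\<^sup>i\<close>, with \<open>s = 1 - \<kappa> m\<^sup>2 t\<close> and suitable weights \<open>q\<^sub>i\<close> with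
  \<open>q\<^sub>7 = 1/2\<close>, is adapted to \<open>\<phi>(t)\<close> and satisfies the structure equations of the same algebra with
  \<open>m\<close> replaced by \<open>m s\<^bsup>-1/2\<^esup>\<close>. In such a coframe \<open>d\<phi> = 3 m x\<^sup>7 \<and> \<phi>\<close> and \<open>d \<star>\<phi> = 4 m x\<^sup>7 \<and> \<star>\<phi>\<close>, and
  \<open>\<Delta>\<phi>\<close> is a combination of the seven monomials of \<open>\<phi>\<close> whose coefficients are \<open>- \<kappa> m\<^sup>2 / s\<close> times
  the exponents of \<open>s\<close> in these monomials, which is the derivative of \<open>\<phi>(t)\<close>.
  Computing \<open>\<star>\<close> in an adapted coframe requires that the metric and the orientation only depend on
  \<open>\<phi>\<close>: this follows from the identities of the seven-dimensional cross product.
\<close>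

section \<open>Exterior algebra\<close>

text \<open>All constants come from a self-similar ansatz. Let -p_i m be the coefficient of e^i
  \<and> e^7 in d e^i. In each of the six cases q_i = 1/2 + p_i/\<kappa> (with p_7 = 0): the coframe
  is moved by the automorphism e^i -> s^(p_i/\<kappa>) e^i and dilated by s^(1/2). A term e^j \<and>
  e^k in d e^i is respected by the automorphism because d d e^i = 0 forces p_i = p_j + p_k; the
  dilation then multiplies every structure constant by s^(-1/2). The coefficient of x^3 \<and> x^4
  \<and> x^7 in \<Delta>\<phi> gives \<kappa> = 2 (p_3 + p_4 - g), with g m the coefficient of e^2
  \<and> e^6 in d e^4.

  The obstacle is that \<open>g2_metric\<close>, \<open>g2_volume\<close> and \<open>hodge\<close>
  are definite descriptions, so no star can be computed before uniqueness is proved. Two adapted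
  coframes differ by a linear map preserving a triple product, which has to be shown orthogonal. The
  orientation then follows because \<star>\<phi> can be written through \<phi> and the metric
  alone.\<close>

lemma linear_cmult:
  fixes f :: "'a::real_vector \<Rightarrow> real"
  assumes "linear f"
  shows "linear (\<lambda>v. c * f v)"
  using linear_compose_scale_right[OF assms, of c] by simp

definition ext_scale :: "real \<Rightarrow> ext \<Rightarrow> ext" (infixr \<open>*\<^sub>e\<close> 75) where
  "r *\<^sub>e \<omega> = (\<lambda>vs. r * \<omega> vs)"

text \<open>The interior product. Identities between wedge products are proved below by induction on
  the argument list, where peeling off the first vector replaces a form by its contraction.\<close>

definition contract :: "real^7 \<Rightarrow> ext \<Rightarrow> ext" where
  "contract v \<omega> = (\<lambda>vs. \<omega> (v # vs))"

lemma ext_scale_apply [simp]: "(r *\<^sub>e \<omega>) vs = r * \<omega> vs"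
  by (simp add: ext_scale_def)

lemma contract_apply [simp]: "contract v \<omega> vs = \<omega> (v # vs)"
  by (simp add: contract_def)

lemma ext_scale_minus_one: "(- 1) *\<^sub>e \<omega> = - \<omega>"
  by (rule ext) simp

lemma contract_linear [simp]:
  "contract v (\<alpha> + \<beta>) = contract v \<alpha> + contract v \<beta>"
  "contract v (r *\<^sub>e \<alpha>) = r *\<^sub>e contract v \<alpha>"
  "contract v 0 = 0"
  by (auto simp: contract_def ext_scale_def)

lemma wedge1_Nil [simp]: "wedge1 \<alpha> \<omega> [] = 0"
  by (simp add: wedge1_def)

text \<open>The interior product is an antiderivation: the summand i = 0 pairs \<open>v\<close> with
  \<alpha>, and shifting the index of the others costs a sign.\<close>

lemma wedge1_Cons:
  "wedge1 \<alpha> \<omega> (v # vs) = \<alpha> [v] * \<omega> vs - wedge1 \<alpha> (contract v \<omega>) vs"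
  unfolding wedge1_def contract_def
  by (simp del: sum.lessThan_Suc add: sum.lessThan_Suc_shift sum_negf[symmetric])

lemma wedge1_add_right [simp]: "wedge1 \<alpha> (\<omega> + \<eta>) = wedge1 \<alpha> \<omega> + wedge1 \<alpha> \<eta>"
  by (rule ext) (simp add: wedge1_def sum.distrib algebra_simps)

lemma wedge1_scale_right [simp]: "wedge1 \<alpha> (r *\<^sub>e \<omega>) = r *\<^sub>e wedge1 \<alpha> \<omega>"
  by (rule ext) (simp add: wedge1_def sum_distrib_left algebra_simps)

lemma wedge1_zero_right [simp]: "wedge1 \<alpha> 0 = 0"
  by (rule ext) (simp add: wedge1_def)

lemma wedge1_uminus_right [simp]: "wedge1 \<alpha> (- \<omega>) = - wedge1 \<alpha> \<omega>"
  by (rule ext) (simp add: wedge1_def sum_negf)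

lemma wedge1_diff_right [simp]: "wedge1 \<alpha> (\<omega> - \<eta>) = wedge1 \<alpha> \<omega> - wedge1 \<alpha> \<eta>"
  by (rule ext) (simp add: wedge1_def sum_subtractf algebra_simps)

lemma wedge1_add_left: "wedge1 (\<alpha> + \<beta>) \<omega> = wedge1 \<alpha> \<omega> + wedge1 \<beta> \<omega>"
  by (rule ext) (simp add: wedge1_def sum.distrib algebra_simps)

lemma wedge1_scale_left: "wedge1 (r *\<^sub>e \<alpha>) \<omega> = r *\<^sub>e wedge1 \<alpha> \<omega>"
  by (rule ext) (simp add: wedge1_def sum_distrib_left algebra_simps)

lemma wedge1_cong_left:
  "(\<And>v. \<alpha> [v] = \<beta> [v]) \<Longrightarrow> wedge1 \<alpha> \<omega> = wedge1 \<beta> \<omega>"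
  by (rule ext) (simp add: wedge1_def)

lemma contract_wedge1: "contract v (wedge1 \<alpha> \<omega>) = \<alpha> [v] *\<^sub>e \<omega> - wedge1 \<alpha> (contract v \<omega>)"
  by (rule ext) (simp add: wedge1_Cons)

text \<open>Peeling off \<open>v\<close> yields \<open>\<alpha> [v]\<close> times \<beta> \<and>
  \<omega> minus \<open>\<beta> [v]\<close> times \<alpha> \<and> \<omega>, which is antisymmetric
  in \<alpha> and \<beta>, plus the same double wedge for \<open>contract v \<omega>\<close>; hence
  \<omega> is arbitrary in the induction.\<close>

lemma wedge1_anticommute: "wedge1 \<alpha> (wedge1 \<beta> \<omega>) = - wedge1 \<beta> (wedge1 \<alpha> \<omega>)"
proof -
  have "wedge1 \<alpha> (wedge1 \<beta> \<omega>) vs = - wedge1 \<beta> (wedge1 \<alpha> \<omega>) vs" for vs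
    by (induction vs arbitrary: \<omega>) (simp_all add: wedge1_Cons contract_wedge1)
  thus ?thesis by (simp add: fun_eq_iff)
qed

lemma wedge1_self [simp]: "wedge1 \<alpha> (wedge1 \<alpha> \<omega>) = 0"
proof -
  have "wedge1 \<alpha> (wedge1 \<alpha> \<omega>) vs = 0" for vs
    using fun_cong[OF wedge1_anticommute[of \<alpha> \<alpha> \<omega>], of vs] by simp
  thus ?thesis by (simp add: fun_eq_iff)
qed

text \<open>Pullback along \<open>f\<close> commutes with the wedge. Through
  \<open>ext_mono_map\<close>, chart changes and left translations of a monomial reduce to those of
  its covectors.\<close>

lemma wedge1_map:
  "wedge1 \<alpha> \<omega> (map f vs) = wedge1 (\<lambda>us. \<alpha> (map f us)) (\<lambda>us. \<omega> (map f us)) vs"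
  by (simp add: wedge1_def take_map drop_map)

lemma wedge1_snoc:
  "wedge1 \<alpha> \<omega> (vs @ [v]) =
     (-1) ^ length vs * \<alpha> [v] * \<omega> vs + wedge1 \<alpha> (\<lambda>us. \<omega> (us @ [v])) vs"
proof (induction vs arbitrary: \<omega>)
  case (Cons u us)
  show ?case
    by (simp add: wedge1_Cons Cons.IH contract_def)
qed (simp add: wedge1_Cons)

lemma ext_mono_Nil [simp]: "ext_mono x [] = ext_one"
  and ext_mono_Cons: "ext_mono x (i # is) = wedge1 (x i) (ext_mono x is)"
  by (simp_all add: ext_mono_def)

lemma ext_mono_map:
  "ext_mono x is (map f vs) = ext_mono (\<lambda>i us. x i (map f us)) is vs"
proof (induction "is" arbitrary: vs)
  case (Cons i "is")
  show ?case
    by (simp add: ext_mono_Cons wedge1_map Cons.IH)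
qed (simp add: ext_one_def)

lemma ext_mono_cong:
  "(\<And>i. i \<in> set is \<Longrightarrow> x i = y i) \<Longrightarrow> ext_mono x is = ext_mono y is"
  by (induction "is") (auto simp: ext_mono_Cons)

lemma ext_mono_scale:
  "ext_mono (\<lambda>i. f i *\<^sub>e x i) is = (\<Prod>i\<leftarrow>is. f i) *\<^sub>e ext_mono x is"
proof (induction "is")
  case (Cons i "is")
  show ?case
    unfolding ext_mono_Cons Cons.IH wedge1_scale_left wedge1_scale_right
    by (simp add: fun_eq_iff)
qed (simp add: fun_eq_iff)

lemma ext_mono_repeated: "i \<in> set is \<Longrightarrow> wedge1 (x i) (ext_mono x is) = 0"
proof (induction "is")
  case (Cons j "is")
  show ?case
  proof (cases "i = j")
    case False
    with Cons.prems have "i \<in> set is" by simp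
    note zero = Cons.IH[OF this]
    have "wedge1 (x i) (ext_mono x (j # is)) = - wedge1 (x j) (wedge1 (x i) (ext_mono x is))"
      unfolding ext_mono_Cons by (rule wedge1_anticommute)
    then show ?thesis unfolding zero by simp
  qed (simp add: ext_mono_Cons)
qed simp


subsection \<open>Alternating forms\<close>

text \<open>
  A recursive description of alternating forms: contracting the first argument lowers the degree,
  and it is enough to test linearity and antisymmetry at the front of the list.
\<close>

primrec alt :: "nat \<Rightarrow> ext \<Rightarrow> bool" where
  "alt 0 \<omega> \<longleftrightarrow> (\<forall>vs. vs \<noteq> [] \<longrightarrow> \<omega> vs = 0)"
| "alt (Suc k) \<omega> \<longleftrightarrow> \<omega> [] = 0 \<and> (\<forall>v. alt k (contract v \<omega>)) \<and>
     (\<forall>vs. linear (\<lambda>v. \<omega> (v # vs))) \<and> (\<forall>v w vs. \<omega> (v # w # vs) = - \<omega> (w # v # vs))"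

lemma alt_Suc_intro:
  assumes "\<omega> [] = 0" "\<And>v. alt k (contract v \<omega>)" "\<And>vs. linear (\<lambda>v. \<omega> (v # vs))"
    "\<And>v w vs. \<omega> (v # w # vs) = - \<omega> (w # v # vs)"
  shows "alt (Suc k) \<omega>"
  unfolding alt.simps using assms by blast

lemma alt_Suc_dest:
  assumes "alt (Suc k) \<omega>"
  shows "\<omega> [] = 0" "alt k (contract v \<omega>)" "linear (\<lambda>v. \<omega> (v # vs))"
    "\<omega> (v # w # vs) = - \<omega> (w # v # vs)"
  using assms unfolding alt.simps by blast+

declare alt.simps(2) [simp del]

lemma alt_length: "alt k \<omega> \<Longrightarrow> length vs \<noteq> k \<Longrightarrow> \<omega> vs = 0"
proof (induction k arbitrary: \<omega> vs)
  case (Suc k)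
  show ?case
  proof (cases vs)
    case (Cons u us)
    with Suc.prems have "contract u \<omega> us = 0"
      by (intro Suc.IH alt_Suc_dest) auto
    with Cons show ?thesis by simp
  qed (use Suc.prems alt_Suc_dest(1) in blast)
qed simp

lemma alt_linear: "alt k \<omega> \<Longrightarrow> i < k \<Longrightarrow> length vs = k \<Longrightarrow> linear (\<lambda>v. \<omega> (vs[i := v]))"
proof (induction k arbitrary: \<omega> vs i)
  case (Suc k)
  obtain u us where vs: "vs = u # us" using Suc.prems by (cases vs) auto
  show ?case
  proof (cases i)
    case 0
    with vs alt_Suc_dest(3)[OF Suc.prems(1)] show ?thesis by simp
  next
    case (Suc j)
    have "linear (\<lambda>v. contract u \<omega> (us[j := v]))"
      by (rule Suc.IH[OF alt_Suc_dest(2)[OF Suc.prems(1)]]) (use Suc.prems vs Suc in auto)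
    with vs Suc show ?thesis by simp
  qed
qed simp

text \<open>Swapping \<open>v\<close> with its successor either shows the value to be its own
  negative or moves \<open>v\<close> one step towards its second occurrence, inside a contraction of
  lower degree.\<close>

lemma alt_mem: "alt (Suc k) \<omega> \<Longrightarrow> v \<in> set vs \<Longrightarrow> \<omega> (v # vs) = 0"
proof (induction vs arbitrary: \<omega> k)
  case (Cons w ws)
  have swap: "\<omega> (v # w # ws) = - \<omega> (w # v # ws)"
    using alt_Suc_dest(4)[OF Cons.prems(1)] .
  show ?case
  proof (cases "v = w")
    case True
    with swap show ?thesis by simp
  next
    case False
    then have v: "v \<in> set ws" using Cons.prems by auto
    show ?thesis
    proof (cases k)
      case 0
      then show ?thesis using alt_length[OF Cons.prems(1)] by simp
    next
      case (Suc k')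
      then have "contract w \<omega> (v # ws) = 0"
        using Cons.IH[OF _ v] alt_Suc_dest(2)[OF Cons.prems(1)] by blast
      with swap show ?thesis by simp
    qed
  qed
qed simp

lemma alt_repeated: "alt k \<omega> \<Longrightarrow> \<not> distinct vs \<Longrightarrow> \<omega> vs = 0"
proof (induction k arbitrary: \<omega> vs)
  case 0
  then show ?case by (cases vs) auto
next
  case (Suc k)
  then obtain u us where vs: "vs = u # us" by (cases vs) auto
  show ?case
  proof (cases "u \<in> set us")
    case True
    with alt_mem Suc.prems vs show ?thesis by blast
  next
    case False
    with Suc.prems vs have "contract u \<omega> us = 0" by (intro Suc.IH alt_Suc_dest) auto
    with vs show ?thesis by simp
  qed
qed

lemma alt_imp_alternating_form: "alt k \<omega> \<Longrightarrow> alternating_form k \<omega>"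
  unfolding alternating_form_def
proof (intro conjI allI impI; (elim conjE)?)
  fix vs :: "(real^7) list" and i j
  assume "alt k \<omega>" "length vs = k" "i < j" "j < k" "vs ! i = vs ! j"
  then show "\<omega> vs = 0"
    by (intro alt_repeated) (auto simp: distinct_conv_nth dest: order.strict_trans)
qed (auto intro: alt_length alt_linear)

lemma alt_add: "alt k \<alpha> \<Longrightarrow> alt k \<beta> \<Longrightarrow> alt k (\<alpha> + \<beta>)"
proof (induction k arbitrary: \<alpha> \<beta>)
  case (Suc k)
  note dest = alt_Suc_dest[OF Suc.prems(1)] alt_Suc_dest[OF Suc.prems(2)]
  show ?case
  proof (rule alt_Suc_intro)
    show "alt k (contract v (\<alpha> + \<beta>))" for v
      unfolding contract_linear by (intro Suc.IH dest)
    show "(\<alpha> + \<beta>) (v # w # vs) = - (\<alpha> + \<beta>) (w # v # vs)" for v w vs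
      using dest(4)[of v w vs] dest(8)[of v w vs] by simp
    show "linear (\<lambda>v. (\<alpha> + \<beta>) (v # vs))" for vs
      using linear_compose_add[OF dest(3)[of vs] dest(7)[of vs]] by simp
  qed (simp add: dest(1) dest(5))
qed simp

lemma alt_scale: "alt k \<alpha> \<Longrightarrow> alt k (r *\<^sub>e \<alpha>)"
proof (induction k arbitrary: \<alpha>)
  case (Suc k)
  note dest = alt_Suc_dest[OF Suc.prems]
  show ?case
  proof (rule alt_Suc_intro)
    show "alt k (contract v (r *\<^sub>e \<alpha>))" for v
      unfolding contract_linear by (intro Suc.IH dest)
    show "(r *\<^sub>e \<alpha>) (v # w # vs) = - (r *\<^sub>e \<alpha>) (w # v # vs)" for v w vs
      using dest(4)[of v w vs] by simp
    show "linear (\<lambda>v. (r *\<^sub>e \<alpha>) (v # vs))" for vs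
      using linear_cmult[OF dest(3)[of vs], of r] by simp
  qed (simp add: dest(1))
qed simp

lemma alt_uminus: "alt k \<alpha> \<Longrightarrow> alt k (- \<alpha>)"
  using alt_scale[of k \<alpha> "-1"] by (simp add: ext_scale_minus_one)

lemma alt_diff: "alt k \<alpha> \<Longrightarrow> alt k \<beta> \<Longrightarrow> alt k (\<alpha> - \<beta>)"
  using alt_add[OF _ alt_uminus, of k \<alpha> \<beta>] by simp

lemma alt_ext_one: "alt 0 ext_one"
  by (simp add: ext_one_def)

text \<open>Induction on the degree by the antiderivation rule: both terms of the contracted product
  have the right degree, the second by the induction hypothesis for
  \<open>contract v \<omega>\<close>.\<close>

lemma alt_wedge1:
  assumes "linear (\<lambda>v. \<alpha> [v])"
  shows "alt k \<omega> \<Longrightarrow> alt (Suc k) (wedge1 \<alpha> \<omega>)"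
proof (induction k arbitrary: \<omega>)
  case 0
  then have zero: "contract v \<omega> = 0" for v by (auto simp: contract_def)
  then have Cons: "wedge1 \<alpha> \<omega> (v # vs) = \<alpha> [v] * \<omega> vs" for v vs
    by (simp only: wedge1_Cons wedge1_zero_right) simp
  show ?case
  proof (rule alt_Suc_intro)
    show "alt 0 (contract v (wedge1 \<alpha> \<omega>))" for v
      using 0 by (simp add: Cons)
    show "linear (\<lambda>v. wedge1 \<alpha> \<omega> (v # vs))" for vs
      using linear_cmult[OF assms, of "\<omega> vs"] by (simp add: Cons mult.commute)
  qed (use 0 in \<open>auto simp: Cons\<close>)
next
  case (Suc k)
  note dest = alt_Suc_dest[OF Suc.prems]
  have swap: "contract v (contract w \<omega>) = - contract w (contract v \<omega>)" for v w
    by (rule ext) (use dest(4)[of w v] in simp)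
  have lin: "linear (\<lambda>v. wedge1 \<alpha> (contract v \<omega>) vs)" for vs
    unfolding wedge1_def contract_def by (intro linear_compose_sum ballI linear_cmult dest(3))
  have lin': "linear (\<lambda>v. \<alpha> [v] * c)" for c
    using linear_cmult[OF assms, of c] by (simp add: mult.commute)
  show ?case
  proof (rule alt_Suc_intro)
    show "alt (Suc k) (contract v (wedge1 \<alpha> \<omega>))" for v
      unfolding contract_wedge1 by (intro alt_diff alt_scale Suc.IH Suc.prems dest)
    show "linear (\<lambda>v. wedge1 \<alpha> \<omega> (v # vs))" for vs
      unfolding wedge1_Cons by (intro linear_compose_sub lin' lin)
    show "wedge1 \<alpha> \<omega> (v # w # vs) = - wedge1 \<alpha> \<omega> (w # v # vs)" for v w vs
      unfolding wedge1_Cons contract_wedge1 swap[of w v] wedge1_uminus_right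
      by (simp add: wedge1_Cons)
  qed simp
qed

lemma alternating_form_1_linear: "alternating_form 1 \<alpha> \<Longrightarrow> linear (\<lambda>v. \<alpha> [v])"
proof -
  assume "alternating_form 1 \<alpha>"
  then have "\<forall>vs. \<forall>i<1. length vs = 1 \<longrightarrow> linear (\<lambda>v. \<alpha> (vs[i := v]))"
    unfolding alternating_form_def by blast
  from this[rule_format, of 0 "[0]"] show ?thesis by simp
qed

lemma alt_ext_mono:
  "(\<And>i. i \<in> set is \<Longrightarrow> alternating_form 1 (x i)) \<Longrightarrow> alt (length is) (ext_mono x is)"
  by (induction "is")
    (simp_all add: ext_mono_Cons alt_ext_one alt_wedge1 alternating_form_1_linear del: alt.simps(1))


subsection \<open>Exterior derivative\<close>

definition ed :: "(real^7 \<Rightarrow> ext) \<Rightarrow> real^7 \<Rightarrow> ext" where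
  "ed F x = (\<lambda>vs. \<Sum>i<length vs.
     (-1) ^ i * frechet_derivative (\<lambda>y. F y (take i vs @ drop (Suc i) vs)) (at x) (vs ! i))"

lemma ext_deriv_eq_ed: "ext_deriv \<omega> C x = ed (\<omega> C) x"
  by (simp add: ext_deriv_def ed_def)

lemma ed_Nil [simp]: "ed F x [] = 0"
  by (simp add: ed_def)

text \<open>Cartan's formula for the constant vector field \<open>v\<close>, whose Lie derivative is
  the directional derivative.\<close>

lemma ed_Cons:
  "ed F x (v # vs) =
     frechet_derivative (\<lambda>y. F y vs) (at x) v - ed (\<lambda>y. contract v (F y)) x vs"
  unfolding ed_def contract_def
  by (simp del: sum.lessThan_Suc add: sum.lessThan_Suc_shift sum_negf[symmetric])

text \<open>\<open>frechet_derivative\<close> is chosen by the predicate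
  \<open>has_derivative\<close>, so fields that agree near \<open>x\<close> have equal derivatives
  whether or not these exist.\<close>

lemma ed_cong:
  assumes "open S" "x \<in> S" "\<And>y. y \<in> S \<Longrightarrow> F y = G y"
  shows "ed F x = ed G x"
proof -
  have "frechet_derivative (\<lambda>y. F y vs) (at x) = frechet_derivative (\<lambda>y. G y vs) (at x)" for vs
  proof -
    have "((\<lambda>y. F y vs) has_derivative D) (at x) \<longleftrightarrow> ((\<lambda>y. G y vs) has_derivative D) (at x)" for D
      using assms by (auto elim!: has_derivative_transform_within_open)
    then show ?thesis unfolding frechet_derivative_def by simp
  qed
  then show ?thesis unfolding ed_def by simp
qed

definition ext_differentiable :: "(real^7 \<Rightarrow> ext) \<Rightarrow> real^7 \<Rightarrow> bool" where
  "ext_differentiable F x \<longleftrightarrow> (\<forall>vs. (\<lambda>y. F y vs) differentiable (at x))"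

lemma ext_differentiable_add:
  "ext_differentiable F x \<Longrightarrow> ext_differentiable G x \<Longrightarrow> ext_differentiable (\<lambda>y. F y + G y) x"
  by (simp add: ext_differentiable_def)

lemma ext_differentiable_diff:
  "ext_differentiable F x \<Longrightarrow> ext_differentiable G x \<Longrightarrow> ext_differentiable (\<lambda>y. F y - G y) x"
  by (simp add: ext_differentiable_def)

lemma ext_differentiable_scale:
  "ext_differentiable F x \<Longrightarrow> ext_differentiable (\<lambda>y. r *\<^sub>e F y) x"
  by (simp add: ext_differentiable_def)

lemma ext_differentiable_const: "ext_differentiable (\<lambda>y. \<alpha>) x"
  by (simp add: ext_differentiable_def)

lemma ext_differentiable_wedge1:
  "ext_differentiable a x \<Longrightarrow> ext_differentiable F x \<Longrightarrow>
     ext_differentiable (\<lambda>y. wedge1 (a y) (F y)) x"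
  unfolding ext_differentiable_def wedge1_def by (auto intro!: derivative_intros)

lemma ext_differentiable_ext_mono:
  "(\<And>i. i \<in> set is \<Longrightarrow> ext_differentiable (X i) x) \<Longrightarrow>
     ext_differentiable (\<lambda>y. ext_mono (\<lambda>i. X i y) is) x"
  by (induction "is")
    (auto simp: ext_mono_Cons ext_differentiable_const intro!: ext_differentiable_wedge1)

lemma frechet_derivative_eqI:
  assumes "(f has_derivative f') (at x)" "f' v = w"
  shows "frechet_derivative f (at x) v = w"
  using frechet_derivative_at[OF assms(1)] assms(2) by simp

lemma frechet_derivative_cmult:
  fixes f :: "'a::real_normed_vector \<Rightarrow> real"
  assumes "f differentiable (at x)"
  shows "frechet_derivative (\<lambda>y. r * f y) (at x) v = r * frechet_derivative f (at x) v"
  by (rule frechet_derivative_eqI[where f' = "\<lambda>v. r * frechet_derivative f (at x) v"])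
    (use assms in \<open>auto intro!: derivative_eq_intros simp: frechet_derivative_works\<close>)

lemma frechet_derivative_add_real:
  fixes f g :: "'a::real_normed_vector \<Rightarrow> real"
  assumes "f differentiable (at x)" "g differentiable (at x)"
  shows "frechet_derivative (\<lambda>y. f y + g y) (at x) v =
    frechet_derivative f (at x) v + frechet_derivative g (at x) v"
  by (rule frechet_derivative_eqI[where f' = "\<lambda>v. frechet_derivative f (at x) v + frechet_derivative g (at x) v"])
    (use assms in \<open>auto intro!: derivative_eq_intros simp: frechet_derivative_works\<close>)

lemma ed_add:
  assumes "ext_differentiable F x" "ext_differentiable G x"
  shows "ed (\<lambda>y. F y + G y) x = ed F x + ed G x"
  using assms unfolding ed_def ext_differentiable_def
  by (auto simp: fun_eq_iff frechet_derivative_add_real sum.distrib algebra_simps)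

lemma ed_scale:
  assumes "ext_differentiable F x"
  shows "ed (\<lambda>y. r *\<^sub>e F y) x = r *\<^sub>e ed F x"
  using assms unfolding ed_def ext_differentiable_def
  by (auto simp: fun_eq_iff frechet_derivative_cmult sum_distrib_left algebra_simps)

lemma ed_diff:
  assumes "ext_differentiable F x" "ext_differentiable G x"
  shows "ed (\<lambda>y. F y - G y) x = ed F x - ed G x"
  using ed_add[OF assms(1) ext_differentiable_scale[OF assms(2), of "-1"]]
  by (simp add: ed_scale[OF assms(2)]) (simp add: fun_eq_iff ext_scale_def fun_diff_def plus_fun_def)

text \<open>Product of a 2-form with a form, given by the derivation rule for contractions. The
  Leibniz rule for a covector field \<open>a\<close> involves the 2-form
  \<open>ed a x\<close>.\<close>

fun wedge2 :: "ext \<Rightarrow> ext \<Rightarrow> ext" where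
  "wedge2 \<beta> \<omega> [] = 0"
| "wedge2 \<beta> \<omega> (v # vs) = wedge1 (contract v \<beta>) \<omega> vs + wedge2 \<beta> (contract v \<omega>) vs"

lemma wedge2_add_left [simp]: "wedge2 (\<alpha> + \<beta>) \<omega> = wedge2 \<alpha> \<omega> + wedge2 \<beta> \<omega>"
proof -
  have "wedge2 (\<alpha> + \<beta>) \<omega> vs = wedge2 \<alpha> \<omega> vs + wedge2 \<beta> \<omega> vs" for vs
    by (induction vs arbitrary: \<omega>) (simp_all add: wedge1_add_left)
  then show ?thesis by (simp add: fun_eq_iff)
qed

lemma wedge2_scale_left [simp]: "wedge2 (r *\<^sub>e \<alpha>) \<omega> = r *\<^sub>e wedge2 \<alpha> \<omega>"
proof -
  have "wedge2 (r *\<^sub>e \<alpha>) \<omega> vs = r * wedge2 \<alpha> \<omega> vs" for vs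
    by (induction vs arbitrary: \<omega>) (simp_all add: wedge1_scale_left algebra_simps)
  then show ?thesis by (simp add: fun_eq_iff)
qed

lemma wedge2_zero_left [simp]: "wedge2 0 \<omega> = 0"
  using wedge2_scale_left[of 0 0 \<omega>] by (simp add: ext_scale_def zero_fun_def)

text \<open>Once the structure equations write the derivative of a covector field through products
  of two covectors, this removes \<open>wedge2\<close> from the Leibniz rule.\<close>

lemma wedge2_wedge1:
  "wedge2 (wedge1 \<alpha> (wedge1 \<beta> ext_one)) \<omega> = wedge1 \<alpha> (wedge1 \<beta> \<omega>)"
proof -
  have "wedge1 (contract v (wedge1 \<alpha> (wedge1 \<beta> ext_one))) \<omega> vs =
        \<alpha> [v] * wedge1 \<beta> \<omega> vs - \<beta> [v] * wedge1 \<alpha> \<omega> vs" for v \<omega> vs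
  proof -
    have "wedge1 (contract v (wedge1 \<alpha> (wedge1 \<beta> ext_one))) \<omega> =
          wedge1 (\<alpha> [v] *\<^sub>e \<beta> + (- \<beta> [v]) *\<^sub>e \<alpha>) \<omega>"
      by (rule wedge1_cong_left) (simp add: wedge1_Cons ext_one_def)
    then show ?thesis by (simp add: wedge1_add_left wedge1_scale_left)
  qed
  then have "wedge2 (wedge1 \<alpha> (wedge1 \<beta> ext_one)) \<omega> vs = wedge1 \<alpha> (wedge1 \<beta> \<omega>) vs" for vs
    by (induction vs arbitrary: \<omega>) (simp_all add: wedge1_Cons contract_wedge1 del: contract_apply)
  then show ?thesis by (simp add: fun_eq_iff)
qed

lemma frechet_derivative_mult_real:
  fixes f g :: "'a::real_normed_vector \<Rightarrow> real"
  assumes "f differentiable (at x)" "g differentiable (at x)"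
  shows "frechet_derivative (\<lambda>y. f y * g y) (at x) v =
    f x * frechet_derivative g (at x) v + frechet_derivative f (at x) v * g x"
  by (rule frechet_derivative_eqI[where f' = "\<lambda>v. f x * frechet_derivative g (at x) v + frechet_derivative f (at x) v * g x"])
    (use assms in \<open>auto intro!: derivative_eq_intros simp: frechet_derivative_works\<close>)

lemma frechet_derivative_wedge1:
  assumes "ext_differentiable a x" "ext_differentiable F x"
  shows "frechet_derivative (\<lambda>y. wedge1 (a y) (F y) vs) (at x) v =
    wedge1 (\<lambda>us. frechet_derivative (\<lambda>y. a y us) (at x) v) (F x) vs +
    wedge1 (a x) (\<lambda>us. frechet_derivative (\<lambda>y. F y us) (at x) v) vs"
proof -
  have "((\<lambda>y. wedge1 (a y) (F y) vs) has_derivative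
    (\<lambda>v. wedge1 (\<lambda>us. frechet_derivative (\<lambda>y. a y us) (at x) v) (F x) vs +
    wedge1 (a x) (\<lambda>us. frechet_derivative (\<lambda>y. F y us) (at x) v) vs)) (at x)"
    using assms unfolding ext_differentiable_def wedge1_def
    by (auto intro!: derivative_eq_intros simp: frechet_derivative_works sum.distrib algebra_simps)
  then show ?thesis by (rule frechet_derivative_eqI) simp
qed

text \<open>The covector dg is encoded through \<open>us ! 0\<close>, which suffices because
  \<open>wedge1\<close> evaluates its left factor on singletons only.\<close>

lemma ed_function_mult:
  assumes "g differentiable (at x)" "ext_differentiable F x"
  shows "ed (\<lambda>y. g y *\<^sub>e F y) x =
    wedge1 (\<lambda>us. frechet_derivative g (at x) (us ! 0)) (F x) + g x *\<^sub>e ed F x"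
  using assms unfolding ed_def ext_differentiable_def wedge1_def
  by (auto simp: fun_eq_iff frechet_derivative_mult_real sum.distrib sum_distrib_left algebra_simps)

text \<open>Contract with the first vector \<open>v\<close>: the term \<open>a y [v]\<close> times
  \<open>F y\<close> obeys the rule for a function factor, the term with
  \<open>contract v (F y)\<close> the induction hypothesis, so \<open>F\<close> has to be
  arbitrary.\<close>

lemma ed_wedge1:
  assumes a: "ext_differentiable a x" and F: "ext_differentiable F x"
  shows "ed (\<lambda>y. wedge1 (a y) (F y)) x = wedge2 (ed a x) (F x) - wedge1 (a x) (ed F x)"
proof -
  have "ed (\<lambda>y. wedge1 (a y) (F y)) x vs =
      wedge2 (ed a x) (F x) vs - wedge1 (a x) (ed F x) vs" for vs
    using F
  proof (induction vs arbitrary: F)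
    case (Cons v vs)
    have iF: "ext_differentiable (\<lambda>y. contract v (F y)) x"
      using Cons.prems by (simp add: ext_differentiable_def)
    have av: "(\<lambda>y. a y [v]) differentiable (at x)"
      using a by (simp add: ext_differentiable_def)
    have "ed (\<lambda>y. contract v (wedge1 (a y) (F y))) x vs =
        wedge1 (\<lambda>us. frechet_derivative (\<lambda>y. a y [v]) (at x) (us ! 0)) (F x) vs
        + a x [v] * ed F x vs
        - (wedge2 (ed a x) (contract v (F x)) vs - wedge1 (a x) (ed (\<lambda>y. contract v (F y)) x) vs)"
      unfolding contract_wedge1
      by (subst ed_diff)
        (auto intro!: ext_differentiable_wedge1 a iF Cons.prems
          simp: ed_function_mult[OF av Cons.prems] Cons.IH[OF iF],
         use av Cons.prems in \<open>auto simp: ext_differentiable_def contract_def\<close>)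
    \<comment> \<open>Cartan's formula for the covector field \<open>a\<close>: contracting da with
      \<open>v\<close> gives the derivative of \<open>a\<close> along \<open>v\<close> minus the
      differential of \<open>a y [v]\<close>.\<close>
    moreover have "wedge1 (contract v (ed a x)) (F x) vs =
        wedge1 (\<lambda>us. frechet_derivative (\<lambda>y. a y us) (at x) v) (F x) vs -
        wedge1 (\<lambda>us. frechet_derivative (\<lambda>y. a y [v]) (at x) (us ! 0)) (F x) vs"
      by (simp add: wedge1_def ed_Cons sum_subtractf algebra_simps)
    moreover have "contract v (ed F x) =
        (\<lambda>us. frechet_derivative (\<lambda>y. F y us) (at x) v) - ed (\<lambda>y. contract v (F y)) x"
      by (simp add: fun_eq_iff ed_Cons)
    ultimately show ?case
      by (simp add: ed_Cons frechet_derivative_wedge1[OF a Cons.prems] wedge1_Cons del: contract_apply)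
  qed simp
  then show ?thesis by (simp add: fun_eq_iff)
qed


subsection \<open>Frames\<close>

lemma sum_1_7: "(\<Sum>i=1..7::nat. f i) = f 1 + f 2 + f 3 + f 4 + f 5 + f 6 + (f 7 :: 'b::comm_monoid_add)"
  by (simp add: eval_nat_numeral add.assoc)

lemma ball_1_7: "(\<forall>i\<in>{1..7::nat}. P i) \<longleftrightarrow> P 1 \<and> P 2 \<and> P 3 \<and> P 4 \<and> P 5 \<and> P 6 \<and> P 7"
proof -
  have "{1..7::nat} = {1, 2, 3, 4, 5, 6, 7}" by auto
  then show ?thesis by simp
qed

lemma exhaust_7:
  fixes i :: 7
  shows "i = 1 \<or> i = 2 \<or> i = 3 \<or> i = 4 \<or> i = 5 \<or> i = 6 \<or> i = 7"
proof (induct i)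
  case (of_int z)
  then have "z = 0 \<or> z = 1 \<or> z = 2 \<or> z = 3 \<or> z = 4 \<or> z = 5 \<or> z = 6" by fastforce
  then show ?case by auto
qed

lemma forall_7: "(\<forall>i::7. P i) \<longleftrightarrow> P 1 \<and> P 2 \<and> P 3 \<and> P 4 \<and> P 5 \<and> P 6 \<and> P 7"
  by (metis exhaust_7)

lemma UNIV_7: "UNIV = {1, 2, 3, 4, 5, 6, 7::7}"
  using exhaust_7 by auto

lemma sum_7: "sum f (UNIV::7 set) = f 1 + f 2 + f 3 + f 4 + f 5 + f 6 + f 7"
  unfolding UNIV_7 by (simp add: ac_simps)

lemma vector_7 [simp]:
  "(vector [a, b, c, d, e, f, g] :: real^7) $ 1 = a"
  "(vector [a, b, c, d, e, f, g] :: real^7) $ 2 = b"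
  "(vector [a, b, c, d, e, f, g] :: real^7) $ 3 = c"
  "(vector [a, b, c, d, e, f, g] :: real^7) $ 4 = d"
  "(vector [a, b, c, d, e, f, g] :: real^7) $ 5 = e"
  "(vector [a, b, c, d, e, f, g] :: real^7) $ 6 = f"
  "(vector [a, b, c, d, e, f, g] :: real^7) $ 7 = g"
  unfolding vector_def by simp_all

definition coords :: "(nat \<Rightarrow> ext) \<Rightarrow> real^7 \<Rightarrow> real^7" where
  "coords x v = vector [x 1 [v], x 2 [v], x 3 [v], x 4 [v], x 5 [v], x 6 [v], x 7 [v]]"

lemma coords_nth [simp]:
  "coords x v $ 1 = x 1 [v]" "coords x v $ 2 = x 2 [v]" "coords x v $ 3 = x 3 [v]"
  "coords x v $ 4 = x 4 [v]" "coords x v $ 5 = x 5 [v]" "coords x v $ 6 = x 6 [v]"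
  "coords x v $ 7 = x 7 [v]"
  by (simp_all add: coords_def)

lemma inner_7:
  "(u :: real^7) \<bullet> v = u$1 * v$1 + u$2 * v$2 + u$3 * v$3 + u$4 * v$4 + u$5 * v$5 + u$6 * v$6 + u$7 * v$7"
  by (simp add: inner_vec_def sum_7)

lemma covector_basis_linear:
  assumes "covector_basis x" "i \<in> {1..7}"
  shows "linear (\<lambda>v. x i [v])"
  using assms by (auto simp: covector_basis_def intro: alternating_form_1_linear)

lemma linear_coords:
  assumes "covector_basis x"
  shows "linear (coords x)"
proof -
  have "\<forall>i\<in>{1..7}. linear (\<lambda>v. x i [v])" using covector_basis_linear[OF assms] by blast
  then show ?thesis
    unfolding ball_1_7 linear_iff by (simp add: vec_eq_iff forall_7)
qed

text \<open>A nonzero vector \<open>a\<close> orthogonal to the range of \<open>coords x\<close>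
  would be a linear relation among the covectors, and a linear surjection of R^7 onto itself is
  injective.\<close>

lemma bij_coords:
  assumes "covector_basis x"
  shows "bij (coords x)"
proof -
  have lin: "linear (coords x)" using linear_coords[OF assms] .
  have "surj (coords x)"
  proof (rule ccontr)
    assume "\<not> surj (coords x)"
    then have "span (range (coords x)) \<noteq> UNIV"
      using lin by (metis linear_subspace_image span_eq_iff subspace_UNIV)
    then have "span (range (coords x)) \<subset> UNIV" by auto
    then obtain a where "a \<noteq> 0" and orth: "\<And>w. w \<in> span (range (coords x)) \<Longrightarrow> orthogonal a w"
      using orthogonal_to_subspace_exists_gen[of "range (coords x)" UNIV] by auto
    have a: "a \<noteq> 0" "\<forall>w\<in>span (range (coords x)). a \<bullet> w = 0"
      using \<open>a \<noteq> 0\<close> orth by (auto simp: orthogonal_def)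
    define c where "c i = (if i = 7 then a $ 7 else a $ of_nat i)" for i :: nat
    have "(\<Sum>i=1..7. c i * x i [v]) = a \<bullet> coords x v" for v
      unfolding sum_1_7 inner_7 coords_nth by (simp add: c_def)
    also have "\<dots> v = 0" for v
      using a(2) by (auto intro: span_base)
    finally have "\<forall>i\<in>{1..7}. c i = 0"
      using assms unfolding covector_basis_def by blast
    then have "a = 0" unfolding ball_1_7 by (simp add: c_def vec_eq_iff forall_7)
    with a(1) show False by simp
  qed
  with lin show ?thesis
    using linear_surjective_imp_injective[of "coords x"] by (simp add: bij_def)
qed

definition dual_basis :: "(nat \<Rightarrow> ext) \<Rightarrow> nat \<Rightarrow> real^7" where
  "dual_basis x i = inv_into UNIV (coords x) (axis (of_nat i) 1)"

lemma dual_basis: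
  assumes "covector_basis x" "i \<in> {1..7}" "j \<in> {1..7}"
  shows "x i [dual_basis x j] = (if i = j then 1 else 0)"
proof -
  have "coords x (dual_basis x j) = axis (of_nat j) 1" for j
    using bij_coords[OF assms(1)] by (simp add: dual_basis_def bij_def surj_f_inv_f)
  then have "coords x (dual_basis x j) $ k = (if k = of_nat j then 1 else 0)" for j k
    by (simp add: axis_def)
  then have "x i [dual_basis x j] = coords x (dual_basis x j) $ of_nat i"
    and "coords x (dual_basis x j) $ of_nat i = (if of_nat i = (of_nat j :: 7) then 1 else 0)"
    if "i \<in> {1..7}" for i j
    using that ball_1_7[of "\<lambda>i. x i [dual_basis x j] = coords x (dual_basis x j) $ of_nat i"]
    by auto
  \<comment> \<open>The index type is arithmetic modulo 7, where the numeral 7 is 0; the indices 1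
    to 7 remain distinct.\<close>
  moreover have "\<forall>i\<in>{1..7}. \<forall>j\<in>{1..7}. of_nat i = (of_nat j :: 7) \<longleftrightarrow> i = j"
    unfolding ball_1_7 by simp
  ultimately have "\<forall>i\<in>{1..7}. \<forall>j\<in>{1..7}. x i [dual_basis x j] = (if i = j then 1 else 0)"
    by metis
  with assms show ?thesis by blast
qed

lemma dual_basis_expansion:
  assumes "covector_basis x"
  shows "v = (\<Sum>i=1..7. x i [v] *\<^sub>R dual_basis x i)"
proof -
  have "coords x (\<Sum>i=1..7. x i [v] *\<^sub>R dual_basis x i)
      = (\<Sum>i=1..7. x i [v] *\<^sub>R axis (of_nat i) 1)"
    using linear_coords[OF assms] bij_coords[OF assms]
    by (simp add: linear_sum linear_cmul dual_basis_def bij_def surj_f_inv_f)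
  also have "\<dots> = coords x v"
    unfolding sum_1_7 by (simp add: vec_eq_iff forall_7 axis_def)
  finally show ?thesis
    using bij_coords[OF assms] by (simp add: bij_def inj_eq)
qed

definition frame_metric :: "(nat \<Rightarrow> ext) \<Rightarrow> real^7 \<Rightarrow> real^7 \<Rightarrow> real" where
  "frame_metric x = (\<lambda>u v. \<Sum>i=1..7. x i [u] * x i [v])"

abbreviation frame_volume :: "(nat \<Rightarrow> ext) \<Rightarrow> ext" where
  "frame_volume x \<equiv> ext_mono x [1,2,3,4,5,6,7]"

lemma frame_metric_coords: "frame_metric x u v = coords x u \<bullet> coords x v"
  unfolding frame_metric_def sum_1_7 inner_7 coords_nth ..


subsection \<open>Hodge star in an orthonormal frame\<close>

lemma ext_sum_apply: "(\<Sum>i\<in>A. (f i :: ext)) vs = (\<Sum>i\<in>A. f i vs)"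
  by (induction A rule: infinite_finite_induct) auto

lemma wedge1_sum_right: "wedge1 \<alpha> (\<Sum>i\<in>A. f i) = (\<Sum>i\<in>A. wedge1 \<alpha> (f i))"
  by (rule ext) (simp add: ext_sum_apply wedge1_def sum_distrib_left sum.swap[of _ A])

lemma wedge1_cong_right:
  assumes "\<And>us. Suc (length us) = length vs \<Longrightarrow> \<omega> us = \<eta> us"
  shows "wedge1 \<alpha> \<omega> vs = wedge1 \<alpha> \<eta> vs"
  unfolding wedge1_def by (intro sum.cong refl arg_cong2[of _ _ _ _ times] assms) auto

text \<open>For lists of equal length \<open>ext_mono x is vs\<close> is the determinant of the
  values \<open>x i [v]\<close>, and this is its Laplace expansion along the last vector, whereas
  \<open>ext_mono_Cons\<close> expands along the first covector.\<close>

lemma ext_mono_snoc: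
  "ext_mono x is (vs @ [v]) = (\<Sum>p<length is.
     (-1) ^ (length vs + p) * x (is ! p) [v] * ext_mono x (take p is @ drop (Suc p) is) vs)"
proof (induction "is" arbitrary: vs)
  case (Cons i "is")
  have "wedge1 (x i) (\<lambda>us. ext_mono x is (us @ [v])) vs =
      wedge1 (x i) (\<Sum>p<length is. ((-1) ^ (length vs + Suc p) * x (is ! p) [v]) *\<^sub>e
        ext_mono x (take p is @ drop (Suc p) is)) vs"
  \<comment> \<open>\<open>us\<close> is one shorter than \<open>vs\<close>, which matches the shift
    from \<open>p\<close> to \<open>Suc p\<close> in the exponent of the sign.\<close>
  proof (rule wedge1_cong_right)
    fix us :: "(real^7) list" assume "Suc (length us) = length vs"
    then have "length vs = Suc (length us)" by simp
    then show "ext_mono x is (us @ [v]) = (\<Sum>p<length is.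
        ((-1) ^ (length vs + Suc p) * x (is ! p) [v]) *\<^sub>e ext_mono x (take p is @ drop (Suc p) is)) us"
      by (simp add: Cons.IH ext_sum_apply)
  qed
  also have "\<dots> = (\<Sum>p<length is. (-1) ^ (length vs + Suc p) * x (is ! p) [v] *
      ext_mono x (i # take p is @ drop (Suc p) is) vs)"
    by (simp add: wedge1_sum_right ext_sum_apply ext_mono_Cons)
  finally show ?case
    by (simp add: ext_mono_Cons wedge1_snoc sum.lessThan_Suc_shift del: sum.lessThan_Suc)
qed (simp add: ext_one_def)

lemma ext_mono_move_front:
  "ext_mono x (bs @ i # js) = (-1) ^ length bs *\<^sub>e ext_mono x (i # bs @ js)"
proof (induction bs)
  case (Cons b bs)
  have "ext_mono x ((b # bs) @ i # js) = wedge1 (x b) (ext_mono x (bs @ i # js))"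
    by (simp only: append_Cons ext_mono_Cons)
  also have "\<dots> = (-1) ^ length bs *\<^sub>e wedge1 (x b) (wedge1 (x i) (ext_mono x (bs @ js)))"
    unfolding Cons.IH by (simp only: wedge1_scale_right ext_mono_Cons)
  also have "\<dots> = (-1) ^ length (b # bs) *\<^sub>e ext_mono x (i # (b # bs) @ js)"
    unfolding wedge1_anticommute[of "x b" "x i"] ext_mono_Cons append_Cons by (rule ext) simp
  finally show ?case .
qed (simp add: fun_eq_iff)

lemma ext_mono_append: "ext_mono x (as @ bs) = foldr (\<lambda>i \<omega>. wedge1 (x i) \<omega>) as (ext_mono x bs)"
  by (simp add: ext_mono_def)

lemma ext_mono_move:
  "ext_mono x (as @ bs @ i # js) = (-1) ^ length bs *\<^sub>e ext_mono x (as @ i # bs @ js)"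
proof -
  have "foldr (\<lambda>i \<omega>. wedge1 (x i) \<omega>) as (r *\<^sub>e \<omega>) = r *\<^sub>e foldr (\<lambda>i \<omega>. wedge1 (x i) \<omega>) as \<omega>"
    for r \<omega> by (induction as) (simp_all only: foldr.simps id_apply o_apply wedge1_scale_right)
  then show ?thesis
    unfolding ext_mono_append[of x as] ext_mono_move_front[of x bs] .
qed

abbreviation wedge_flats :: "(real^7 \<Rightarrow> real^7 \<Rightarrow> real) \<Rightarrow> (real^7) list \<Rightarrow> ext \<Rightarrow> ext" where
  "wedge_flats g us \<omega> \<equiv> foldr (\<lambda>u \<omega>. wedge1 (flat g u) \<omega>) us \<omega>"

lemma wedge_flats_linear:
  "wedge_flats g us (\<omega> + \<eta>) = wedge_flats g us \<omega> + wedge_flats g us \<eta>"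
  "wedge_flats g us (\<omega> - \<eta>) = wedge_flats g us \<omega> - wedge_flats g us \<eta>"
  "wedge_flats g us (r *\<^sub>e \<omega>) = r *\<^sub>e wedge_flats g us \<omega>"
  "wedge_flats g us 0 = 0"
  by (induction us) simp_all

lemma wedge_flats_sum:
  "wedge_flats g us (\<Sum>i\<in>A. f i) = (\<Sum>i\<in>A. wedge_flats g us (f i))"
  by (induction A rule: infinite_finite_induct) (simp_all only: sum.infinite sum.empty sum.insert wedge_flats_linear not_False_eq_True)

lemma wedge1_flat:
  "wedge1 (flat (frame_metric x) u) \<omega> = (\<Sum>i=1..7. x i [u] *\<^sub>e wedge1 (x i) \<omega>)"
proof -
  have "wedge1 (flat (frame_metric x) u) \<omega> vs = (\<Sum>i=1..7. x i [u] *\<^sub>e wedge1 (x i) \<omega>) vs" for vs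
    unfolding ext_sum_apply ext_scale_apply
    unfolding wedge1_def flat_def frame_metric_def
    by (simp add: sum_distrib_left sum_distrib_right) (subst sum.swap, simp add: mult_ac)
  then show ?thesis by (rule ext)
qed

text \<open>In the orthonormal frame the flat of \<open>u\<close> is the sum of
  \<open>x i [u]\<close> times \<open>x i\<close>; wedged onto \<open>ext_mono x js\<close> only the
  indices from \<open>is\<close> survive. Each of them is moved from \<open>is\<close> to the front
  of \<open>js\<close>, and the resulting sum is the Laplace expansion of
  \<open>ext_mono x is\<close> along the last vector. The induction runs from the right because the
  last vector is wedged first.\<close>

lemma wedge_flats_ext_mono:
  assumes "distinct (is @ js)" "set (is @ js) = {1..7}" "length us = length is"
  shows "wedge_flats (frame_metric x) us (ext_mono x js) = ext_mono x is us *\<^sub>e ext_mono x (is @ js)"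
  using assms
proof (induction us arbitrary: "is" js rule: rev_induct)
  case Nil
  then show ?case by (simp add: ext_one_def fun_eq_iff)
next
  case (snoc u us)
  define rest where "rest p = take p is @ drop (Suc p) is" for p
  have split: "is = take p is @ is ! p # drop (Suc p) is" if "p < length is" for p
    using that by (rule id_take_nth_drop)
  have step: "wedge_flats (frame_metric x) us (ext_mono x (is ! p # js)) =
      ((-1) ^ (length us + p) * ext_mono x (rest p) us) *\<^sub>e ext_mono x (is @ js)"
    if p: "p < length is" for p
  proof -
    have "distinct ((as @ i # bs) @ js) \<Longrightarrow>
        distinct ((as @ bs) @ i # js) \<and> set ((as @ bs) @ i # js) = set ((as @ i # bs) @ js)"
      for as bs and i :: nat by auto
    from this[of "take p is" "is ! p" "drop (Suc p) is"] split[OF p, symmetric] snoc.prems(1,2)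
    have perm: "distinct (rest p @ is ! p # js)" "set (rest p @ is ! p # js) = {1..7}"
      unfolding rest_def by (simp_all only:)
    have "wedge_flats (frame_metric x) us (ext_mono x (is ! p # js)) =
        ext_mono x (rest p) us *\<^sub>e ext_mono x (rest p @ is ! p # js)"
      using snoc.prems(3) p by (intro snoc.IH perm) (simp add: rest_def)
    also have "ext_mono x (rest p @ is ! p # js) =
        (-1) ^ (length is - Suc p) *\<^sub>e ext_mono x (take p is @ is ! p # drop (Suc p) is @ js)"
      using ext_mono_move[of x "take p is" "drop (Suc p) is" "is ! p" js] by (simp add: rest_def)
    also have "take p is @ is ! p # drop (Suc p) is @ js = is @ js"
      using split[OF p] by (metis append.assoc append_Cons)
    \<comment> \<open>Since \<open>is\<close> is one longer than \<open>us\<close>, the exponents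
      are \<open>length us - p\<close> and \<open>length us + p\<close>, which differ by 2p.\<close>
    also have "(-1 :: real) ^ (length is - Suc p) = (-1) ^ (length us + p)"
      using snoc.prems(3)[symmetric] p by (auto simp: minus_one_power_iff)
    finally show ?thesis by (simp add: fun_eq_iff)
  qed
  have "wedge1 (flat (frame_metric x) u) (ext_mono x js) =
      (\<Sum>i\<in>{1..7}. x i [u] *\<^sub>e wedge1 (x i) (ext_mono x js))"
    by (rule wedge1_flat)
  also have "\<dots> = (\<Sum>i\<in>set is. x i [u] *\<^sub>e wedge1 (x i) (ext_mono x js))"
  proof (rule sum.mono_neutral_right)
    show "\<forall>i\<in>{1..7} - set is. x i [u] *\<^sub>e wedge1 (x i) (ext_mono x js) = 0"
    proof
      fix i assume "i \<in> {1..7} - set is"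
      then have "i \<in> set js" using snoc.prems(2) by auto
      from ext_mono_repeated[OF this] show "x i [u] *\<^sub>e wedge1 (x i) (ext_mono x js) = 0"
        by (simp add: fun_eq_iff)
    qed
  qed (use snoc.prems(2) in auto)
  also have "\<dots> = (\<Sum>p<length is. x (is ! p) [u] *\<^sub>e ext_mono x (is ! p # js))"
    using snoc.prems(1) bij_betw_nth[of "is" "{..<length is}" "set is"]
    by (subst sum.reindex_bij_betw[symmetric]) (auto simp: ext_mono_Cons)
  finally have flat: "wedge1 (flat (frame_metric x) u) (ext_mono x js) =
    (\<Sum>p<length is. x (is ! p) [u] *\<^sub>e ext_mono x (is ! p # js))" .
  have "wedge_flats (frame_metric x) (us @ [u]) (ext_mono x js) =
      (\<Sum>p<length is. x (is ! p) [u] *\<^sub>e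
        (((-1) ^ (length us + p) * ext_mono x (rest p) us) *\<^sub>e ext_mono x (is @ js)))"
    by (simp add: flat wedge_flats_sum wedge_flats_linear(3) step)
  also have "\<dots> = ext_mono x is (us @ [u]) *\<^sub>e ext_mono x (is @ js)"
    by (rule ext)
      (simp add: ext_mono_snoc ext_sum_apply sum_distrib_left sum_distrib_right rest_def mult_ac)
  finally show ?case .
qed

lemma multilinear_zero:
  fixes \<gamma> :: ext
  assumes "covector_basis x"
    and "\<And>vs i. i < k \<Longrightarrow> length vs = k \<Longrightarrow> linear (\<lambda>v. \<gamma> (vs[i := v]))"
    and "\<And>js. set js \<subseteq> {1..7} \<Longrightarrow> length js = k \<Longrightarrow> \<gamma> (map (dual_basis x) js) = 0"
    and "length vs = k"
  shows "\<gamma> vs = 0"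
  using assms(2-)
proof (induction k arbitrary: \<gamma> vs)
  case (Suc k)
  obtain v ws where vs: "vs = v # ws" "length ws = k" using Suc.prems(3) by (cases vs) auto
  have basis: "\<gamma> (dual_basis x i # ws) = 0" if i: "i \<in> {1..7}" for i
  proof -
    have "contract (dual_basis x i) \<gamma> ws = 0"
    proof (rule Suc.IH)
      show "linear (\<lambda>v. contract (dual_basis x i) \<gamma> (us[j := v]))" if "j < k" "length us = k" for us j
        using Suc.prems(1)[of "Suc j" "dual_basis x i # us"] that by simp
      show "contract (dual_basis x i) \<gamma> (map (dual_basis x) js) = 0"
        if "set js \<subseteq> {1..7}" "length js = k" for js
        using Suc.prems(2)[of "i # js"] that i by simp
    qed (fact vs(2))
    then show ?thesis by simp
  qed
  have lin: "linear (\<lambda>v. \<gamma> (v # ws))" using Suc.prems(1)[of 0 vs] vs by simp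
  have "\<gamma> (v # ws) = \<gamma> ((\<Sum>i=1..7. x i [v] *\<^sub>R dual_basis x i) # ws)"
    using dual_basis_expansion[OF assms(1), of v] by simp
  also have "\<dots> = (\<Sum>i=1..7. x i [v] *\<^sub>R \<gamma> (dual_basis x i # ws))"
    by (simp add: linear_sum[OF lin] linear_cmul[OF lin])
  also have "\<dots> = 0" using basis by simp
  finally show ?case using vs by simp
next
  case 0
  then show ?case using 0(2)[of "[]"] by simp
qed

text \<open>The flat of a dual basis vector takes the value 1 on that vector and 0 on the others, so
  each wedge keeps its leading term only. Thus every component of \<gamma> can be read off from its
  wedges with flats.\<close>

lemma wedge_flats_self:
  assumes "distinct is" "set is \<inter> set js = {}" "set is \<union> set js \<subseteq> {1..7}" "covector_basis x"
  shows "wedge_flats (frame_metric x) (map (dual_basis x) is) \<gamma> (map (dual_basis x) (is @ js)) =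
    \<gamma> (map (dual_basis x) js)"
  using assms(1-3)
proof (induction "is")
  case (Cons i "is")
  have flat: "flat (frame_metric x) (dual_basis x i) [dual_basis x j] = (if i = j then 1 else 0)"
    if "j \<in> {1..7}" for j
  proof -
    have "(\<Sum>k=1..7. x k [dual_basis x i] * x k [dual_basis x j]) =
        (\<Sum>k=1..7. (if k = i then 1 else 0) * (if k = j then 1 else 0 :: real))"
      using that Cons.prems dual_basis[OF assms(4)] by (intro sum.cong) auto
    also have "\<dots> = (if i = j then 1 else 0)"
      using Cons.prems by (simp add: if_distrib[of "\<lambda>a. a * _"] cong: if_cong)
    finally show ?thesis by (simp add: flat_def frame_metric_def)
  qed
  have vanish: "wedge1 (flat (frame_metric x) (dual_basis x i)) \<omega> (map (dual_basis x) ks) = 0"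
    if "i \<notin> set ks" "set ks \<subseteq> {1..7}" for \<omega> ks
    unfolding wedge1_def using that flat by (intro sum.neutral ballI) (auto simp: subset_iff)
  have "wedge1 (flat (frame_metric x) (dual_basis x i)) \<omega> (map (dual_basis x) (i # is @ js)) =
      \<omega> (map (dual_basis x) (is @ js))" for \<omega>
    using Cons.prems by (simp add: wedge1_Cons vanish[of "is @ js", simplified] flat)
  with Cons show ?case by simp
qed simp

text \<open>The defining property of \<open>hodge\<close> for the metric and volume of a frame,
  stated as a relation: it is linear in the pair of \<beta> and \<gamma>, so stars are assembled
  from monomials before uniqueness turns them into values of \<open>hodge\<close>.\<close>

definition is_star :: "(nat \<Rightarrow> ext) \<Rightarrow> nat \<Rightarrow> ext \<Rightarrow> ext \<Rightarrow> bool" where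
  "is_star x k \<beta> \<gamma> \<longleftrightarrow> alternating_form (7 - k) \<gamma> \<and>
     (\<forall>us. length us = k \<longrightarrow> wedge_flats (frame_metric x) us \<gamma> = \<beta> us *\<^sub>e frame_volume x)"

lemma alternating_form_diff:
  assumes "alternating_form k \<alpha>" "alternating_form k \<beta>"
  shows "alternating_form k (\<alpha> - \<beta>)"
  using assms unfolding alternating_form_def by (auto intro!: linear_compose_sub)

lemma alternating_form_add:
  assumes "alternating_form k \<alpha>" "alternating_form k \<beta>"
  shows "alternating_form k (\<alpha> + \<beta>)"
  using assms unfolding alternating_form_def by (auto intro!: linear_compose_add)

lemma alternating_form_scale:
  assumes "alternating_form k \<alpha>"
  shows "alternating_form k (r *\<^sub>e \<alpha>)"
  using assms unfolding alternating_form_def by (auto intro!: linear_cmult)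

text \<open>By multilinearity the difference is determined by its values on dual basis vectors.
  Those with a repeated index vanish, and for distinct indices \<open>js\<close> wedging with the
  flats of the complementary dual vectors isolates the value.\<close>

lemma is_star_unique:
  assumes "covector_basis x" "k \<le> 7" "is_star x k \<beta> \<gamma>" "is_star x k \<beta> \<gamma>'"
  shows "\<gamma> = \<gamma>'"
proof -
  define \<delta> where "\<delta> = \<gamma> - \<gamma>'"
  have \<delta>: "alternating_form (7 - k) \<delta>"
    using assms unfolding \<delta>_def is_star_def by (blast intro: alternating_form_diff)
  have zero: "wedge_flats (frame_metric x) us \<delta> = 0" if "length us = k" for us
    using assms that unfolding \<delta>_def is_star_def wedge_flats_linear by auto
  have "\<delta> vs = 0" if "length vs = 7 - k" for vs
  proof (rule multilinear_zero[OF assms(1) _ _ that])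
    show "linear (\<lambda>v. \<delta> (vs[i := v]))" if "i < 7 - k" "length vs = 7 - k" for vs i
      using \<delta> that unfolding alternating_form_def by blast
    fix js :: "nat list" assume js: "set js \<subseteq> {1..7}" "length js = 7 - k"
    show "\<delta> (map (dual_basis x) js) = 0"
    proof (cases "distinct js")
      case False
      then obtain i j where "i < j" "j < length js" "js ! i = js ! j"
        by (metis distinct_conv_nth nat_neq_iff)
      with js have "length (map (dual_basis x) js) = 7 - k \<and> i < j \<and> j < 7 - k \<and>
          map (dual_basis x) js ! i = map (dual_basis x) js ! j" by simp
      with \<delta> show ?thesis unfolding alternating_form_def by blast
    next
      case True
      define ks where "ks = sorted_list_of_set ({1..7} - set js)"
      have ks: "set ks = {1..7} - set js" "distinct ks" by (simp_all add: ks_def)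
      have "length ks = card ({1..7} - set js)" by (simp add: ks_def)
      also have "\<dots> = k"
        using js True assms(2) by (simp add: card_Diff_subset distinct_card)
      finally have "wedge_flats (frame_metric x) (map (dual_basis x) ks) \<delta> = 0"
        by (intro zero) simp
      moreover have "wedge_flats (frame_metric x) (map (dual_basis x) ks) \<delta> (map (dual_basis x) (ks @ js))
          = \<delta> (map (dual_basis x) js)"
        using ks js by (intro wedge_flats_self assms) auto
      ultimately show ?thesis by simp
    qed
  qed
  moreover have "\<delta> vs = 0" if "length vs \<noteq> 7 - k" for vs
    using \<delta> that unfolding alternating_form_def by blast
  ultimately have "\<delta> vs = 0" for vs by blast
  then show ?thesis by (simp add: \<delta>_def fun_eq_iff)
qed

lemma hodge_eq:
  assumes "covector_basis x" "k \<le> 7" "is_star x k \<beta> \<gamma>"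
  shows "hodge (frame_metric x) (frame_volume x) k \<beta> = \<gamma>"
proof -
  have "is_star x k \<beta> \<gamma>' \<longleftrightarrow> alternating_form (7 - k) \<gamma>' \<and> (\<forall>us. length us = k \<longrightarrow>
      wedge_flats (frame_metric x) us \<gamma>' = (\<lambda>vs. \<beta> us * frame_volume x vs))" for \<gamma>'
    unfolding is_star_def ext_scale_def ..
  then have "hodge (frame_metric x) (frame_volume x) k \<beta> = (THE \<gamma>. is_star x k \<beta> \<gamma>)"
    unfolding hodge_def by simp
  also have "\<dots> = \<gamma>" using is_star_unique assms by blast
  finally show ?thesis .
qed

lemma ext_scale_left:
  "(a + b) *\<^sub>e \<omega> = a *\<^sub>e \<omega> + b *\<^sub>e \<omega>"
  "(a - b) *\<^sub>e \<omega> = a *\<^sub>e \<omega> - b *\<^sub>e \<omega>"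
  "(a * b) *\<^sub>e \<omega> = a *\<^sub>e b *\<^sub>e \<omega>"
  by (rule ext, simp add: algebra_simps)+

lemma is_star_add:
  assumes "is_star x k \<beta> \<gamma>" "is_star x k \<beta>' \<gamma>'"
  shows "is_star x k (\<beta> + \<beta>') (\<gamma> + \<gamma>')"
  using assms unfolding is_star_def wedge_flats_linear
  by (simp only: alternating_form_add plus_fun_apply ext_scale_left simp_thms) simp

lemma is_star_diff:
  assumes "is_star x k \<beta> \<gamma>" "is_star x k \<beta>' \<gamma>'"
  shows "is_star x k (\<beta> - \<beta>') (\<gamma> - \<gamma>')"
  using assms unfolding is_star_def wedge_flats_linear
  by (simp only: alternating_form_diff minus_apply ext_scale_left simp_thms) simp

lemma is_star_scale:
  assumes "is_star x k \<beta> \<gamma>"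
  shows "is_star x k (r *\<^sub>e \<beta>) (r *\<^sub>e \<gamma>)"
  using assms unfolding is_star_def wedge_flats_linear
  by (simp only: alternating_form_scale ext_scale_apply ext_scale_left simp_thms) simp

lemma alternating_form_ext_mono:
  "(\<And>i. i \<in> set is \<Longrightarrow> alternating_form 1 (x i)) \<Longrightarrow> length is = k \<Longrightarrow> alternating_form k (ext_mono x is)"
  using alt_imp_alternating_form[OF alt_ext_mono] by blast

text \<open>\<sigma> is the sign of the permutation \<open>is @ js\<close>, given through its effect
  on the monomial so that concrete instances follow by sorting the factors. It occurs twice, in the
  star and in the reordering, hence squares away.\<close>

lemma is_star_ext_mono:
  assumes "covector_basis x" "distinct (is @ js)" "set (is @ js) = {1..7}" "length is = k"
    and "ext_mono x (is @ js) = \<sigma> *\<^sub>e frame_volume x" "\<sigma> * \<sigma> = 1"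
  shows "is_star x k (ext_mono x is) (\<sigma> *\<^sub>e ext_mono x js)"
  unfolding is_star_def
proof (intro conjI allI impI)
  have "length (is @ js) = card {1..7::nat}"
    using assms(2,3) distinct_card by metis
  then have "length js = 7 - k" using assms(4) by simp
  then show "alternating_form (7 - k) (\<sigma> *\<^sub>e ext_mono x js)"
    using assms(1,3) by (intro alternating_form_scale alternating_form_ext_mono)
      (auto simp: covector_basis_def)
  fix us :: "(real^7) list" assume "length us = k"
  then have "wedge_flats (frame_metric x) us (\<sigma> *\<^sub>e ext_mono x js) =
      \<sigma> *\<^sub>e (ext_mono x is us *\<^sub>e \<sigma> *\<^sub>e frame_volume x)"
    unfolding wedge_flats_linear using assms by (subst wedge_flats_ext_mono) auto
  also have "\<dots> = ext_mono x is us *\<^sub>e frame_volume x"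
  proof (rule ext)
    fix vs
    have "(\<sigma> *\<^sub>e (ext_mono x is us *\<^sub>e \<sigma> *\<^sub>e frame_volume x)) vs =
        (\<sigma> * \<sigma>) * (ext_mono x is us * frame_volume x vs)" by simp
    then show "(\<sigma> *\<^sub>e (ext_mono x is us *\<^sub>e \<sigma> *\<^sub>e frame_volume x)) vs =
        (ext_mono x is us *\<^sub>e frame_volume x) vs" using assms(6) by simp
  qed
  finally show "wedge_flats (frame_metric x) us (\<sigma> *\<^sub>e ext_mono x js) =
    ext_mono x is us *\<^sub>e frame_volume x" .
qed

text \<open>The side condition orients \<open>wedge1_anticommute\<close>, so that rewriting with it
  sorts the factors of a monomial.\<close>

lemma wedge1_swap:
  "j < (i::nat) \<Longrightarrow> wedge1 (x i) (wedge1 (x j) \<omega>) = - wedge1 (x j) (wedge1 (x i) \<omega>)"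
  by (rule wedge1_anticommute)


subsection \<open>The metric and the volume form of a \<open>G\<^sub>2\<close>-form\<close>

text \<open>The cross product of the model form: its inner product with a third vector is the value
  of that form, see \<open>g2_form_cross7\<close>.\<close>

definition cross7 :: "real^7 \<Rightarrow> real^7 \<Rightarrow> real^7" where
  "cross7 u v = vector [
     (u$2 * v$7 - u$7 * v$2) + (u$3 * v$5 - u$5 * v$3) - (u$4 * v$6 - u$6 * v$4),
     - (u$1 * v$7 - u$7 * v$1) - (u$3 * v$6 - u$6 * v$3) - (u$4 * v$5 - u$5 * v$4),
     (u$4 * v$7 - u$7 * v$4) + (u$2 * v$6 - u$6 * v$2) - (u$1 * v$5 - u$5 * v$1),
     (u$1 * v$6 - u$6 * v$1) + (u$2 * v$5 - u$5 * v$2) - (u$3 * v$7 - u$7 * v$3),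
     (u$6 * v$7 - u$7 * v$6) + (u$1 * v$3 - u$3 * v$1) - (u$2 * v$4 - u$4 * v$2),
     - (u$5 * v$7 - u$7 * v$5) - (u$1 * v$4 - u$4 * v$1) - (u$2 * v$3 - u$3 * v$2),
     (u$1 * v$2 - u$2 * v$1) + (u$3 * v$4 - u$4 * v$3) + (u$5 * v$6 - u$6 * v$5)]"

lemma cross7_nth:
  "cross7 u v $ 1 = (u$2 * v$7 - u$7 * v$2) + (u$3 * v$5 - u$5 * v$3) - (u$4 * v$6 - u$6 * v$4)"
  "cross7 u v $ 2 = - (u$1 * v$7 - u$7 * v$1) - (u$3 * v$6 - u$6 * v$3) - (u$4 * v$5 - u$5 * v$4)"
  "cross7 u v $ 3 = (u$4 * v$7 - u$7 * v$4) + (u$2 * v$6 - u$6 * v$2) - (u$1 * v$5 - u$5 * v$1)"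
  "cross7 u v $ 4 = (u$1 * v$6 - u$6 * v$1) + (u$2 * v$5 - u$5 * v$2) - (u$3 * v$7 - u$7 * v$3)"
  "cross7 u v $ 5 = (u$6 * v$7 - u$7 * v$6) + (u$1 * v$3 - u$3 * v$1) - (u$2 * v$4 - u$4 * v$2)"
  "cross7 u v $ 6 = - (u$5 * v$7 - u$7 * v$5) - (u$1 * v$4 - u$4 * v$1) - (u$2 * v$3 - u$3 * v$2)"
  "cross7 u v $ 7 = (u$1 * v$2 - u$2 * v$1) + (u$3 * v$4 - u$4 * v$3) + (u$5 * v$6 - u$6 * v$5)"
  unfolding cross7_def vector_7 by (rule refl)+

lemma cross7_cyclic: "cross7 u v \<bullet> w = cross7 v w \<bullet> u"
  unfolding inner_7 cross7_nth by algebra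

lemma cross7_skew: "cross7 u v \<bullet> w = - (cross7 v u \<bullet> w)"
  unfolding inner_7 cross7_nth by algebra

lemma cross7_orthogonal [simp]: "cross7 u v \<bullet> u = 0" "cross7 u v \<bullet> v = 0"
  unfolding inner_7 cross7_nth by algebra+

lemma cross7_minus_right [simp]: "cross7 u (- v) = - cross7 u v"
  by (simp add: vec_eq_iff forall_7 cross7_nth algebra_simps)

text \<open>This is where the octonionic structure enters: on the complement of \<open>u\<close> the
  map \<open>cross7 u\<close> squares to minus the squared length of \<open>u\<close>. Each
  component is a polynomial identity.\<close>

lemma cross7_cross7: "cross7 u (cross7 u w) = (u \<bullet> w) *\<^sub>R u - (u \<bullet> u) *\<^sub>R w"
proof -
  have "\<forall>i. cross7 u (cross7 u w) $ i = ((u \<bullet> w) *\<^sub>R u - (u \<bullet> u) *\<^sub>R w) $ i"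
    unfolding forall_7 vector_minus_component vector_scaleR_component inner_7 cross7_nth
    by (intro conjI; simp only: real_scaleR_def; algebra)
  then show ?thesis by (simp add: vec_eq_iff)
qed

text \<open>\<open>cross7 u\<close> is skew-adjoint by the cyclic symmetry, which moves one factor
  across and leaves a double cross product.\<close>

lemma cross7_inner_cross7: "cross7 u v \<bullet> cross7 u w = (u \<bullet> u) * (v \<bullet> w) - (u \<bullet> v) * (u \<bullet> w)"
proof -
  have "cross7 u v \<bullet> cross7 u w = cross7 (cross7 u w) u \<bullet> v"
    using cross7_cyclic[of "cross7 u w" u v] by (simp add: inner_commute)
  also have "\<dots> = - (cross7 u (cross7 u w) \<bullet> v)" by (rule cross7_skew)
  finally show ?thesis
    unfolding cross7_cross7 inner_diff_left inner_scaleR_left by (simp add: inner_commute)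
qed

text \<open>A null vector of a positive semidefinite form lies in its radical: otherwise the chosen
  \<open>t\<close> makes the value at w + t u equal to -1.\<close>

lemma bilinear_form_zero:
  fixes B :: "'a::real_vector \<Rightarrow> 'a \<Rightarrow> real"
  assumes "bilinear B" "\<And>u v. B u v = B v u" "\<And>u. 0 \<le> B u u" "B u u = 0"
  shows "B u w = 0"
proof (rule ccontr)
  assume nz: "B u w \<noteq> 0"
  define t where "t = - (B w w + 1) / (2 * B u w)"
  have "B (w + t *\<^sub>R u) (w + t *\<^sub>R u) = B w w + 2 * t * B u w"
    using assms(1,4) assms(2)[of w u]
    by (simp add: bilinear_ladd bilinear_radd bilinear_lmul bilinear_rmul algebra_simps)
  also have "\<dots> = -1" using nz by (simp add: t_def field_simps)
  finally show False using assms(3)[of "w + t *\<^sub>R u"] by simp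
qed

text \<open>The sign \<open>s\<close> selects the maximum or the minimum of |A v|^2 on the unit
  sphere. At the extremal \<open>u\<close> the form \<open>B\<close> below is positive semidefinite
  with null vector \<open>u\<close>, so \<open>u\<close> lies in its radical; this is the weak form
  of the eigenvector equation A^T A u = |A u|^2 u.\<close>

lemma extremal_eigenvector:
  fixes A :: "real^7 \<Rightarrow> real^7"
  assumes lin: "linear A" and s: "s = 1 \<or> s = -1"
  obtains u where "norm u = 1" "\<And>v. s * (A v \<bullet> A v) \<le> s * (A u \<bullet> A u) * (v \<bullet> v)"
    "\<And>w. A u \<bullet> A w = (A u \<bullet> A u) * (u \<bullet> w)"
proof -
  have cont: "continuous_on (sphere 0 1) (\<lambda>v. s * (A v \<bullet> A v))"
    by (intro continuous_intros linear_continuous_on linear_conv_bounded_linear[THEN iffD1] lin)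
  have "sphere (0::real^7) 1 \<noteq> {}" by simp
  then obtain u where u: "u \<in> sphere 0 1"
      "\<And>v. v \<in> sphere 0 1 \<Longrightarrow> s * (A v \<bullet> A v) \<le> s * (A u \<bullet> A u)"
    using continuous_attains_sup[OF compact_sphere _ cont] by blast
  have max: "s * (A v \<bullet> A v) \<le> s * (A u \<bullet> A u) * (v \<bullet> v)" for v
  proof (cases "v = 0")
    case False
    define v' where "v' = (1 / norm v) *\<^sub>R v"
    have v: "v = norm v *\<^sub>R v'" using False by (simp add: v'_def)
    have "A v \<bullet> A v = (norm v)\<^sup>2 * (A v' \<bullet> A v')"
      by (subst (1 2) v) (simp add: linear_cmul[OF lin] power2_eq_square)
    moreover have "s * (A v' \<bullet> A v') \<le> s * (A u \<bullet> A u)"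
      using False by (intro u) (simp add: v'_def)
    ultimately show ?thesis
      using mult_left_mono[of "s * (A v' \<bullet> A v')" "s * (A u \<bullet> A u)" "(norm v)\<^sup>2"]
      by (simp add: power2_norm_eq_inner algebra_simps)
  qed (simp add: linear_0[OF lin])
  have uu: "u \<bullet> u = 1" using u(1) by (simp add: norm_eq_1)
  define B where "B v w = s * (A u \<bullet> A u) * (v \<bullet> w) - s * (A v \<bullet> A w)" for v w
  have zero: "B u w = 0" for w
  proof (rule bilinear_form_zero[of B])
    have inner: "linear (\<lambda>w. v \<bullet> w)" "linear (\<lambda>w. w \<bullet> v)" for v :: "real^7"
      by (auto intro: linearI simp: inner_add_left inner_add_right)
    have "linear (\<lambda>w. A v \<bullet> A w)" "linear (\<lambda>w. A w \<bullet> A v)" for v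
      using linear_compose[OF lin inner(1)] linear_compose[OF lin inner(2)] by (auto simp: o_def)
    with inner show "bilinear B"
      unfolding bilinear_def B_def by (intro conjI allI linear_compose_sub linear_cmult) auto
    show "B v w = B w v" for v w by (simp add: B_def inner_commute)
    show "0 \<le> B v v" for v using max[of v] by (simp add: B_def)
    show "B u u = 0" using uu by (simp add: B_def)
  qed
  have "A u \<bullet> A w = (A u \<bullet> A u) * (u \<bullet> w)" for w
    using zero[of w] s by (auto simp: B_def)
  moreover have "norm u = 1" using u(1) by simp
  ultimately show ?thesis using that[of u] max by blast
qed

lemma exists_orthogonal_3:
  fixes a b c :: "real^7"
  obtains z where "norm z = 1" "z \<bullet> a = 0" "z \<bullet> b = 0" "z \<bullet> c = 0"
proof -
  have "dim {a, b, c} \<le> card {a, b, c}" by (rule dim_le_card') simp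
  also have "\<dots> \<le> 3" by (simp add: card_insert_if)
  finally have "dim {a, b, c} < DIM(real^7)" by simp
  then obtain z where z: "z \<noteq> 0" "\<And>y. y \<in> span {a, b, c} \<Longrightarrow> orthogonal z y"
    using orthogonal_to_subspace_exists by blast
  then have "z \<bullet> a = 0" "z \<bullet> b = 0" "z \<bullet> c = 0"
    by (auto simp: orthogonal_def span_base)
  with z(1) show ?thesis
    by (intro that[of "(1 / norm z) *\<^sub>R z"]) auto
qed

text \<open>
  If \<open>u\<close> and \<open>w\<close> are unit vectors at which \<open>|A v|\<^sup>2\<close> is extremal on the unit sphere, with extremal
  values \<open>p\<close> and \<open>q\<close>, then \<open>|A u \<times> A z|\<^sup>2 = p |A z|\<^sup>2\<close> for \<open>z \<bottom> u\<close>, and \<open>A u \<times> A z\<close> only depends on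
  \<open>u \<times> z\<close>. Comparing the two expressions for \<open>u \<times> z = w \<times> z'\<close> forces \<open>p = q\<close>.
\<close>

lemma cross7_preserving_isometry:
  assumes lin: "linear A" and bij: "bij A"
    and pres: "\<And>u v w. cross7 (A u) (A v) \<bullet> A w = cross7 u v \<bullet> w"
  shows "A v \<bullet> A w = v \<bullet> w"
proof -
  obtain u where u: "norm u = 1" "\<And>v. 1 * (A v \<bullet> A v) \<le> 1 * (A u \<bullet> A u) * (v \<bullet> v)"
    "\<And>w. A u \<bullet> A w = (A u \<bullet> A u) * (u \<bullet> w)"
    using extremal_eigenvector[OF lin, of 1] by blast
  obtain w where w: "norm w = 1" "\<And>v. -1 * (A v \<bullet> A v) \<le> -1 * (A w \<bullet> A w) * (v \<bullet> v)"
    "\<And>v. A w \<bullet> A v = (A w \<bullet> A w) * (w \<bullet> v)"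
    using extremal_eigenvector[OF lin, of "-1"] by blast
  define p where "p = A u \<bullet> A u"
  define q where "q = A w \<bullet> A w"
  have uu: "u \<bullet> u = 1" and ww: "w \<bullet> w = 1" using u(1) w(1) by (simp_all add: norm_eq_1)
  have max: "A v \<bullet> A v \<le> p * (v \<bullet> v)" and min: "q * (v \<bullet> v) \<le> A v \<bullet> A v" for v
    using u(2)[of v] w(2)[of v] by (simp_all add: p_def q_def)
  have eigu: "A u \<bullet> A v = p * (u \<bullet> v)" and eigw: "A w \<bullet> A v = q * (w \<bullet> v)" for v
    using u(3)[of v] w(3)[of v] by (simp_all add: p_def q_def)
  have eq_iff: "a = b" if "\<And>v. a \<bullet> A v = b \<bullet> A v" for a b
  proof -
    obtain v where "A v = a - b" using bij by (metis bij_pointE)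
    with that[of v] have "(a - b) \<bullet> (a - b) = 0" by (simp add: inner_diff_left)
    then show ?thesis by simp
  qed
  have q_pos: "q > 0"
  proof -
    have "w \<noteq> 0" using w(1) by auto
    then have "A w \<noteq> 0" using bij lin by (metis bij_def inj_eq linear_0)
    then show ?thesis by (simp add: q_def)
  qed
  have pq: "p = q"
  proof (rule ccontr)
    assume "p \<noteq> q"
    \<comment> \<open>Eigenvectors of A^T A for different eigenvalues are orthogonal.\<close>
    have "p * (u \<bullet> w) = q * (u \<bullet> w)"
      using eigu[of w] eigw[of u] by (simp add: inner_commute)
    with \<open>p \<noteq> q\<close> have uw: "u \<bullet> w = 0" by simp
    define good where "good z \<longleftrightarrow> z \<bullet> z = 1 \<and> z \<bullet> u = 0 \<and> z \<bullet> w = 0 \<and> z \<bullet> cross7 u w = 0" for z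
    \<comment> \<open>Solves \<open>cross7 w (z' z) = cross7 u z\<close>, since
      \<open>cross7 w\<close> squares to -1 on the complement of \<open>w\<close>; orthogonality of
      \<open>z\<close> to \<open>cross7 u w\<close> puts \<open>cross7 u z\<close> into that
      complement.\<close>
    define z' where "z' z = - cross7 w (cross7 u z)" for z
    have orth: "cross7 u z \<bullet> w = 0" if "good z" for z
      using that cross7_cyclic[of u z w] cross7_cyclic[of z w u] cross7_skew[of u w z] cross7_cyclic[of w u z]
      unfolding good_def by (simp add: inner_commute)
    have good': "good (z' z)" if z: "good z" for z
    proof -
      have "z' z \<bullet> z' z = 1"
        using cross7_inner_cross7[of w "cross7 u z" "cross7 u z"] cross7_inner_cross7[of u z z]
          orth[OF z] z uu ww unfolding z'_def good_def by (simp add: inner_commute)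
      moreover have "z' z \<bullet> u = 0"
      proof -
        have "z' z \<bullet> u = - (cross7 w (cross7 u z) \<bullet> u)" by (simp add: z'_def)
        also have "cross7 w (cross7 u z) \<bullet> u = cross7 u w \<bullet> cross7 u z"
          using cross7_cyclic[of u w "cross7 u z"] by simp
        finally show ?thesis
          using cross7_inner_cross7[of u w z] z uu uw unfolding good_def by (simp add: inner_commute)
      qed
      moreover have "z' z \<bullet> cross7 u w = 0"
      proof -
        have "z' z \<bullet> cross7 u w = - (cross7 w (cross7 u z) \<bullet> cross7 u w)" by (simp add: z'_def)
        also have "\<dots> = cross7 w (cross7 u z) \<bullet> cross7 w u"
          using cross7_skew[of u w "cross7 w (cross7 u z)"] by (simp add: inner_commute)
        finally show ?thesis
          using cross7_inner_cross7[of w "cross7 u z" u] cross7_orthogonal(1)[of u z] uw ww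
          by (simp add: inner_commute)
      qed
      ultimately show ?thesis by (simp add: good_def z'_def)
    qed
    have vals: "A z \<bullet> A z = q \<and> A (z' z) \<bullet> A (z' z) = p" if z: "good z" for z
    proof -
      have "cross7 w (z' z) = cross7 u z"
        using orth[OF z] ww by (simp add: z'_def cross7_cross7 inner_commute)
      then have "cross7 (A u) (A z) \<bullet> A v = cross7 (A w) (A (z' z)) \<bullet> A v" for v
        by (simp add: pres)
      then have same: "cross7 (A u) (A z) = cross7 (A w) (A (z' z))" by (rule eq_iff)
      have "cross7 (A u) (A z) \<bullet> cross7 (A u) (A z) = p * (A z \<bullet> A z)"
        using cross7_inner_cross7[of "A u" "A z" "A z"] eigu[of z] z
        by (simp add: good_def p_def inner_commute)
      moreover have "cross7 (A w) (A (z' z)) \<bullet> cross7 (A w) (A (z' z)) = q * (A (z' z) \<bullet> A (z' z))"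
        using cross7_inner_cross7[of "A w" "A (z' z)" "A (z' z)"] eigw[of "z' z"] good'[OF z]
        by (simp add: good_def q_def inner_commute)
      ultimately have eq: "p * (A z \<bullet> A z) = q * (A (z' z) \<bullet> A (z' z))" using same by simp
      have p_pos: "p > 0" using max[of w] q_pos unfolding q_def ww by linarith
      have le: "q \<le> A z \<bullet> A z" "A (z' z) \<bullet> A (z' z) \<le> p"
        using min[of z] max[of "z' z"] z good'[OF z] by (simp_all add: good_def)
      \<comment> \<open>The chain p q \<le> p |A z|^2 = q |A (z' z)|^2 \<le> q p is forced to
        consist of equalities.\<close>
      have "p * q \<le> p * (A z \<bullet> A z)" "q * (A (z' z) \<bullet> A (z' z)) \<le> q * p"
        using le p_pos q_pos by (simp_all add: mult_left_mono)
      with eq have "p * (A z \<bullet> A z) = p * q" "q * (A (z' z) \<bullet> A (z' z)) = q * p"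
        by (simp_all add: mult.commute)
      then show ?thesis using p_pos q_pos by simp
    qed
    obtain z where "norm z = 1" "z \<bullet> u = 0" "z \<bullet> w = 0" "z \<bullet> cross7 u w = 0"
      by (rule exists_orthogonal_3)
    then have "good z" by (simp add: good_def norm_eq_1)
    \<comment> \<open>\<open>z' z\<close> is good itself, so |A (z' z)|^2 is both \<open>p\<close>
      and \<open>q\<close>.\<close>
    with vals good' have "p = q" by metis
    with \<open>p \<noteq> q\<close> show False ..
  qed
  have norm_A: "A v \<bullet> A v = p * (v \<bullet> v)" for v
    using max[of v] min[of v] pq by simp
  have inner_A: "A v \<bullet> A w = p * (v \<bullet> w)" for v w
    using norm_A[of "v + w"] norm_A[of v] norm_A[of w]
    by (simp add: linear_add[OF lin] inner_add_left inner_add_right inner_commute algebra_simps)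
  obtain z where z: "norm z = 1" "z \<bullet> u = 0" by (rule exists_orthogonal_3[of u u u])
  define y where "y = cross7 u z"
  have yy: "y \<bullet> y = 1"
    using cross7_inner_cross7[of u z z] uu z by (simp add: y_def norm_eq_1 inner_commute)
  \<comment> \<open>\<open>A\<close> is by now conformal with factor \<open>p\<close>. Comparing
    squared lengths on both sides, for the unit vector \<open>y\<close>, gives p^2 p^2 = p.\<close>
  have "p *\<^sub>R cross7 (A u) (A z) = A y"
    by (rule eq_iff) (simp add: pres inner_A y_def)
  then have "p * p * (cross7 (A u) (A z) \<bullet> cross7 (A u) (A z)) = p"
    using norm_A[of y] yy by (metis inner_scaleR_left inner_scaleR_right mult.assoc mult.right_neutral)
  moreover have "cross7 (A u) (A z) \<bullet> cross7 (A u) (A z) = p * p"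
    using cross7_inner_cross7[of "A u" "A z" "A z"] z uu by (simp add: inner_A norm_eq_1 inner_commute)
  ultimately have "p ^ 3 = 1" using q_pos pq by (simp add: power3_eq_cube)
  then have "p = 1" using q_pos pq by (intro power_eq_imp_eq_base[of p 3 1]) auto
  with inner_A show ?thesis by simp
qed

lemma wedge1_short:
  "wedge1 \<alpha> \<omega> [u] = \<alpha> [u] * \<omega> []"
  "wedge1 \<alpha> \<omega> [u, v] = \<alpha> [u] * \<omega> [v] - \<alpha> [v] * \<omega> [u]"
  "wedge1 \<alpha> \<omega> [u, v, w] = \<alpha> [u] * \<omega> [v, w] - \<alpha> [v] * \<omega> [u, w] + \<alpha> [w] * \<omega> [u, v]"
  "wedge1 \<alpha> \<omega> [u, v, w, z] =
     \<alpha> [u] * \<omega> [v, w, z] - \<alpha> [v] * \<omega> [u, w, z] + \<alpha> [w] * \<omega> [u, v, z] - \<alpha> [z] * \<omega> [u, v, w]"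
  by (simp_all add: wedge1_Cons)

lemma ext_mono_3: "ext_mono x [i, j, k] [u, v, w] =
    x i [u] * (x j [v] * x k [w] - x j [w] * x k [v])
    - x i [v] * (x j [u] * x k [w] - x j [w] * x k [u])
    + x i [w] * (x j [u] * x k [v] - x j [v] * x k [u])"
  by (simp_all add: ext_mono_Cons wedge1_short ext_one_def)

lemma ext_mono_4: "ext_mono x [i, j, k, l] [u, v, w, z] =
    x i [u] * ext_mono x [j, k, l] [v, w, z] - x i [v] * ext_mono x [j, k, l] [u, w, z]
    + x i [w] * ext_mono x [j, k, l] [u, v, z] - x i [z] * ext_mono x [j, k, l] [u, v, w]"
  by (simp add: ext_mono_Cons wedge1_short)

lemma g2_form_cross7: "g2_form x [u, v, w] = cross7 (coords x u) (coords x v) \<bullet> coords x w"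
  unfolding g2_form_def plus_fun_apply minus_apply ext_mono_3 inner_7 cross7_nth coords_nth
  by algebra

text \<open>The 4-form \<star>\<phi> of an adapted coframe, see
  \<open>is_star_g2_form\<close>.\<close>

definition g2_dual_form :: "(nat \<Rightarrow> ext) \<Rightarrow> ext" where
  "g2_dual_form x = ext_mono x [1,2,3,4] + ext_mono x [1,2,5,6] + ext_mono x [3,4,5,6]
     + ext_mono x [1,3,6,7] + ext_mono x [1,4,5,7] + ext_mono x [2,3,5,7] - ext_mono x [2,4,6,7]"

text \<open>Expresses \<star>\<phi> through the cross product and the metric, without reference to
  the orientation; this is what recovers the volume form in
  \<open>adapted_volume_unique\<close>.\<close>

lemma g2_dual_form_cross7:
  "g2_dual_form x [u, v, w, z] =
     cross7 (coords x u) (coords x v) \<bullet> cross7 (coords x w) (coords x z)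
     - (coords x u \<bullet> coords x w) * (coords x v \<bullet> coords x z)
     + (coords x u \<bullet> coords x z) * (coords x v \<bullet> coords x w)"
  unfolding g2_dual_form_def plus_fun_apply minus_apply ext_mono_4 ext_mono_3 inner_7 cross7_nth coords_nth
  by algebra

lemma ext_scale_one [simp]: "1 *\<^sub>e \<omega> = \<omega>"
  by (rule ext) simp

lemma is_star_pos:
  assumes "covector_basis x" "distinct (is @ js)" "set (is @ js) = {1..7}" "length is = k"
    and "ext_mono x (is @ js) = frame_volume x"
  shows "is_star x k (ext_mono x is) (ext_mono x js)"
  using is_star_ext_mono[OF assms(1-4), of 1] assms(5) by simp

lemma is_star_neg:
  assumes "covector_basis x" "distinct (is @ js)" "set (is @ js) = {1..7}" "length is = k"
    and "ext_mono x (is @ js) = - frame_volume x"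
  shows "is_star x k (ext_mono x is) (- ext_mono x js)"
  using is_star_ext_mono[OF assms(1-4), of "-1"] assms(5) by (simp add: ext_scale_minus_one)

lemma is_star_g2_form:
  assumes "covector_basis x"
  shows "is_star x 3 (g2_form x) (g2_dual_form x)"
proof -
  have pos: "is_star x 3 (ext_mono x [1,2,7]) (ext_mono x [3,4,5,6])"
    "is_star x 3 (ext_mono x [3,4,7]) (ext_mono x [1,2,5,6])"
    "is_star x 3 (ext_mono x [5,6,7]) (ext_mono x [1,2,3,4])"
    by (rule is_star_pos[OF assms]; auto simp: ext_mono_Cons wedge1_swap)+
  have neg: "is_star x 3 (ext_mono x [1,3,5]) (- ext_mono x [2,4,6,7])"
    "is_star x 3 (ext_mono x [1,4,6]) (- ext_mono x [2,3,5,7])"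
    "is_star x 3 (ext_mono x [2,3,6]) (- ext_mono x [1,4,5,7])"
    "is_star x 3 (ext_mono x [2,4,5]) (- ext_mono x [1,3,6,7])"
    by (rule is_star_neg[OF assms]; auto simp: ext_mono_Cons wedge1_swap)+
  have "is_star x 3 (g2_form x) (ext_mono x [3,4,5,6] + ext_mono x [1,2,5,6] + ext_mono x [1,2,3,4]
      + - ext_mono x [2,4,6,7] - - ext_mono x [2,3,5,7] - - ext_mono x [1,4,5,7] - - ext_mono x [1,3,6,7])"
    unfolding g2_form_def by (intro is_star_add is_star_diff pos neg)
  also have "ext_mono x [3,4,5,6] + ext_mono x [1,2,5,6] + ext_mono x [1,2,3,4]
      + - ext_mono x [2,4,6,7] - - ext_mono x [2,3,5,7] - - ext_mono x [1,4,5,7] - - ext_mono x [1,3,6,7]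
      = g2_dual_form x"
    unfolding g2_dual_form_def by (simp add: algebra_simps)
  finally show ?thesis .
qed

text \<open>The map \<open>A\<close> between the coordinates of the two coframes preserves the
  triple product of \<open>cross7\<close>, because in either coordinates that product is the common
  3-form.\<close>

lemma adapted_metric_unique:
  assumes "adapted x \<phi>" "adapted y \<phi>"
  shows "frame_metric x = frame_metric y"
proof -
  have x: "covector_basis x" and y: "covector_basis y" and xy: "g2_form x = g2_form y"
    using assms by (auto simp: adapted_def)
  note bx = bij_coords[OF x] and b_y = bij_coords[OF y]
  define A where "A = coords y \<circ> inv_into UNIV (coords x)"
  have A: "A (coords x u) = coords y u" for u
    using bx by (simp add: A_def bij_def)
  have "linear (inv_into UNIV (coords x))"
    using linear_coords[OF x] bx by (simp add: inj_linear_imp_inv_linear bij_def)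
  then have lin: "linear A" unfolding A_def by (rule linear_compose) (rule linear_coords[OF y])
  have bij: "bij A" unfolding A_def by (intro bij_comp bij_imp_bij_inv bx b_y)
  have "cross7 (A u) (A v) \<bullet> A w = cross7 u v \<bullet> w" for u v w
  proof -
    obtain u' v' w' where "u = coords x u'" "v = coords x v'" "w = coords x w'"
      using bx by (metis bij_pointE)
    then show ?thesis
      using fun_cong[OF xy, of "[u', v', w']"] by (simp add: A g2_form_cross7)
  qed
  from cross7_preserving_isometry[OF lin bij this]
  have "A (coords x u) \<bullet> A (coords x v) = coords x u \<bullet> coords x v" for u v .
  then show ?thesis by (intro ext) (simp add: frame_metric_coords A)
qed

text \<open>The cross product is dual to \<phi> through the metric, so by nondegeneracy the vector
  \<open>a\<close> that represents it in one coframe represents it in the other.\<close>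

lemma cross7_frame_metric:
  assumes "covector_basis x" "covector_basis y" "g2_form x = g2_form y" "frame_metric x = frame_metric y"
  shows "cross7 (coords x u) (coords x v) \<bullet> cross7 (coords x w) (coords x z) =
    cross7 (coords y u) (coords y v) \<bullet> cross7 (coords y w) (coords y z)"
proof -
  obtain a where a: "coords x a = cross7 (coords x u) (coords x v)"
    using bij_coords[OF assms(1)] by (metis bij_pointE)
  have inner: "coords x b \<bullet> coords x c = coords y b \<bullet> coords y c" for b c
    using assms(4) by (metis frame_metric_coords)
  have form: "cross7 (coords x b) (coords x c) \<bullet> coords x d = cross7 (coords y b) (coords y c) \<bullet> coords y d"
    for b c d using fun_cong[OF assms(3), of "[b, c, d]"] by (simp add: g2_form_cross7)
  have "(coords y a - cross7 (coords y u) (coords y v)) \<bullet> coords y b = 0" for b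
    using inner[of a b] form[of u v b] a by (simp add: inner_diff_left)
  moreover obtain b where "coords y b = coords y a - cross7 (coords y u) (coords y v)"
    using bij_coords[OF assms(2)] by (metis bij_pointE)
  ultimately have "coords y a = cross7 (coords y u) (coords y v)"
    by (metis inner_eq_zero_iff right_minus_eq)
  with a show ?thesis
    using form[of w z a] by (simp add: inner_commute)
qed

text \<open>Both coframes yield the same metric and the same \<star>\<phi>. The defining equation of
  the star then equates the multiples of the two volume forms by a value of \<phi>, and three dual
  basis vectors make this value 1.\<close>

lemma adapted_volume_unique:
  assumes "adapted x \<phi>" "adapted y \<phi>"
  shows "frame_volume x = frame_volume y"
proof -
  have x: "covector_basis x" and y: "covector_basis y" and xy: "g2_form x = g2_form y"
    using assms by (auto simp: adapted_def)
  have metric: "frame_metric x = frame_metric y" by (rule adapted_metric_unique[OF assms])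
  then have inner: "coords x u \<bullet> coords x v = coords y u \<bullet> coords y v" for u v
    by (metis frame_metric_coords)
  note star = is_star_g2_form[OF x] is_star_g2_form[OF y]
  have "g2_dual_form x vs = g2_dual_form y vs" for vs
  proof (cases "length vs = 4")
    case True
    then obtain u v w z where "vs = [u, v, w, z]"
      by (auto simp: length_Suc_conv eval_nat_numeral)
    then show ?thesis
      by (simp only: g2_dual_form_cross7 cross7_frame_metric[OF x y xy metric] inner)
  next
    case False
    with star show ?thesis by (simp add: is_star_def alternating_form_def)
  qed
  then have "g2_dual_form x = g2_dual_form y" ..
  with star metric have "g2_form x us *\<^sub>e frame_volume x = g2_form y us *\<^sub>e frame_volume y"
    if "length us = 3" for us
    using that unfolding is_star_def by metis
  from this[of "map (dual_basis x) [1,2,7]"] xy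
  have "g2_form x (map (dual_basis x) [1,2,7]) *\<^sub>e frame_volume x
      = g2_form x (map (dual_basis x) [1,2,7]) *\<^sub>e frame_volume y" by simp
  moreover have "g2_form x (map (dual_basis x) [1,2,7]) = 1"
    using dual_basis[OF x] by (simp add: g2_form_def ext_mono_3)
  ultimately show ?thesis by simp
qed

lemma g2_metric_eq:
  assumes "adapted x \<phi>"
  shows "g2_metric \<phi> = frame_metric x"
  unfolding g2_metric_def frame_metric_def[symmetric]
proof (rule the_equality)
  show "\<exists>y. adapted y \<phi> \<and> frame_metric x = frame_metric y" using assms by blast
  show "g = frame_metric x" if "\<exists>y. adapted y \<phi> \<and> g = frame_metric y" for g
    using that adapted_metric_unique[OF assms] by auto
qed

lemma g2_volume_eq:
  assumes "adapted x \<phi>"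
  shows "g2_volume \<phi> = frame_volume x"
  unfolding g2_volume_def
proof (rule the_equality)
  show "\<exists>y. adapted y \<phi> \<and> frame_volume x = frame_volume y" using assms by blast
  show "\<nu> = frame_volume x" if "\<exists>y. adapted y \<phi> \<and> \<nu> = frame_volume y" for \<nu>
    using that adapted_volume_unique[OF assms] by auto
qed

lemma star_eq:
  assumes "adapted x (\<phi> C y)" "k \<le> 7" "is_star x k (\<omega> C y) \<gamma>"
  shows "star \<phi> k \<omega> C y = \<gamma>"
  unfolding star_def g2_metric_eq[OF assms(1)] g2_volume_eq[OF assms(1)]
  using assms by (intro hodge_eq) (simp_all add: adapted_def)


section \<open>Smooth left-invariant forms\<close>

lemma Ck_on_cong:
  assumes "open S" "\<And>x. x \<in> S \<Longrightarrow> f x = g x"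
  shows "Ck_on k S f \<Longrightarrow> Ck_on k S g"
  using assms(2)
proof (induction k arbitrary: f g)
  case 0
  then show ?case by (simp cong: continuous_on_cong)
next
  case (Suc k)
  have deriv: "(f has_derivative D) (at x) \<longleftrightarrow> (g has_derivative D) (at x)" if "x \<in> S" for D x
    using that Suc.prems(2) assms(1) by (auto elim!: has_derivative_transform_within_open)
  have eq: "frechet_derivative f (at x) = frechet_derivative g (at x)" if "x \<in> S" for x
    using deriv[OF that] by (simp add: frechet_derivative_def)
  have "Ck_on k S (\<lambda>x. frechet_derivative f (at x) v)" for v using Suc.prems(1) by simp
  from Suc.IH[OF this] eq have "Ck_on k S (\<lambda>x. frechet_derivative g (at x) v)" for v by simp
  moreover have "g differentiable (at x)" if "x \<in> S" for x
    using Suc.prems(1) that unfolding differentiable_def deriv[OF that, symmetric]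
    by (auto simp: differentiable_def)
  ultimately show ?case by simp
qed

lemma Ck_on_Suc_imp: "Ck_on (Suc k) S f \<Longrightarrow> Ck_on k S f"
proof (induction k arbitrary: f)
  case 0
  then show ?case
    by (auto intro!: continuous_at_imp_continuous_on differentiable_imp_continuous_within)
next
  case (Suc k)
  then show ?case by (metis Ck_on.simps(2))
qed

lemma Ck_on_const: "Ck_on k S (\<lambda>x. c)"
  by (induction k arbitrary: c) (simp_all add: frechet_derivative_const)

lemma Ck_on_add:
  fixes f g :: "'a::euclidean_space \<Rightarrow> real"
  assumes "open S"
  shows "Ck_on k S f \<Longrightarrow> Ck_on k S g \<Longrightarrow> Ck_on k S (\<lambda>x. f x + g x)"
proof (induction k arbitrary: f g)
  case (Suc k)
  have "Ck_on k S (\<lambda>x. frechet_derivative f (at x) v + frechet_derivative g (at x) v)" for v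
    using Suc.prems by (intro Suc.IH) auto
  then have "Ck_on k S (\<lambda>x. frechet_derivative (\<lambda>x. f x + g x) (at x) v)" for v
    by (rule Ck_on_cong[OF assms, rotated]) (use Suc.prems in \<open>auto simp: frechet_derivative_add_real\<close>)
  with Suc.prems show ?case by simp
qed (simp add: continuous_on_add)

lemma Ck_on_mult:
  fixes f g :: "'a::euclidean_space \<Rightarrow> real"
  assumes "open S"
  shows "Ck_on k S f \<Longrightarrow> Ck_on k S g \<Longrightarrow> Ck_on k S (\<lambda>x. f x * g x)"
proof (induction k arbitrary: f g)
  case (Suc k)
  \<comment> \<open>The product rule pairs a derivative, of class \<open>k\<close> only, with a
    factor of class \<open>Suc k\<close>, which is weakened to class \<open>k\<close> to fit the
    induction hypothesis.\<close>
  have "Ck_on k S (\<lambda>x. f x * frechet_derivative g (at x) v + frechet_derivative f (at x) v * g x)" for v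
    using Suc.prems Ck_on_Suc_imp[OF Suc.prems(1)] Ck_on_Suc_imp[OF Suc.prems(2)]
    by (intro Ck_on_add[OF assms] Suc.IH) auto
  then have "Ck_on k S (\<lambda>x. frechet_derivative (\<lambda>x. f x * g x) (at x) v)" for v
    by (rule Ck_on_cong[OF assms, rotated]) (use Suc.prems in \<open>auto simp: frechet_derivative_mult_real\<close>)
  with Suc.prems show ?case by simp
qed (simp add: continuous_on_mult)

lemma smooth_on_const: "smooth_on S (\<lambda>x. c)"
  by (simp add: smooth_on_def Ck_on_const)

lemma smooth_on_add:
  fixes f g :: "'a::euclidean_space \<Rightarrow> real"
  shows "open S \<Longrightarrow> smooth_on S f \<Longrightarrow> smooth_on S g \<Longrightarrow> smooth_on S (\<lambda>x. f x + g x)"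
  by (simp add: smooth_on_def Ck_on_add)

lemma smooth_on_mult:
  fixes f g :: "'a::euclidean_space \<Rightarrow> real"
  shows "open S \<Longrightarrow> smooth_on S f \<Longrightarrow> smooth_on S g \<Longrightarrow> smooth_on S (\<lambda>x. f x * g x)"
  by (simp add: smooth_on_def Ck_on_mult)

lemma smooth_on_sum:
  fixes f :: "'i \<Rightarrow> 'a::euclidean_space \<Rightarrow> real"
  assumes "open S" "\<And>i. i \<in> I \<Longrightarrow> smooth_on S (f i)"
  shows "smooth_on S (\<lambda>x. \<Sum>i\<in>I. f i x)"
  using assms(2)
  by (induction I rule: infinite_finite_induct) (auto simp: smooth_on_const smooth_on_add[OF assms(1)])

lemma smooth_on_differentiable: "smooth_on S f \<Longrightarrow> x \<in> S \<Longrightarrow> f differentiable (at x)"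
  unfolding smooth_on_def by (metis Ck_on.simps(2))

lemma smooth_on_ext_mono:
  assumes "open S" "\<And>i vs. i \<in> set is \<Longrightarrow> smooth_on S (\<lambda>x. X i x vs)"
  shows "smooth_on S (\<lambda>x. ext_mono (\<lambda>i. X i x) is vs)"
  using assms(2)
proof (induction "is" arbitrary: vs)
  case (Cons i "is")
  then show ?case
    unfolding ext_mono_Cons wedge1_def
    by (intro smooth_on_sum smooth_on_mult smooth_on_const assms(1)) auto
qed (simp add: smooth_on_const)

section \<open>Linear combinations and monomials of smooth forms on the manifold\<close>

lemma smooth_atlas_open: "smooth_atlas \<A> \<Longrightarrow> (U, c) \<in> \<A> \<Longrightarrow> open (c ` U)"
  unfolding smooth_atlas_def by auto

lemma form_scale_eq: "(r *\<^sub>f \<omega>) C x = r *\<^sub>e \<omega> C x"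
  by (simp add: form_scale_def ext_scale_def)

lemma diff_form_intro:
  assumes "\<And>U c x. (U, c) \<in> \<A> \<Longrightarrow> x \<in> c ` U \<Longrightarrow> alternating_form k (\<omega> (U, c) x)"
    and "\<And>U c vs. (U, c) \<in> \<A> \<Longrightarrow> smooth_on (c ` U) (\<lambda>x. \<omega> (U, c) x vs)"
    and "\<And>U c V d p vs. (U, c) \<in> \<A> \<Longrightarrow> (V, d) \<in> \<A> \<Longrightarrow> p \<in> U \<Longrightarrow> p \<in> V \<Longrightarrow>
      \<omega> (U, c) (c p) vs =
      \<omega> (V, d) (d p) (map (frechet_derivative (d \<circ> inv_into U c) (at (c p))) vs)"
  shows "diff_form \<A> UNIV k \<omega>"
  unfolding diff_form_def split_def
  by (intro conjI ballI allI; (rule assms(1) | unfold Int_UNIV_right, rule assms(2) | rule assms(3)); simp)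

lemma diff_form_dest:
  assumes "diff_form \<A> UNIV k \<omega>" "(U, c) \<in> \<A>"
  shows "x \<in> c ` U \<Longrightarrow> alternating_form k (\<omega> (U, c) x)"
    and "smooth_on (c ` U) (\<lambda>x. \<omega> (U, c) x vs)"
    and "(V, d) \<in> \<A> \<Longrightarrow> p \<in> U \<Longrightarrow> p \<in> V \<Longrightarrow> \<omega> (U, c) (c p) vs =
      \<omega> (V, d) (d p) (map (frechet_derivative (d \<circ> inv_into U c) (at (c p))) vs)"
proof -
  note local = bspec[OF conjunct1[OF assms(1)[unfolded diff_form_def]] assms(2), unfolded prod.case Int_UNIV_right]
  show "x \<in> c ` U \<Longrightarrow> alternating_form k (\<omega> (U, c) x)" using local by blast
  show "smooth_on (c ` U) (\<lambda>x. \<omega> (U, c) x vs)" using local by blast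
  assume V: "(V, d) \<in> \<A>" and p: "p \<in> U" "p \<in> V"
  from bspec[OF bspec[OF conjunct2[OF assms(1)[unfolded diff_form_def]] assms(2), unfolded prod.case] V]
  show "\<omega> (U, c) (c p) vs =
      \<omega> (V, d) (d p) (map (frechet_derivative (d \<circ> inv_into U c) (at (c p))) vs)"
    using p by (simp only: prod.case Int_iff UNIV_I simp_thms Ball_def)
qed

lemma diff_form_add:
  assumes "smooth_atlas \<A>" "diff_form \<A> UNIV k \<omega>" "diff_form \<A> UNIV k \<eta>"
  shows "diff_form \<A> UNIV k (\<omega> + \<eta>)"
proof (rule diff_form_intro)
  fix U c x assume "(U, c) \<in> \<A>" "x \<in> c ` U"
  then show "alternating_form k ((\<omega> + \<eta>) (U, c) x)"
    using diff_form_dest(1)[OF assms(2)] diff_form_dest(1)[OF assms(3)]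
    by (simp only: plus_fun_apply alternating_form_add)
next
  fix U c vs assume "(U, c) \<in> \<A>"
  then show "smooth_on (c ` U) (\<lambda>x. (\<omega> + \<eta>) (U, c) x vs)"
    using diff_form_dest(2)[OF assms(2)] diff_form_dest(2)[OF assms(3)]
    by (simp add: smooth_on_add smooth_atlas_open[OF assms(1)])
next
  fix U c V d p vs assume "(U, c) \<in> \<A>" "(V, d) \<in> \<A>" "p \<in> U" "p \<in> V"
  then show "(\<omega> + \<eta>) (U, c) (c p) vs =
      (\<omega> + \<eta>) (V, d) (d p) (map (frechet_derivative (d \<circ> inv_into U c) (at (c p))) vs)"
    using diff_form_dest(3)[OF assms(2), of U c V d p vs] diff_form_dest(3)[OF assms(3), of U c V d p vs]
    by simp
qed

lemma diff_form_scale: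
  assumes "smooth_atlas \<A>" "diff_form \<A> UNIV k \<omega>"
  shows "diff_form \<A> UNIV k (r *\<^sub>f \<omega>)"
proof (rule diff_form_intro)
  fix U c x assume "(U, c) \<in> \<A>" "x \<in> c ` U"
  then show "alternating_form k ((r *\<^sub>f \<omega>) (U, c) x)"
    using diff_form_dest(1)[OF assms(2)] by (simp only: form_scale_eq alternating_form_scale)
next
  fix U c vs assume "(U, c) \<in> \<A>"
  then show "smooth_on (c ` U) (\<lambda>x. (r *\<^sub>f \<omega>) (U, c) x vs)"
    using diff_form_dest(2)[OF assms(2)]
    by (simp add: form_scale_def smooth_on_mult smooth_on_const smooth_atlas_open[OF assms(1)])
next
  fix U c V d p vs assume "(U, c) \<in> \<A>" "(V, d) \<in> \<A>" "p \<in> U" "p \<in> V"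
  then show "(r *\<^sub>f \<omega>) (U, c) (c p) vs =
      (r *\<^sub>f \<omega>) (V, d) (d p) (map (frechet_derivative (d \<circ> inv_into U c) (at (c p))) vs)"
    using diff_form_dest(3)[OF assms(2), of U c V d p vs] by (simp add: form_scale_def)
qed

lemma form_diff_eq: "(\<omega> :: 'a form) - \<eta> = \<omega> + (-1) *\<^sub>f \<eta>"
  by (simp add: fun_eq_iff form_scale_def)

lemma diff_form_diff:
  assumes "smooth_atlas \<A>" "diff_form \<A> UNIV k \<omega>" "diff_form \<A> UNIV k \<eta>"
  shows "diff_form \<A> UNIV k (\<omega> - \<eta>)"
  unfolding form_diff_eq by (intro diff_form_add diff_form_scale assms)

lemma diff_form_mono:
  assumes "smooth_atlas \<A>" "\<And>i. i \<in> set is \<Longrightarrow> diff_form \<A> UNIV 1 (e i)" "length is = k"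
  shows "diff_form \<A> UNIV k (e \<up> is)"
proof (rule diff_form_intro)
  fix U c x assume "(U, c) \<in> \<A>" "x \<in> c ` U"
  then show "alternating_form k ((e \<up> is) (U, c) x)"
    unfolding form_mono_def using assms(2,3) diff_form_dest(1)
    by (intro alternating_form_ext_mono) blast+
next
  fix U c vs assume "(U, c) \<in> \<A>"
  then show "smooth_on (c ` U) (\<lambda>x. (e \<up> is) (U, c) x vs)"
    unfolding form_mono_def using assms(2) diff_form_dest(2) smooth_atlas_open[OF assms(1)]
    by (intro smooth_on_ext_mono) blast+
next
  fix U c V d p vs assume *: "(U, c) \<in> \<A>" "(V, d) \<in> \<A>" "p \<in> U" "p \<in> V"
  show "(e \<up> is) (U, c) (c p) vs =
      (e \<up> is) (V, d) (d p) (map (frechet_derivative (d \<circ> inv_into U c) (at (c p))) vs)"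
    unfolding form_mono_def ext_mono_map
    using diff_form_dest(3)[OF assms(2) *(1,2)] *(3,4)
    by (intro fun_cong[OF ext_mono_cong] ext) blast
qed

section \<open>Left-invariance under the same operations, and pointwise bases\<close>

lemma left_invariant_intro:
  assumes "\<And>U c V d p g vs. (U, c) \<in> \<A> \<Longrightarrow> (V, d) \<in> \<A> \<Longrightarrow> p \<in> U \<Longrightarrow> g \<otimes>\<^bsub>G\<^esub> p \<in> V \<Longrightarrow>
    \<omega> (U, c) (c p) vs = \<omega> (V, d) (d (g \<otimes>\<^bsub>G\<^esub> p))
      (map (frechet_derivative (\<lambda>x. d (g \<otimes>\<^bsub>G\<^esub> inv_into U c x)) (at (c p))) vs)"
  shows "left_invariant \<A> G \<omega>"
  unfolding left_invariant_def split_def by (intro allI ballI impI; rule assms; simp)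

lemma left_invariant_dest:
  assumes "left_invariant \<A> G \<omega>" "(U, c) \<in> \<A>" "(V, d) \<in> \<A>" "p \<in> U" "g \<otimes>\<^bsub>G\<^esub> p \<in> V"
  shows "\<omega> (U, c) (c p) vs = \<omega> (V, d) (d (g \<otimes>\<^bsub>G\<^esub> p))
    (map (frechet_derivative (\<lambda>x. d (g \<otimes>\<^bsub>G\<^esub> inv_into U c x)) (at (c p))) vs)"
  using assms unfolding left_invariant_def by blast

lemma left_invariant_add:
  assumes "left_invariant \<A> G \<omega>" "left_invariant \<A> G \<eta>"
  shows "left_invariant \<A> G (\<omega> + \<eta>)"
  using left_invariant_dest[OF assms(1)] left_invariant_dest[OF assms(2)]
  by (intro left_invariant_intro) (simp only: plus_fun_apply)

lemma left_invariant_scale: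
  assumes "left_invariant \<A> G \<omega>"
  shows "left_invariant \<A> G (r *\<^sub>f \<omega>)"
  using left_invariant_dest[OF assms] by (intro left_invariant_intro) (simp only: form_scale_def)

lemma left_invariant_diff:
  assumes "left_invariant \<A> G \<omega>" "left_invariant \<A> G \<eta>"
  shows "left_invariant \<A> G (\<omega> - \<eta>)"
  unfolding form_diff_eq by (intro left_invariant_add left_invariant_scale assms)

lemma left_invariant_mono:
  assumes "\<And>i. i \<in> set is \<Longrightarrow> left_invariant \<A> G (e i)"
  shows "left_invariant \<A> G (e \<up> is)"
proof (rule left_invariant_intro)
  fix U c V d p g vs
  assume *: "(U, c) \<in> \<A>" "(V, d) \<in> \<A>" "p \<in> U" "g \<otimes>\<^bsub>G\<^esub> p \<in> V"
  show "(e \<up> is) (U, c) (c p) vs = (e \<up> is) (V, d) (d (g \<otimes>\<^bsub>G\<^esub> p))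
      (map (frechet_derivative (\<lambda>x. d (g \<otimes>\<^bsub>G\<^esub> inv_into U c x)) (at (c p))) vs)"
    unfolding form_mono_def ext_mono_map
    using left_invariant_dest[OF assms *] by (intro fun_cong[OF ext_mono_cong] ext) blast
qed

lemma form_sum_apply: "(\<Sum>i\<in>I. (\<omega> i :: 'a form)) C x vs = (\<Sum>i\<in>I. \<omega> i C x vs)"
  by (induction I rule: infinite_finite_induct) auto

text \<open>
  A linear relation between left-invariant forms at one point is carried to every other point by a
  left translation, so linear independence over the constants is pointwise linear independence.
\<close>

lemma left_invariant_basis_pointwise:
  assumes lie: "lie_group \<A> S" and basis: "left_invariant_basis \<A> S e"
    and chart: "(U, c) \<in> \<A>" "x \<in> c ` U"
  shows "covector_basis (\<lambda>i. e i (U, c) x)"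
proof -
  have forms: "diff_form \<A> UNIV 1 (e i)" "left_invariant \<A> S (e i)" if "i \<in> {1..7}" for i
    using basis that unfolding left_invariant_basis_def by blast+
  obtain p where p: "p \<in> U" "x = c p" using chart by blast
  have "\<forall>i\<in>{1..7}. a i = 0" if a: "\<forall>v. (\<Sum>i=1..7. a i * e i (U, c) x [v]) = 0" for a :: "nat \<Rightarrow> real"
  proof -
    have "(\<Sum>i=1..7. a i *\<^sub>f e i) (V, d) y vs = 0" if V: "(V, d) \<in> \<A>" "y \<in> d ` V" for V d y vs
    proof (cases "length vs = 1")
      case True
      then obtain v where vs: "vs = [v]" by (auto simp: length_Suc_conv)
      obtain q where q: "q \<in> V" "y = d q" using V by blast
      \<comment> \<open>Left translation by \<open>g\<close> carries \<open>q\<close> to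
        \<open>p\<close>; \<open>D\<close> is its differential at \<open>q\<close> in the two
        charts.\<close>
      define g where "g = p \<otimes>\<^bsub>S\<^esub> inv\<^bsub>S\<^esub> q"
      have "group S" "carrier S = UNIV" using lie by (auto simp: lie_group_def)
      then have gq: "g \<otimes>\<^bsub>S\<^esub> q = p"
        by (simp add: g_def group.inv_closed group.l_inv group.is_monoid monoid.m_assoc monoid.r_one)
      define D where "D = frechet_derivative (\<lambda>x. c (g \<otimes>\<^bsub>S\<^esub> inv_into V d x)) (at (d q))"
      have "e i (V, d) y vs = e i (U, c) x [D v]" if "i \<in> {1..7}" for i
        using left_invariant_dest[OF forms(2)[OF that] V(1) chart(1) q(1), of g vs] p q gq
        by (simp add: vs D_def)
      then have "(\<Sum>i=1..7. a i *\<^sub>f e i) (V, d) y vs = (\<Sum>i=1..7. a i * e i (U, c) x [D v])"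
        unfolding form_sum_apply form_scale_def by (intro sum.cong) auto
      with a show ?thesis by simp
    next
      case False
      then have "e i (V, d) y vs = 0" if "i \<in> {1..7}" for i
        using diff_form_dest(1)[OF forms(1)[OF that] V] unfolding alternating_form_def by blast
      then show ?thesis unfolding form_sum_apply form_scale_def by (intro sum.neutral) auto
    qed
    then have "form_eq \<A> (\<Sum>i=1..7. a i *\<^sub>f e i) 0"
      unfolding form_eq_def by (auto simp: fun_eq_iff simp del: sum.cl_ivl_Suc)
    then show ?thesis using basis unfolding left_invariant_basis_def by blast
  qed
  moreover have "\<forall>i\<in>{1..7}. alternating_form 1 (e i (U, c) x)"
    using diff_form_dest(1)[OF forms(1) chart] by blast
  ultimately show ?thesis unfolding covector_basis_def by blast
qed

lemma covector_basis_scale: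
  assumes "covector_basis x" "\<And>i. i \<in> {1..7} \<Longrightarrow> f i \<noteq> 0"
  shows "covector_basis (\<lambda>i. f i *\<^sub>e x i)"
  unfolding covector_basis_def
proof (intro conjI ballI allI impI)
  fix i :: nat assume "i \<in> {1..7}"
  then show "alternating_form 1 (f i *\<^sub>e x i)"
    using assms(1) unfolding covector_basis_def by (blast intro: alternating_form_scale)
next
  fix a :: "nat \<Rightarrow> real" and i :: nat
  assume "\<forall>v. (\<Sum>i=1..7. a i * (f i *\<^sub>e x i) [v]) = 0" and i: "i \<in> {1..7}"
  then have "\<forall>v. (\<Sum>i=1..7. (a i * f i) * x i [v]) = 0"
    by (simp add: mult.assoc)
  with conjunct2[OF assms(1)[unfolded covector_basis_def], THEN spec, of "\<lambda>i. a i * f i"]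
  have "\<forall>i\<in>{1..7}. a i * f i = 0" by blast
  from bspec[OF this i] assms(2)[OF i] show "a i = 0" by simp
qed


section \<open>The structure equations\<close>

text \<open>The 4-form is x^7 \<and> \<phi>, hence d\<phi> up to a factor. With \<omega> = x^12 +
  x^34 + x^56 and \<rho> the real part of the wedge product of x^1 + i x^2, x^3 + i x^4 and x^5 + i
  x^6, the form \<phi> is \<omega> \<and> x^7 + \<rho>, and the star here is the imaginary part of
  the same product.\<close>

lemma is_star_dg2_form:
  assumes "covector_basis x"
  shows "is_star x 4 (ext_mono x [1,4,6,7] + ext_mono x [2,3,6,7] + ext_mono x [2,4,5,7] - ext_mono x [1,3,5,7])
    (ext_mono x [1,3,6] + ext_mono x [1,4,5] + ext_mono x [2,3,5] - ext_mono x [2,4,6])"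
proof -
  have pos: "is_star x 4 (ext_mono x [1,4,6,7]) (ext_mono x [2,3,5])"
    "is_star x 4 (ext_mono x [2,3,6,7]) (ext_mono x [1,4,5])"
    "is_star x 4 (ext_mono x [2,4,5,7]) (ext_mono x [1,3,6])"
    "is_star x 4 (ext_mono x [1,3,5,7]) (ext_mono x [2,4,6])"
    by (rule is_star_pos[OF assms]; auto simp: ext_mono_Cons wedge1_swap)+
  have "is_star x 4 (ext_mono x [1,4,6,7] + ext_mono x [2,3,6,7] + ext_mono x [2,4,5,7] - ext_mono x [1,3,5,7])
    (ext_mono x [2,3,5] + ext_mono x [1,4,5] + ext_mono x [1,3,6] - ext_mono x [2,4,6])"
    by (intro is_star_add is_star_diff pos)
  then show ?thesis by (simp add: add.commute add.left_commute)
qed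

text \<open>The 5-form is x^7 \<and> \<star>\<phi>, hence d \<star>\<phi> up to a factor; its star
  is the 2-form x^12 + x^34 + x^56.\<close>

lemma is_star_dg2_dual_form:
  assumes "covector_basis x"
  shows "is_star x 5 (ext_mono x [1,2,3,4,7] + ext_mono x [1,2,5,6,7] + ext_mono x [3,4,5,6,7])
    (ext_mono x [5,6] + ext_mono x [3,4] + ext_mono x [1,2])"
  by (intro is_star_add; rule is_star_pos[OF assms]; auto simp: ext_mono_Cons wedge1_swap)

text \<open>Arbitrary coefficients on the seven monomials of \<star>\<phi>: the form d \<star>
  d\<phi> has this shape, with coefficients built from the structure constants.\<close>

lemma is_star_four_forms:
  assumes "covector_basis x"
  shows "is_star x 4
    (r1 *\<^sub>e ext_mono x [1,2,3,4] + r2 *\<^sub>e ext_mono x [1,2,5,6] + r3 *\<^sub>e ext_mono x [3,4,5,6]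
     + r4 *\<^sub>e ext_mono x [1,3,6,7] + r5 *\<^sub>e ext_mono x [1,4,5,7] + r6 *\<^sub>e ext_mono x [2,3,5,7]
     + r7 *\<^sub>e ext_mono x [2,4,6,7])
    (r1 *\<^sub>e ext_mono x [5,6,7] + r2 *\<^sub>e ext_mono x [3,4,7] + r3 *\<^sub>e ext_mono x [1,2,7]
     + r4 *\<^sub>e (- ext_mono x [2,4,5]) + r5 *\<^sub>e (- ext_mono x [2,3,6]) + r6 *\<^sub>e (- ext_mono x [1,4,6])
     + r7 *\<^sub>e (- ext_mono x [1,3,5]))"
proof -
  have pos: "is_star x 4 (ext_mono x [1,2,3,4]) (ext_mono x [5,6,7])"
    "is_star x 4 (ext_mono x [1,2,5,6]) (ext_mono x [3,4,7])"
    "is_star x 4 (ext_mono x [3,4,5,6]) (ext_mono x [1,2,7])"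
    by (rule is_star_pos[OF assms]; auto simp: ext_mono_Cons wedge1_swap)+
  have neg: "is_star x 4 (ext_mono x [1,3,6,7]) (- ext_mono x [2,4,5])"
    "is_star x 4 (ext_mono x [1,4,5,7]) (- ext_mono x [2,3,6])"
    "is_star x 4 (ext_mono x [2,3,5,7]) (- ext_mono x [1,4,6])"
    "is_star x 4 (ext_mono x [2,4,6,7]) (- ext_mono x [1,3,5])"
    by (rule is_star_neg[OF assms]; auto simp: ext_mono_Cons wedge1_swap)+
  show ?thesis by (intro is_star_add is_star_scale pos neg)
qed

text \<open>
  A common form of the structure equations of all the algebras \<open>cp\<^sub>s\<^sup>m\<close>. The linear equations for the
  coefficients say that \<open>d\<phi> = 3 m x\<^sup>7 \<and> \<phi>\<close> and \<open>d \<star>\<phi> = 4 m x\<^sup>7 \<and> \<star>\<phi>\<close>.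
\<close>

locale cp_frame =
  fixes Y :: "(real^7) set" and X :: "nat \<Rightarrow> real^7 \<Rightarrow> ext"
    and p :: "nat \<Rightarrow> real" and a b c f g h m :: real
  assumes open_Y: "open Y"
    and basis: "y \<in> Y \<Longrightarrow> covector_basis (\<lambda>i. X i y)"
    and differentiable: "y \<in> Y \<Longrightarrow> i \<in> {1..7} \<Longrightarrow> ext_differentiable (X i) y"
    and cartan:
      "y \<in> Y \<Longrightarrow> ed (X 1) y = (- p 1) *\<^sub>e ext_mono (\<lambda>i. X i y) [1,7]
         + a *\<^sub>e ext_mono (\<lambda>i. X i y) [3,6] + b *\<^sub>e ext_mono (\<lambda>i. X i y) [4,5]"
      "y \<in> Y \<Longrightarrow> ed (X 2) y = (- p 2) *\<^sub>e ext_mono (\<lambda>i. X i y) [2,7]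
         + c *\<^sub>e ext_mono (\<lambda>i. X i y) [3,5] + f *\<^sub>e ext_mono (\<lambda>i. X i y) [4,6]"
      "y \<in> Y \<Longrightarrow> ed (X 3) y = (- p 3) *\<^sub>e ext_mono (\<lambda>i. X i y) [3,7]"
      "y \<in> Y \<Longrightarrow> ed (X 4) y = (- p 4) *\<^sub>e ext_mono (\<lambda>i. X i y) [4,7] + g *\<^sub>e ext_mono (\<lambda>i. X i y) [2,6]"
      "y \<in> Y \<Longrightarrow> ed (X 5) y = (- p 5) *\<^sub>e ext_mono (\<lambda>i. X i y) [5,7] + h *\<^sub>e ext_mono (\<lambda>i. X i y) [2,3]"
      "y \<in> Y \<Longrightarrow> ed (X 6) y = (- p 6) *\<^sub>e ext_mono (\<lambda>i. X i y) [6,7]"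
      "y \<in> Y \<Longrightarrow> ed (X 7) y = 0"
    and lee:
      "p 1 + p 3 + p 5 + c = 3 * m" "p 1 + p 4 + p 6 - f = 3 * m"
      "p 2 + p 3 + p 6 + a + g + h = 3 * m" "p 2 + p 4 + p 5 + b = 3 * m"
      "p 1 + p 2 + p 3 + p 4 + h = 4 * m" "p 1 + p 2 + p 5 + p 6 + g = 4 * m"
      "p 3 + p 4 + p 5 + p 6 + a + b + c - f = 4 * m"
begin

abbreviation M :: "nat list \<Rightarrow> real^7 \<Rightarrow> ext" where
  "M is \<equiv> (\<lambda>y. ext_mono (\<lambda>i. X i y) is)"

lemma differentiable_M: "y \<in> Y \<Longrightarrow> set is \<subseteq> {1..7} \<Longrightarrow> ext_differentiable (M is) y"
  by (intro ext_differentiable_ext_mono differentiable) auto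

lemma ed_ext_one: "ed (\<lambda>y. ext_one) y = 0"
  by (rule ext) (simp add: ed_def)

lemma X_swap:
  "j < i \<Longrightarrow> wedge1 (X i y) (wedge1 (X j y) \<omega>) = - wedge1 (X j y) (wedge1 (X i y) \<omega>)"
  by (rule wedge1_anticommute)

lemma ed_M_Cons:
  assumes "y \<in> Y" "i \<in> {1..7}" "set is \<subseteq> {1..7}"
  shows "ed (M (i # is)) y = wedge2 (ed (X i) y) (M is y) - wedge1 (X i y) (ed (M is) y)"
  unfolding ext_mono_Cons
  by (intro ed_wedge1 differentiable differentiable_M assms)

text \<open>The Leibniz rule with the structure equations inserted, as a recursion for the
  derivative of a monomial; the index lists come out unsorted.\<close>

lemma ed_monomial:
  assumes "y \<in> Y" "set is \<subseteq> {1..7}"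
  shows
    "ed (M (1 # is)) y = (- p 1) *\<^sub>e M (1 # 7 # is) y + a *\<^sub>e M (3 # 6 # is) y + b *\<^sub>e M (4 # 5 # is) y
       - wedge1 (X 1 y) (ed (M is) y)"
    "ed (M (2 # is)) y = (- p 2) *\<^sub>e M (2 # 7 # is) y + c *\<^sub>e M (3 # 5 # is) y + f *\<^sub>e M (4 # 6 # is) y
       - wedge1 (X 2 y) (ed (M is) y)"
    "ed (M (3 # is)) y = (- p 3) *\<^sub>e M (3 # 7 # is) y - wedge1 (X 3 y) (ed (M is) y)"
    "ed (M (4 # is)) y = (- p 4) *\<^sub>e M (4 # 7 # is) y + g *\<^sub>e M (2 # 6 # is) y
       - wedge1 (X 4 y) (ed (M is) y)"
    "ed (M (5 # is)) y = (- p 5) *\<^sub>e M (5 # 7 # is) y + h *\<^sub>e M (2 # 3 # is) y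
       - wedge1 (X 5 y) (ed (M is) y)"
    "ed (M (6 # is)) y = (- p 6) *\<^sub>e M (6 # 7 # is) y - wedge1 (X 6 y) (ed (M is) y)"
    "ed (M (7 # is)) y = - wedge1 (X 7 y) (ed (M is) y)"
  by (subst ed_M_Cons[OF assms(1) _ assms(2)], simp,
      simp only: cartan[OF assms(1)] wedge2_add_left wedge2_scale_left wedge2_wedge1 wedge2_zero_left
        ext_mono_Cons ext_mono_Nil diff_0)+

text \<open>After the recursion \<open>X_swap\<close> sorts every monomial, products with a repeated
  index vanish by \<open>wedge1_self\<close>, and the remaining coefficients are compared.\<close>

lemma ed_g2_form_monomials:
  assumes y: "y \<in> Y"
  shows
    "ed (M [1,2,7]) y = (- c) *\<^sub>e M [1,3,5,7] y + (- f) *\<^sub>e M [1,4,6,7] y + (a) *\<^sub>e M [2,3,6,7] y + (b) *\<^sub>e M [2,4,5,7] y"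
    "ed (M [3,4,7]) y = (g) *\<^sub>e M [2,3,6,7] y"
    "ed (M [5,6,7]) y = (h) *\<^sub>e M [2,3,6,7] y"
    "ed (M [1,3,5]) y = (- p 5 - p 3 - p 1) *\<^sub>e M [1,3,5,7] y"
    "ed (M [1,4,6]) y = (- p 6 - p 4 - p 1) *\<^sub>e M [1,4,6,7] y"
    "ed (M [2,3,6]) y = (- p 6 - p 3 - p 2) *\<^sub>e M [2,3,6,7] y"
    "ed (M [2,4,5]) y = (- p 5 - p 4 - p 2) *\<^sub>e M [2,4,5,7] y"
  by (simp_all add: ed_monomial y ed_ext_one del: One_nat_def)
    (rule ext, simp add: ext_mono_Cons X_swap algebra_simps del: One_nat_def)+

lemma ed_g2_dual_form_monomials:
  assumes y: "y \<in> Y"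
  shows
    "ed (M [1,2,3,4]) y = (p 4 + p 3 + p 2 + p 1) *\<^sub>e M [1,2,3,4,7] y"
    "ed (M [1,2,5,6]) y = (p 6 + p 5 + p 2 + p 1) *\<^sub>e M [1,2,5,6,7] y"
    "ed (M [3,4,5,6]) y = (p 6 + p 5 + p 4 + p 3) *\<^sub>e M [3,4,5,6,7] y"
    "ed (M [1,3,6,7]) y = (b) *\<^sub>e M [3,4,5,6,7] y"
    "ed (M [1,4,5,7]) y = (h) *\<^sub>e M [1,2,3,4,7] y + (g) *\<^sub>e M [1,2,5,6,7] y + (a) *\<^sub>e M [3,4,5,6,7] y"
    "ed (M [2,3,5,7]) y = (- f) *\<^sub>e M [3,4,5,6,7] y"
    "ed (M [2,4,6,7]) y = (- c) *\<^sub>e M [3,4,5,6,7] y"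
  by (simp_all add: ed_monomial y ed_ext_one del: One_nat_def)
    (rule ext, simp add: ext_mono_Cons X_swap algebra_simps del: One_nat_def)+

text \<open>Used for d d^*\<phi>, as d^*\<phi> is a multiple of the sum of these three
  2-forms.\<close>

lemma ed_omega_monomials:
  assumes y: "y \<in> Y"
  shows
    "ed (M [1,2]) y = (p 2 + p 1) *\<^sub>e M [1,2,7] y + (- c) *\<^sub>e M [1,3,5] y + (- f) *\<^sub>e M [1,4,6] y + (a) *\<^sub>e M [2,3,6] y + (b) *\<^sub>e M [2,4,5] y"
    "ed (M [3,4]) y = (g) *\<^sub>e M [2,3,6] y + (p 4 + p 3) *\<^sub>e M [3,4,7] y"
    "ed (M [5,6]) y = (h) *\<^sub>e M [2,3,6] y + (p 6 + p 5) *\<^sub>e M [5,6,7] y"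
  by (simp_all add: ed_monomial y ed_ext_one del: One_nat_def)
    (rule ext, simp add: ext_mono_Cons X_swap algebra_simps del: One_nat_def)+

text \<open>Used for d^* d\<phi>, as \<star> d\<phi> is a combination of these four 3-forms.\<close>

lemma ed_rho_monomials:
  assumes y: "y \<in> Y"
  shows
    "ed (M [1,3,6]) y = (- p 6 - p 3 - p 1) *\<^sub>e M [1,3,6,7] y + (b) *\<^sub>e M [3,4,5,6] y"
    "ed (M [1,4,5]) y = (h) *\<^sub>e M [1,2,3,4] y + (g) *\<^sub>e M [1,2,5,6] y + (- p 5 - p 4 - p 1) *\<^sub>e M [1,4,5,7] y + (a) *\<^sub>e M [3,4,5,6] y"
    "ed (M [2,3,5]) y = (- p 5 - p 3 - p 2) *\<^sub>e M [2,3,5,7] y + (- f) *\<^sub>e M [3,4,5,6] y"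
    "ed (M [2,4,6]) y = (- p 6 - p 4 - p 2) *\<^sub>e M [2,4,6,7] y + (- c) *\<^sub>e M [3,4,5,6] y"
  by (simp_all add: ed_monomial y ed_ext_one del: One_nat_def)
    (rule ext, simp add: ext_mono_Cons X_swap algebra_simps del: One_nat_def)+

abbreviation \<phi> :: "real^7 \<Rightarrow> ext" where
  "\<phi> \<equiv> (\<lambda>y. g2_form (\<lambda>i. X i y))"

abbreviation \<psi> :: "real^7 \<Rightarrow> ext" where
  "\<psi> \<equiv> (\<lambda>y. g2_dual_form (\<lambda>i. X i y))"

lemmas differentiable_intros =
  ext_differentiable_add ext_differentiable_diff ext_differentiable_scale differentiable_M

text \<open>The first four equations of \<open>lee\<close> match the four coefficients. The wedge
  version is the conformal condition; the expanded version is the one whose star is known from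
  \<open>is_star_dg2_form\<close>.\<close>

lemma ed_g2_form:
  assumes y: "y \<in> Y"
  shows "ed \<phi> y = (3 * m) *\<^sub>e wedge1 (X 7 y) (\<phi> y)"
    and "ed \<phi> y = (3 * m) *\<^sub>e (M [1,4,6,7] y + M [2,3,6,7] y + M [2,4,5,7] y - M [1,3,5,7] y)"
proof -
  have "ed \<phi> y = ed (M [1,2,7]) y + ed (M [3,4,7]) y + ed (M [5,6,7]) y + ed (M [1,3,5]) y
      - ed (M [1,4,6]) y - ed (M [2,3,6]) y - ed (M [2,4,5]) y"
    unfolding g2_form_def by (simp add: ed_add ed_diff y differentiable_intros del: One_nat_def)
  also have "\<dots> = (3 * m) *\<^sub>e (M [1,4,6,7] y + M [2,3,6,7] y + M [2,4,5,7] y - M [1,3,5,7] y)"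
    unfolding ed_g2_form_monomials[OF y]
    by (rule ext, simp only: plus_fun_apply minus_apply ext_scale_apply zero_fun_apply) (use lee in algebra)
  finally show *: "ed \<phi> y = (3 * m) *\<^sub>e (M [1,4,6,7] y + M [2,3,6,7] y + M [2,4,5,7] y - M [1,3,5,7] y)" .
  show "ed \<phi> y = (3 * m) *\<^sub>e wedge1 (X 7 y) (\<phi> y)"
    unfolding * unfolding g2_form_def
    by (rule ext) (simp add: ext_mono_Cons X_swap del: One_nat_def)
qed

lemma ed_g2_dual_form:
  assumes y: "y \<in> Y"
  shows "ed \<psi> y = (4 * m) *\<^sub>e wedge1 (X 7 y) (\<psi> y)"
    and "ed \<psi> y = (4 * m) *\<^sub>e (M [1,2,3,4,7] y + M [1,2,5,6,7] y + M [3,4,5,6,7] y)"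
proof -
  have "ed \<psi> y = ed (M [1,2,3,4]) y + ed (M [1,2,5,6]) y + ed (M [3,4,5,6]) y + ed (M [1,3,6,7]) y
      + ed (M [1,4,5,7]) y + ed (M [2,3,5,7]) y - ed (M [2,4,6,7]) y"
    unfolding g2_dual_form_def by (simp add: ed_add ed_diff y differentiable_intros del: One_nat_def)
  also have "\<dots> = (4 * m) *\<^sub>e (M [1,2,3,4,7] y + M [1,2,5,6,7] y + M [3,4,5,6,7] y)"
    unfolding ed_g2_dual_form_monomials[OF y]
    by (rule ext, simp only: plus_fun_apply minus_apply ext_scale_apply zero_fun_apply) (use lee in algebra)
  finally show *: "ed \<psi> y = (4 * m) *\<^sub>e (M [1,2,3,4,7] y + M [1,2,5,6,7] y + M [3,4,5,6,7] y)" .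
  show "ed \<psi> y = (4 * m) *\<^sub>e wedge1 (X 7 y) (\<psi> y)"
    unfolding * unfolding g2_dual_form_def
    by (rule ext) (simp add: ext_mono_Cons X_swap del: One_nat_def)
qed

lemma adapted: "y \<in> Y \<Longrightarrow> adapted (\<lambda>i. X i y) (\<phi> y)"
  by (simp add: adapted_def basis)

section \<open>Transfer of the frame computations to \<open>star\<close>, \<open>codiff\<close> and
  \<open>hodge_laplacian\<close> in one chart\<close>

context
  fixes \<Phi> :: "'a form" and C :: "'a chart"
  assumes \<Phi>: "\<And>y. y \<in> Y \<Longrightarrow> \<Phi> C y = \<phi> y"
begin

lemma star_eqI:
  assumes "y \<in> Y" "k \<le> 7" "is_star (\<lambda>i. X i y) k (\<omega> C y) \<gamma>"
  shows "star \<Phi> k \<omega> C y = \<gamma>"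
  using assms adapted[of y] \<Phi>[of y] by (intro star_eq) simp_all

lemma ext_deriv_eqI:
  assumes "y \<in> Y" "\<And>z. z \<in> Y \<Longrightarrow> \<omega> C z = F z"
  shows "ext_deriv \<omega> C y = ed F y"
  unfolding ext_deriv_eq_ed using assms by (intro ed_cong[OF open_Y])

lemma star_phi: "y \<in> Y \<Longrightarrow> star \<Phi> 3 \<Phi> C y = \<psi> y"
  by (intro star_eqI) (simp_all add: \<Phi> is_star_g2_form basis)

lemma d_phi: "y \<in> Y \<Longrightarrow> ext_deriv \<Phi> C y = (3 * m) *\<^sub>e wedge1 (X 7 y) (\<Phi> C y)"
  using ext_deriv_eqI[of y \<Phi> \<phi>, OF _ \<Phi>] ed_g2_form(1)[of y] \<Phi>[of y] by simp

lemma d_star_phi: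
  "y \<in> Y \<Longrightarrow> ext_deriv (star \<Phi> 3 \<Phi>) C y = (4 * m) *\<^sub>e wedge1 (X 7 y) (star \<Phi> 3 \<Phi> C y)"
  using ext_deriv_eqI[of y "star \<Phi> 3 \<Phi>" \<psi>, OF _ star_phi] ed_g2_dual_form(1)[of y] star_phi[of y] by simp

lemma codiff_phi:
  assumes y: "y \<in> Y"
  shows "codiff \<Phi> 3 \<Phi> C y = (- 4 * m) *\<^sub>e (M [5,6] y + M [3,4] y + M [1,2] y)"
proof -
  have "star \<Phi> 5 (ext_deriv (star \<Phi> 3 \<Phi>)) C y = (4 * m) *\<^sub>e (M [5,6] y + M [3,4] y + M [1,2] y)"
    using ext_deriv_eqI[of y "star \<Phi> 3 \<Phi>" \<psi>, OF y star_phi] ed_g2_dual_form(2)[OF y]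
      is_star_scale[OF is_star_dg2_dual_form[OF basis[OF y]]]
    by (intro star_eqI[OF y]) simp_all
  \<comment> \<open>On 3-forms the sign in \<open>codiff\<close> is (-1)^29 = -1.\<close>
  then show ?thesis
    unfolding codiff_def form_scale_eq by (simp add: fun_eq_iff)
qed

lemma d_codiff_phi:
  assumes y: "y \<in> Y"
  shows "ext_deriv (codiff \<Phi> 3 \<Phi>) C y =
    (- 4 * m) *\<^sub>e ((p 2 + p 1) *\<^sub>e M [1,2,7] y - c *\<^sub>e M [1,3,5] y - f *\<^sub>e M [1,4,6] y
      + (a + g + h) *\<^sub>e M [2,3,6] y + b *\<^sub>e M [2,4,5] y
      + (p 4 + p 3) *\<^sub>e M [3,4,7] y + (p 6 + p 5) *\<^sub>e M [5,6,7] y)"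
proof -
  have "ext_deriv (codiff \<Phi> 3 \<Phi>) C y = ed (\<lambda>y. (- 4 * m) *\<^sub>e (M [5,6] y + M [3,4] y + M [1,2] y)) y"
    by (intro ext_deriv_eqI y codiff_phi)
  also have "\<dots> = (- 4 * m) *\<^sub>e (ed (M [5,6]) y + ed (M [3,4]) y + ed (M [1,2]) y)"
    by (simp add: ed_add ed_scale y differentiable_intros del: One_nat_def)
  finally show ?thesis
    unfolding ed_omega_monomials[OF y] by (simp add: fun_eq_iff algebra_simps)
qed

lemma star_d_phi:
  assumes y: "y \<in> Y"
  shows "star \<Phi> 4 (ext_deriv \<Phi>) C y = (3 * m) *\<^sub>e (M [1,3,6] y + M [1,4,5] y + M [2,3,5] y - M [2,4,6] y)"
  using ext_deriv_eqI[of y \<Phi> \<phi>, OF y \<Phi>] ed_g2_form(2)[OF y] is_star_scale[OF is_star_dg2_form[OF basis[OF y]]]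
  by (intro star_eqI[OF y]) simp_all

lemma codiff_d_phi:
  assumes y: "y \<in> Y"
  shows "codiff \<Phi> 4 (ext_deriv \<Phi>) C y =
    (3 * m) *\<^sub>e (h *\<^sub>e M [5,6,7] y + g *\<^sub>e M [3,4,7] y + (a + b + c - f) *\<^sub>e M [1,2,7] y
      + (- p 6 - p 3 - p 1) *\<^sub>e (- M [2,4,5] y) + (- p 5 - p 4 - p 1) *\<^sub>e (- M [2,3,6] y)
      + (- p 5 - p 3 - p 2) *\<^sub>e (- M [1,4,6] y) + (p 6 + p 4 + p 2) *\<^sub>e (- M [1,3,5] y))"
proof -
  have "ext_deriv (star \<Phi> 4 (ext_deriv \<Phi>)) C y =
      ed (\<lambda>y. (3 * m) *\<^sub>e (M [1,3,6] y + M [1,4,5] y + M [2,3,5] y - M [2,4,6] y)) y"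
    by (intro ext_deriv_eqI y star_d_phi)
  also have "\<dots> = (3 * m) *\<^sub>e (ed (M [1,3,6]) y + ed (M [1,4,5]) y + ed (M [2,3,5]) y - ed (M [2,4,6]) y)"
    by (simp add: ed_add ed_diff ed_scale y differentiable_intros del: One_nat_def)
  also have "\<dots> = (3 * m) *\<^sub>e
    (h *\<^sub>e M [1,2,3,4] y + g *\<^sub>e M [1,2,5,6] y + (a + b + c - f) *\<^sub>e M [3,4,5,6] y
     + (- p 6 - p 3 - p 1) *\<^sub>e M [1,3,6,7] y + (- p 5 - p 4 - p 1) *\<^sub>e M [1,4,5,7] y
     + (- p 5 - p 3 - p 2) *\<^sub>e M [2,3,5,7] y + (p 6 + p 4 + p 2) *\<^sub>e M [2,4,6,7] y)"
    unfolding ed_rho_monomials[OF y] by (simp add: fun_eq_iff algebra_simps)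
  finally have "star \<Phi> 4 (ext_deriv (star \<Phi> 4 (ext_deriv \<Phi>))) C y =
    (3 * m) *\<^sub>e (h *\<^sub>e M [5,6,7] y + g *\<^sub>e M [3,4,7] y + (a + b + c - f) *\<^sub>e M [1,2,7] y
      + (- p 6 - p 3 - p 1) *\<^sub>e (- M [2,4,5] y) + (- p 5 - p 4 - p 1) *\<^sub>e (- M [2,3,6] y)
      + (- p 5 - p 3 - p 2) *\<^sub>e (- M [1,4,6] y) + (p 6 + p 4 + p 2) *\<^sub>e (- M [1,3,5] y))"
    using is_star_scale[OF is_star_four_forms[OF basis[OF y]]] by (intro star_eqI[OF y]) simp_all
  \<comment> \<open>On 4-forms the sign in \<open>codiff\<close> is (-1)^36 = 1.\<close>
  then show ?thesis
    unfolding codiff_def form_scale_eq by simp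
qed

text \<open>The terms are grouped with the signs of the monomials in \<phi>, so that each bracket
  can be compared with the logarithmic derivative of one coefficient of \<phi>(t).\<close>

lemma laplacian_phi:
  assumes y: "y \<in> Y"
  shows "hodge_laplacian \<Phi> 3 \<Phi> C y =
      (- 4 * m * (p 1 + p 2) + 3 * m * (a + b + c - f)) *\<^sub>e M [1,2,7] y
    + (- 4 * m * (p 3 + p 4) + 3 * m * g) *\<^sub>e M [3,4,7] y
    + (- 4 * m * (p 5 + p 6) + 3 * m * h) *\<^sub>e M [5,6,7] y
    + (4 * m * c - 3 * m * (p 2 + p 4 + p 6)) *\<^sub>e M [1,3,5] y
    - (- 4 * m * f - 3 * m * (p 2 + p 3 + p 5)) *\<^sub>e M [1,4,6] y
    - (4 * m * (a + g + h) - 3 * m * (p 1 + p 4 + p 5)) *\<^sub>e M [2,3,6] y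
    - (4 * m * b - 3 * m * (p 1 + p 3 + p 6)) *\<^sub>e M [2,4,5] y"
proof -
  have "hodge_laplacian \<Phi> 3 \<Phi> C y = ext_deriv (codiff \<Phi> 3 \<Phi>) C y + codiff \<Phi> 4 (ext_deriv \<Phi>) C y"
    by (simp add: hodge_laplacian_def)
  then show ?thesis
    unfolding d_codiff_phi[OF y] codiff_d_phi[OF y]
    by (simp add: fun_eq_iff algebra_simps)
qed

end

end


section \<open>The flow\<close>

text \<open>The shape required by \<open>cp_frame\<close>, with all structure constants in units of
  \<open>m\<close>, so that rescaling the coframe changes this common factor only.\<close>

definition cp_general ::
  "(nat \<Rightarrow> real) \<Rightarrow> real \<Rightarrow> real \<Rightarrow> real \<Rightarrow> real \<Rightarrow> real \<Rightarrow> real \<Rightarrow> real \<Rightarrow> (nat \<Rightarrow> 'a form) \<Rightarrow> 'a form list"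
  where "cp_general p a b c f g h m e =
    [(- p 1 * m) *\<^sub>f e\<up>[1,7] + (a * m) *\<^sub>f e\<up>[3,6] + (b * m) *\<^sub>f e\<up>[4,5],
     (- p 2 * m) *\<^sub>f e\<up>[2,7] + (c * m) *\<^sub>f e\<up>[3,5] + (f * m) *\<^sub>f e\<up>[4,6],
     (- p 3 * m) *\<^sub>f e\<up>[3,7],
     (- p 4 * m) *\<^sub>f e\<up>[4,7] + (g * m) *\<^sub>f e\<up>[2,6],
     (- p 5 * m) *\<^sub>f e\<up>[5,7] + (h * m) *\<^sub>f e\<up>[2,3],
     (- p 6 * m) *\<^sub>f e\<up>[6,7],
     0]"

lemma form_mono_eq: "(e \<up> is) C y = ext_mono (\<lambda>i. e i C y) is"
  by (simp add: form_mono_def)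

lemma ext_scale_add_right: "r *\<^sub>e (\<omega> + \<eta>) = r *\<^sub>e \<omega> + r *\<^sub>e \<eta>"
  by (rule ext) (simp add: algebra_simps)

text \<open>Replacing e^i by s^(q_i) e^i multiplies the coefficient of e^j \<and> e^k in d e^i by
  s^(q_i - q_j - q_k); \<open>weights\<close> makes this factor s^(-1/2) for every nonzero
  coefficient. Then \<Delta>\<phi> carries the factor m^2/s, and \<open>laplacian\<close> equates
  its coefficients with d/dt s^w = -\<kappa> m^2 w s^w / s, where w is the exponent of the
  respective monomial.\<close>

lemma cp_flow:
  fixes S :: "'a::{t2_space, second_countable_topology} monoid"
    and \<A> :: "'a chart set" and e :: "nat \<Rightarrow> 'a form"
    and p q :: "nat \<Rightarrow> real" and a b c f g h m \<kappa> :: real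
  assumes lie: "lie_group \<A> S" and basis: "left_invariant_basis \<A> S e"
    and cartan: "structure_eqs \<A> e (cp_general p a b c f g h m e)"
    and lee:
      "p 1 + p 3 + p 5 + c = 3" "p 1 + p 4 + p 6 - f = 3"
      "p 2 + p 3 + p 6 + a + g + h = 3" "p 2 + p 4 + p 5 + b = 3"
      "p 1 + p 2 + p 3 + p 4 + h = 4" "p 1 + p 2 + p 5 + p 6 + g = 4"
      "p 3 + p 4 + p 5 + p 6 + a + b + c - f = 4"
    and weights: "q 7 = 1/2"
      "a = 0 \<or> q 1 + 1/2 = q 3 + q 6" "b = 0 \<or> q 1 + 1/2 = q 4 + q 5"
      "c = 0 \<or> q 2 + 1/2 = q 3 + q 5" "f = 0 \<or> q 2 + 1/2 = q 4 + q 6"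
      "g = 0 \<or> q 4 + 1/2 = q 2 + q 6" "h = 0 \<or> q 5 + 1/2 = q 2 + q 3"
    and laplacian:
      "- 4 * (p 1 + p 2) + 3 * (a + b + c - f) = - \<kappa> * (q 1 + q 2 + q 7)"
      "- 4 * (p 3 + p 4) + 3 * g = - \<kappa> * (q 3 + q 4 + q 7)"
      "- 4 * (p 5 + p 6) + 3 * h = - \<kappa> * (q 5 + q 6 + q 7)"
      "4 * c - 3 * (p 2 + p 4 + p 6) = - \<kappa> * (q 1 + q 3 + q 5)"
      "- 4 * f - 3 * (p 2 + p 3 + p 5) = - \<kappa> * (q 1 + q 4 + q 6)"
      "4 * (a + g + h) - 3 * (p 1 + p 4 + p 5) = - \<kappa> * (q 2 + q 3 + q 6)"
      "4 * b - 3 * (p 1 + p 3 + p 6) = - \<kappa> * (q 2 + q 4 + q 5)"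
    and pos: "\<And>t. t \<in> I \<Longrightarrow> 0 < 1 - \<kappa> * m\<^sup>2 * t"
    and \<phi>: "\<And>t. t \<in> I \<Longrightarrow> \<phi> t =
        (1 - \<kappa> * m\<^sup>2 * t) powr (q 1 + q 2 + q 7) *\<^sub>f e\<up>[1,2,7]
      + (1 - \<kappa> * m\<^sup>2 * t) powr (q 3 + q 4 + q 7) *\<^sub>f e\<up>[3,4,7]
      + (1 - \<kappa> * m\<^sup>2 * t) powr (q 5 + q 6 + q 7) *\<^sub>f e\<up>[5,6,7]
      + (1 - \<kappa> * m\<^sup>2 * t) powr (q 1 + q 3 + q 5) *\<^sub>f e\<up>[1,3,5]
      - (1 - \<kappa> * m\<^sup>2 * t) powr (q 1 + q 4 + q 6) *\<^sub>f e\<up>[1,4,6]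
      - (1 - \<kappa> * m\<^sup>2 * t) powr (q 2 + q 3 + q 6) *\<^sub>f e\<up>[2,3,6]
      - (1 - \<kappa> * m\<^sup>2 * t) powr (q 2 + q 4 + q 5) *\<^sub>f e\<up>[2,4,5]"
  shows "left_invariant_LCP_solution \<A> S I \<phi>"
proof -
  define s where "s t = 1 - \<kappa> * m\<^sup>2 * t" for t
  define X where "X t i = (s t powr q i) *\<^sub>f e i" for t i
  have atlas: "smooth_atlas \<A>" using lie by (simp add: lie_group_def)
  have forms: "diff_form \<A> UNIV 1 (e i)" "left_invariant \<A> S (e i)" if "i \<in> {1..7}" for i
    using basis that unfolding left_invariant_basis_def by blast+
  have X: "diff_form \<A> UNIV 1 (X t i)" "left_invariant \<A> S (X t i)" if "i \<in> {1..7}" for t i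
    unfolding X_def using forms[OF that] by (auto intro: diff_form_scale[OF atlas] left_invariant_scale)
  have X_eq: "X t i C y = (s t powr q i) *\<^sub>e e i C y" for t i C y
    by (simp add: X_def form_scale_eq)
  have mono_eq: "ext_mono (\<lambda>i. X t i C y) is = (\<Prod>i\<leftarrow>is. s t powr q i) *\<^sub>e ext_mono (\<lambda>i. e i C y) is"
    for t C y "is" unfolding X_eq by (rule ext_mono_scale)
  have \<phi>_eq: "\<phi> t C y = g2_form (\<lambda>i. X t i C y)" if "t \<in> I" for t C y
    unfolding \<phi>[OF that] s_def[symmetric] g2_form_def mono_eq
    by (rule ext) (simp add: form_scale_def form_mono_eq powr_add)
  have \<phi>_mono: "\<phi> t = X t\<up>[1,2,7] + X t\<up>[3,4,7] + X t\<up>[5,6,7] + X t\<up>[1,3,5]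
      - X t\<up>[1,4,6] - X t\<up>[2,3,6] - X t\<up>[2,4,5]" if "t \<in> I" for t
    using \<phi>_eq[OF that] by (simp add: fun_eq_iff g2_form_def form_mono_eq)
  have chart: "open (c ` U)"
      "covector_basis (\<lambda>i. e i (U, c) y)" "i \<in> {1..7} \<Longrightarrow> ext_differentiable (e i (U, c)) y"
    if "(U, c) \<in> \<A>" "y \<in> c ` U" for U c y i
    using that smooth_atlas_open[OF atlas] left_invariant_basis_pointwise[OF lie basis]
      diff_form_dest(2)[OF forms(1)] smooth_on_differentiable
    unfolding ext_differentiable_def by blast+
  have frame: "cp_frame (c' ` U) (\<lambda>i. X t i (U, c')) (\<lambda>i. p i * (m * s t powr (-1/2)))
      (a * (m * s t powr (-1/2))) (b * (m * s t powr (-1/2))) (c * (m * s t powr (-1/2)))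
      (f * (m * s t powr (-1/2))) (g * (m * s t powr (-1/2))) (h * (m * s t powr (-1/2)))
      (m * s t powr (-1/2))"
    if U: "(U, c') \<in> \<A>" and t: "t \<in> I" for U c' t
  proof -
    define \<mu> where "\<mu> = m * s t powr (-1/2)"
    define w where "w i = s t powr q i" for i
    have st: "s t > 0" using pos[OF t] by (simp add: s_def)
    have \<mu>: "\<mu> * w 7 = m"
      unfolding \<mu>_def w_def weights(1) using st by (simp add: powr_add[symmetric] mult.assoc)
    have "s t powr (-1/2) * (s t powr r1 * s t powr r2) = s t powr r0"
      if "r0 + 1/2 = r1 + r2" for r0 r1 r2
    proof -
      have "r0 = - (1/2) + (r1 + r2)" using that by simp
      then show ?thesis by (simp only: powr_add minus_divide_left)
    qed
    \<comment> \<open>The alternative \<open>k = 0\<close> covers structure constants that are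
      absent from the algebra at hand.\<close>
    then have resc: "k * \<mu> * (w i * w j) = k * m * w l" if "k = 0 \<or> q l + 1/2 = q i + q j" for k i j l
      using that by (auto simp: \<mu>_def w_def mult.assoc)
    show ?thesis
      unfolding \<mu>_def[symmetric]
    proof
      show "open (c' ` U)" using smooth_atlas_open[OF atlas U] .
      fix y assume y: "y \<in> c' ` U"
      show "covector_basis (\<lambda>i. X t i (U, c') y)"
        unfolding X_eq using st by (intro covector_basis_scale chart U y) auto
      have diff: "ext_differentiable (e i (U, c')) y" if "i \<in> {1..7}" for i
        using chart(3)[OF U y that] .
      have X_fun: "X t i (U, c') = (\<lambda>y. w i *\<^sub>e e i (U, c') y)" for i
        by (simp add: fun_eq_iff X_eq w_def)
      show "ext_differentiable (X t i (U, c')) y" if "i \<in> {1..7}" for i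
        unfolding X_fun by (intro ext_differentiable_scale diff that)
      have ed_X: "ed (X t i (U, c')) y = w i *\<^sub>e (cp_general p a b c f g h m e ! (i - 1)) (U, c') y"
        if i: "i \<in> {1..7}" for i
      proof -
        have "ed (e i (U, c')) y = (cp_general p a b c f g h m e ! (i - 1)) (U, c') y"
          using cartan i U y unfolding structure_eqs_def form_eq_def ext_deriv_eq_ed by fast
        then show ?thesis unfolding X_fun by (simp only: ed_scale[OF diff[OF i]])
      qed
      define E where "E is = ext_mono (\<lambda>i. e i (U, c') y) is" for "is"
      have mono_w: "ext_mono (\<lambda>i. X t i (U, c') y) [i, j] = (w i * w j) *\<^sub>e E [i, j]" for i j
        unfolding w_def E_def mono_eq by simp
      have resc_7: "(- (k * \<mu>)) *\<^sub>e ((w i * w 7) *\<^sub>e \<omega>) = w i *\<^sub>e ((- k * m) *\<^sub>e \<omega>)" for k i \<omega>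
        unfolding \<mu>[symmetric] by (rule ext) simp
      have resc_ij: "(k * \<mu>) *\<^sub>e ((w i * w j) *\<^sub>e \<omega>) = w l *\<^sub>e ((k * m) *\<^sub>e \<omega>)"
        if "k = 0 \<or> q l + 1/2 = q i + q j" for k i j l \<omega>
        by (rule ext, simp only: ext_scale_apply mult.assoc[symmetric])
          (use resc[OF that] in \<open>auto simp: mult_ac\<close>)
      note nth = ed_X cp_general_def form_scale_eq form_mono_eq E_def
      note rewrite = mono_w resc_7 resc_ij[OF weights(2)] resc_ij[OF weights(3)] resc_ij[OF weights(4)]
        resc_ij[OF weights(5)] resc_ij[OF weights(6)] resc_ij[OF weights(7)] ext_scale_add_right[symmetric]
      show "ed (X t 1 (U, c')) y = (- (p 1 * \<mu>)) *\<^sub>e ext_mono (\<lambda>i. X t i (U, c') y) [1,7]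
          + (a * \<mu>) *\<^sub>e ext_mono (\<lambda>i. X t i (U, c') y) [3,6]
          + (b * \<mu>) *\<^sub>e ext_mono (\<lambda>i. X t i (U, c') y) [4,5]"
        unfolding rewrite by (simp add: nth)
      show "ed (X t 2 (U, c')) y = (- (p 2 * \<mu>)) *\<^sub>e ext_mono (\<lambda>i. X t i (U, c') y) [2,7]
          + (c * \<mu>) *\<^sub>e ext_mono (\<lambda>i. X t i (U, c') y) [3,5]
          + (f * \<mu>) *\<^sub>e ext_mono (\<lambda>i. X t i (U, c') y) [4,6]"
        unfolding rewrite by (simp add: nth)
      show "ed (X t 3 (U, c')) y = (- (p 3 * \<mu>)) *\<^sub>e ext_mono (\<lambda>i. X t i (U, c') y) [3,7]"
        unfolding rewrite by (simp add: nth)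
      show "ed (X t 4 (U, c')) y = (- (p 4 * \<mu>)) *\<^sub>e ext_mono (\<lambda>i. X t i (U, c') y) [4,7]
          + (g * \<mu>) *\<^sub>e ext_mono (\<lambda>i. X t i (U, c') y) [2,6]"
        unfolding rewrite by (simp add: nth)
      show "ed (X t 5 (U, c')) y = (- (p 5 * \<mu>)) *\<^sub>e ext_mono (\<lambda>i. X t i (U, c') y) [5,7]
          + (h * \<mu>) *\<^sub>e ext_mono (\<lambda>i. X t i (U, c') y) [2,3]"
        unfolding rewrite by (simp add: nth)
      show "ed (X t 6 (U, c')) y = (- (p 6 * \<mu>)) *\<^sub>e ext_mono (\<lambda>i. X t i (U, c') y) [6,7]"
        unfolding rewrite by (simp add: nth)
      show "ed (X t 7 (U, c')) y = 0"
        by (rule ext) (simp add: nth)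
    qed (simp_all only: lee distrib_right[symmetric] left_diff_distrib[symmetric])
  qed
  have g2: "g2_structure \<A> (\<phi> t)" if t: "t \<in> I" for t
  proof -
    have "diff_form \<A> UNIV 3 (\<phi> t)"
      unfolding \<phi>_mono[OF t]
      by (intro diff_form_add diff_form_diff diff_form_mono atlas X) auto
    moreover have "adapted (\<lambda>i. X t i (U, c) y) (\<phi> t (U, c) y)" if "(U, c) \<in> \<A>" "y \<in> c ` U" for U c y
      using cp_frame.adapted[OF frame[OF that(1) t] that(2)] \<phi>_eq[OF t] by simp
    \<comment> \<open>The adapted coframe is global, so \<open>UNIV\<close> serves as the
      neighbourhood of every point.\<close>
    ultimately show ?thesis
      unfolding g2_structure_def using X(1)
      by (intro conjI allI exI[of _ UNIV] exI[of _ "X t"]) (auto simp del: atLeastAtMost_iff)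
  qed
  have invariant: "left_invariant \<A> S (\<phi> t)" if t: "t \<in> I" for t
    unfolding \<phi>_mono[OF t]
    by (intro left_invariant_add left_invariant_diff left_invariant_mono X) auto
  have lcp: "locally_conformal_parallel \<A> (\<phi> t)" if t: "t \<in> I" for t
    unfolding locally_conformal_parallel_def
  \<comment> \<open>The Lee form does not depend on t: the factor s^(1/2) in x^7 cancels the factor
    s^(-1/2) of the rescaled \<open>m\<close>.\<close>
  proof (intro conjI exI[of _ "m *\<^sub>f e 7"])
    have st: "s t > 0" using pos[OF t] by (simp add: s_def)
    have lee_form: "((m *\<^sub>f e 7) C y) = (m * s t powr (-1/2)) *\<^sub>e X t 7 C y" for C y
    proof -
      have "m * s t powr (-1/2) * s t powr q 7 = m"
        unfolding weights(1) using st by (simp add: powr_add[symmetric] mult.assoc)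
      then show ?thesis
        unfolding X_eq form_scale_eq ext_scale_left(3)[symmetric] by (simp only:)
    qed
    show "g2_structure \<A> (\<phi> t)" by (rule g2[OF t])
    show "diff_form \<A> UNIV 1 (m *\<^sub>f e 7)" by (intro diff_form_scale atlas forms) simp
    show "form_eq \<A> (ext_deriv (\<phi> t)) (3 *\<^sub>f form_wedge1 (m *\<^sub>f e 7) (\<phi> t))"
      unfolding form_eq_def
    proof (clarify del: ext)
      fix U c y assume U: "(U, c) \<in> \<A>" and y: "y \<in> U"
      show "ext_deriv (\<phi> t) (U, c) (c y) = (3 *\<^sub>f form_wedge1 (m *\<^sub>f e 7) (\<phi> t)) (U, c) (c y)"
        using cp_frame.d_phi[OF frame[OF U t], of "\<phi> t" "(U, c)" "c y"] y
        unfolding form_scale_eq[of 3] form_wedge1_def lee_form wedge1_scale_left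
        by (simp add: \<phi>_eq[OF t] ext_scale_left)
    qed
    show "form_eq \<A> (ext_deriv (star (\<phi> t) 3 (\<phi> t))) (4 *\<^sub>f form_wedge1 (m *\<^sub>f e 7) (star (\<phi> t) 3 (\<phi> t)))"
      unfolding form_eq_def
    proof (clarify del: ext)
      fix U c y assume U: "(U, c) \<in> \<A>" and y: "y \<in> U"
      show "ext_deriv (star (\<phi> t) 3 (\<phi> t)) (U, c) (c y) =
          (4 *\<^sub>f form_wedge1 (m *\<^sub>f e 7) (star (\<phi> t) 3 (\<phi> t))) (U, c) (c y)"
        using cp_frame.d_star_phi[OF frame[OF U t], of "\<phi> t" "(U, c)" "c y"] y
        unfolding form_scale_eq[of 4] form_wedge1_def lee_form wedge1_scale_left
        by (simp add: \<phi>_eq[OF t] ext_scale_left)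
    qed
  qed
  have flow: "((\<lambda>r. \<phi> r (U, c') y vs) has_real_derivative
      hodge_laplacian (\<phi> t) 3 (\<phi> t) (U, c') y vs) (at t within I)"
    if t: "t \<in> I" and U: "(U, c') \<in> \<A>" "y \<in> c' ` U" for t U c' y vs
  proof -
    define E where "E is = ext_mono (\<lambda>i. e i (U, c') y) is vs" for "is"
    have st: "s t > 0" using pos[OF t] by (simp add: s_def)
    have deriv: "((\<lambda>r. s r powr w * x) has_real_derivative (- \<kappa> * w) * (m\<^sup>2 * s t powr (-1)) * s t powr w * x)
        (at t within I)" for w x
    proof -
      have "((\<lambda>r. s r powr w) has_real_derivative (w * s t powr (w - 1)) * (- \<kappa> * m\<^sup>2)) (at t)"
        using st unfolding s_def
        by (intro DERIV_chain2[OF has_real_derivative_powr]) (auto intro!: derivative_eq_intros)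
      then have "((\<lambda>r. s r powr w * x) has_real_derivative (w * s t powr (w - 1)) * (- \<kappa> * m\<^sup>2) * x) (at t)"
        by (rule DERIV_cmult_right)
      moreover have "s t powr (w - 1) = s t powr w * s t powr (-1)"
        using powr_add[of "s t" w "-1"] by simp
      ultimately show ?thesis
        by (auto intro: has_field_derivative_at_within simp: mult_ac)
    qed
    have \<mu>2: "(m * s t powr (-1/2)) * (m * s t powr (-1/2)) = m\<^sup>2 * s t powr (-1)"
      by (simp add: power2_eq_square powr_add[symmetric] algebra_simps)
    have sum: "\<phi> r (U, c') y vs =
        s r powr (q 1 + q 2 + q 7) * E [1,2,7] + s r powr (q 3 + q 4 + q 7) * E [3,4,7]
      + s r powr (q 5 + q 6 + q 7) * E [5,6,7] + s r powr (q 1 + q 3 + q 5) * E [1,3,5]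
      - s r powr (q 1 + q 4 + q 6) * E [1,4,6] - s r powr (q 2 + q 3 + q 6) * E [2,3,6]
      - s r powr (q 2 + q 4 + q 5) * E [2,4,5]" if "r \<in> I" for r
      unfolding \<phi>[OF that] s_def E_def by (simp add: form_scale_def form_mono_eq)
    define D where "D w = (- \<kappa> * w) * (m\<^sup>2 * s t powr (-1)) * s t powr w" for w
    have mono: "ext_mono (\<lambda>i. X t i (U, c') y) [i, j, k] vs = s t powr (q i + q j + q k) * E [i, j, k]" for i j k
      unfolding mono_eq E_def by (simp add: powr_add)
    have "hodge_laplacian (\<phi> t) 3 (\<phi> t) (U, c') y vs =
        D (q 1 + q 2 + q 7) * E [1,2,7] + D (q 3 + q 4 + q 7) * E [3,4,7]
      + D (q 5 + q 6 + q 7) * E [5,6,7] + D (q 1 + q 3 + q 5) * E [1,3,5]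
      - D (q 1 + q 4 + q 6) * E [1,4,6] - D (q 2 + q 3 + q 6) * E [2,3,6]
      - D (q 2 + q 4 + q 5) * E [2,4,5]"
      unfolding cp_frame.laplacian_phi[OF frame[OF U(1) t] _ U(2), of "\<phi> t" "(U, c')", OF \<phi>_eq[OF t]]
      \<comment> \<open>Read backwards, \<open>laplacian\<close> turns every -\<kappa> w in
        \<open>D\<close> into a coefficient of \<open>laplacian_phi\<close>, and
        \<open>\<mu>2\<close> accounts for the square of the rescaled \<open>m\<close>.\<close>
      unfolding D_def laplacian[symmetric] \<mu>2[symmetric]
      by (simp only: plus_fun_apply minus_apply ext_scale_apply mono) algebra
    moreover have "((\<lambda>r. s r powr (q 1 + q 2 + q 7) * E [1,2,7] + s r powr (q 3 + q 4 + q 7) * E [3,4,7]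
      + s r powr (q 5 + q 6 + q 7) * E [5,6,7] + s r powr (q 1 + q 3 + q 5) * E [1,3,5]
      - s r powr (q 1 + q 4 + q 6) * E [1,4,6] - s r powr (q 2 + q 3 + q 6) * E [2,3,6]
      - s r powr (q 2 + q 4 + q 5) * E [2,4,5]) has_real_derivative
        D (q 1 + q 2 + q 7) * E [1,2,7] + D (q 3 + q 4 + q 7) * E [3,4,7]
      + D (q 5 + q 6 + q 7) * E [5,6,7] + D (q 1 + q 3 + q 5) * E [1,3,5]
      - D (q 1 + q 4 + q 6) * E [1,4,6] - D (q 2 + q 3 + q 6) * E [2,3,6]
      - D (q 2 + q 4 + q 5) * E [2,4,5]) (at t within I)"
      unfolding D_def by (intro DERIV_add DERIV_diff deriv)
    ultimately show ?thesis
      \<comment> \<open>The radius 1 is arbitrary, as \<open>sum\<close> holds on all of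
        \<open>I\<close>.\<close>
      using sum t by (auto intro: has_field_derivative_transform_within[of _ _ _ _ 1])
  qed
  show ?thesis
    unfolding left_invariant_LCP_solution_def laplacian_LCP_flow_def
    using g2 invariant lcp flow by blast
qed


section \<open>The six algebras\<close>

lemma cp2_flow:
  fixes S :: "'a::{t2_space, second_countable_topology} monoid"
    and \<A> :: "'a chart set" and e :: "nat \<Rightarrow> 'a form"
  assumes "m \<noteq> 0" "lie_group \<A> S" "left_invariant_basis \<A> S e"
    and "structure_eqs \<A> e (cp2 m e)"
  shows "left_invariant_LCP_solution \<A> S {..<3 / (10 * m\<^sup>2)} (\<lambda>t.
          (1 - 10/3 * m\<^sup>2 * t) powr (11/5) *\<^sub>f (e\<up>[1,2,7] - e\<up>[2,3,6])
        + (1 - 10/3 * m\<^sup>2 * t) ^ 2 *\<^sub>f (e\<up>[3,4,7] + e\<up>[5,6,7])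
        + (1 - 10/3 * m\<^sup>2 * t) powr (12/5) *\<^sub>f (e\<up>[1,3,5] - e\<up>[1,4,6] - e\<up>[2,4,5]))"
proof -
  \<comment> \<open>The leading 0 pads position 0, since \<open>p\<close> and \<open>q\<close> are
    indexed from 1.\<close>
  have cartan: "cp2 m e = cp_general ((!) [0, 4/3, 1, 2/3, 1, 1, 2/3]) (2/3) 0 0 0 0 0 m e"
    by (simp add: cp2_def cp_general_def fun_eq_iff form_scale_def)
  have pos: "0 < 1 - 10/3 * m\<^sup>2 * t" if "t < 3 / (10 * m\<^sup>2)" for t
    using that assms(1) by (simp add: field_simps)
  show ?thesis
  proof (rule cp_flow[OF assms(2,3,4)[unfolded cartan], where \<kappa> = "10/3"
        and q = "(!) [0, 9/10, 4/5, 7/10, 4/5, 4/5, 7/10, 1/2]"], goal_cases)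
    \<comment> \<open>The preceding 21 goals are the numerical conditions \<open>lee\<close>,
      \<open>weights\<close> and \<open>laplacian\<close>; cases 22 and 23 are \<open>pos\<close>
      and the formula for \<phi>.\<close>
    case (22 t)
    then show ?case using pos by simp
  next
    case (23 t)
    define r where "r = 1 - 10/3 * m\<^sup>2 * t"
    \<comment> \<open>Positivity identifies the exponent 2 of \<open>powr\<close> with the ordinary
      square in the statement.\<close>
    have "r > 0" using pos[of t] 23 by (simp add: r_def)
    then show ?case
      unfolding r_def[symmetric] by (simp add: fun_eq_iff form_scale_def algebra_simps)
  qed simp_all
qed

lemma cp3_flow:
  fixes S :: "'a::{t2_space, second_countable_topology} monoid"
    and \<A> :: "'a chart set" and e :: "nat \<Rightarrow> 'a form"
  assumes "m \<noteq> 0" "lie_group \<A> S" "left_invariant_basis \<A> S e"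
    and "structure_eqs \<A> e (cp3 m e)"
  shows "left_invariant_LCP_solution \<A> S {..<1 / (3 * m\<^sup>2)} (\<lambda>t.
          (1 - 3 * m\<^sup>2 * t) powr (7/3) *\<^sub>f (e\<up>[1,2,7] - e\<up>[2,3,6] - e\<up>[2,4,5])
        + (1 - 3 * m\<^sup>2 * t) ^ 2 *\<^sub>f (e\<up>[3,4,7] + e\<up>[5,6,7])
        + (1 - 3 * m\<^sup>2 * t) powr (5/2) *\<^sub>f (e\<up>[1,3,5] - e\<up>[1,4,6]))"
proof -
  have cartan: "cp3 m e = cp_general ((!) [0, 3/2, 1, 3/4, 3/4, 3/4, 3/4]) (1/2) (1/2) 0 0 0 0 m e"
    by (simp add: cp3_def cp_general_def fun_eq_iff form_scale_def)
  have pos: "0 < 1 - 3 * m\<^sup>2 * t" if "t < 1 / (3 * m\<^sup>2)" for t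
    using that assms(1) by (simp add: field_simps)
  show ?thesis
  proof (rule cp_flow[OF assms(2,3,4)[unfolded cartan], where \<kappa> = "3"
        and q = "(!) [0, 1, 5/6, 3/4, 3/4, 3/4, 3/4, 1/2]"], goal_cases)
    case (22 t)
    then show ?case using pos by simp
  next
    case (23 t)
    define r where "r = 1 - 3 * m\<^sup>2 * t"
    have "r > 0" using pos[of t] 23 by (simp add: r_def)
    then show ?case
      unfolding r_def[symmetric] by (simp add: fun_eq_iff form_scale_def algebra_simps)
  qed simp_all
qed

lemma cp4_flow:
  fixes S :: "'a::{t2_space, second_countable_topology} monoid"
    and \<A> :: "'a chart set" and e :: "nat \<Rightarrow> 'a form"
  assumes "m \<noteq> 0" "lie_group \<A> S" "left_invariant_basis \<A> S e"
    and "structure_eqs \<A> e (cp4 m e)"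
  shows "left_invariant_LCP_solution \<A> S {..<5 / (14 * m\<^sup>2)} (\<lambda>t.
          (1 - 14/5 * m\<^sup>2 * t) powr (17/7) *\<^sub>f
            (e\<up>[1,2,7] - e\<up>[1,4,6] - e\<up>[2,3,6] - e\<up>[2,4,5])
        + (1 - 14/5 * m\<^sup>2 * t) ^ 2 *\<^sub>f (e\<up>[3,4,7] + e\<up>[5,6,7])
        + (1 - 14/5 * m\<^sup>2 * t) powr (18/7) *\<^sub>f e\<up>[1,3,5])"
proof -
  \<comment> \<open>\<open>f\<close> is the coefficient of e^4 \<and> e^6 in d e^2, which enters the
    algebra with a minus sign.\<close>
  have cartan: "cp4 m e = cp_general ((!) [0, 7/5, 6/5, 4/5, 3/5, 4/5, 3/5]) (2/5) (2/5) 0 (-2/5) 0 0 m e"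
    by (simp add: cp4_def cp_general_def fun_eq_iff form_scale_def)
  have pos: "0 < 1 - 14/5 * m\<^sup>2 * t" if "t < 5 / (14 * m\<^sup>2)" for t
    using that assms(1) by (simp add: field_simps)
  show ?thesis
  proof (rule cp_flow[OF assms(2,3,4)[unfolded cartan], where \<kappa> = "14/5"
        and q = "(!) [0, 1, 13/14, 11/14, 5/7, 11/14, 5/7, 1/2]"], goal_cases)
    case (22 t)
    then show ?case using pos by simp
  next
    case (23 t)
    define r where "r = 1 - 14/5 * m\<^sup>2 * t"
    have "r > 0" using pos[of t] 23 by (simp add: r_def)
    then show ?case
      unfolding r_def[symmetric] by (simp add: fun_eq_iff form_scale_def algebra_simps)
  qed simp_all
qed

lemma cp5_flow:
  fixes S :: "'a::{t2_space, second_countable_topology} monoid"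
    and \<A> :: "'a chart set" and e :: "nat \<Rightarrow> 'a form"
  assumes "m \<noteq> 0" "lie_group \<A> S" "left_invariant_basis \<A> S e"
    and "structure_eqs \<A> e (cp5 m e)"
  shows "left_invariant_LCP_solution \<A> S {..<1 / (3 * m\<^sup>2)} (\<lambda>t.
          (1 - 3 * m\<^sup>2 * t) powr (7/3) *\<^sub>f (e\<up>[1,2,7] - e\<up>[1,4,6] - e\<up>[2,4,5])
        + (1 - 3 * m\<^sup>2 * t) ^ 2 *\<^sub>f (e\<up>[3,4,7] + e\<up>[5,6,7])
        + (1 - 3 * m\<^sup>2 * t) powr (5/2) *\<^sub>f (e\<up>[1,3,5] - e\<up>[2,3,6]))"
proof -
  have cartan: "cp5 m e = cp_general ((!) [0, 5/4, 5/4, 1, 1/2, 3/4, 3/4]) 0 (1/2) 0 (-1/2) 0 0 m e"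
    by (simp add: cp5_def cp_general_def fun_eq_iff form_scale_def)
  have pos: "0 < 1 - 3 * m\<^sup>2 * t" if "t < 1 / (3 * m\<^sup>2)" for t
    using that assms(1) by (simp add: field_simps)
  show ?thesis
  proof (rule cp_flow[OF assms(2,3,4)[unfolded cartan], where \<kappa> = "3"
        and q = "(!) [0, 11/12, 11/12, 5/6, 2/3, 3/4, 3/4, 1/2]"], goal_cases)
    case (22 t)
    then show ?case using pos by simp
  next
    case (23 t)
    define r where "r = 1 - 3 * m\<^sup>2 * t"
    have "r > 0" using pos[of t] 23 by (simp add: r_def)
    then show ?case
      unfolding r_def[symmetric] by (simp add: fun_eq_iff form_scale_def algebra_simps)
  qed simp_all
qed

text \<open>The quadratic terms combine to d(e^1 + i e^2) = (i m/3) (e^3 - i e^4) \<and> (e^5 - i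
  e^6) modulo e^7, a complex Heisenberg algebra; hence the four constants agree up to sign.\<close>

lemma cp6_flow:
  fixes S :: "'a::{t2_space, second_countable_topology} monoid"
    and \<A> :: "'a chart set" and e :: "nat \<Rightarrow> 'a form"
  assumes "m \<noteq> 0" "lie_group \<A> S" "left_invariant_basis \<A> S e"
    and "structure_eqs \<A> e (cp6 m e)"
  shows "left_invariant_LCP_solution \<A> S {..<3 / (8 * m\<^sup>2)} (\<lambda>t.
          (1 - 8/3 * m\<^sup>2 * t) powr (5/2) *\<^sub>f
            (e\<up>[1,2,7] + e\<up>[1,3,5] - e\<up>[1,4,6] - e\<up>[2,3,6] - e\<up>[2,4,5])
        + (1 - 8/3 * m\<^sup>2 * t) ^ 2 *\<^sub>f (e\<up>[3,4,7] + e\<up>[5,6,7]))"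
proof -
  have cartan: "cp6 m e = cp_general ((!) [0, 4/3, 4/3, 2/3, 2/3, 2/3, 2/3]) (1/3) (1/3) (1/3) (-1/3) 0 0 m e"
    by (simp add: cp6_def cp_general_def fun_eq_iff form_scale_def)
  have pos: "0 < 1 - 8/3 * m\<^sup>2 * t" if "t < 3 / (8 * m\<^sup>2)" for t
    using that assms(1) by (simp add: field_simps)
  show ?thesis
  proof (rule cp_flow[OF assms(2,3,4)[unfolded cartan], where \<kappa> = "8/3"
        and q = "(!) [0, 1, 1, 3/4, 3/4, 3/4, 3/4, 1/2]"], goal_cases)
    case (22 t)
    then show ?case using pos by simp
  next
    case (23 t)
    define r where "r = 1 - 8/3 * m\<^sup>2 * t"
    have "r > 0" using pos[of t] 23 by (simp add: r_def)
    then show ?case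
      unfolding r_def[symmetric] by (simp add: fun_eq_iff form_scale_def algebra_simps)
  qed simp_all
qed

text \<open>Here \<open>g\<close> and \<open>h\<close> are nonzero and the exponents of e^347 and
  e^567 become 15/7. In the other five cases g = h = 0 and \<kappa> = 2 (p_3 + p_4) = 2 (p_5 + p_6),
  so these exponents are 4 (p_3 + p_4)/\<kappa> = 2.\<close>

lemma cp7_flow:
  fixes S :: "'a::{t2_space, second_countable_topology} monoid"
    and \<A> :: "'a chart set" and e :: "nat \<Rightarrow> 'a form"
  assumes "m \<noteq> 0" "lie_group \<A> S" "left_invariant_basis \<A> S e"
    and "structure_eqs \<A> e (cp7 m e)"
  shows "left_invariant_LCP_solution \<A> S {..<5 / (14 * m\<^sup>2)} (\<lambda>t.
          (1 - 14/5 * m\<^sup>2 * t) powr (15/7) *\<^sub>f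
            (e\<up>[1,2,7] + e\<up>[3,4,7] + e\<up>[5,6,7] - e\<up>[2,3,6])
        + (1 - 14/5 * m\<^sup>2 * t) powr (18/7) *\<^sub>f (e\<up>[1,3,5] - e\<up>[1,4,6] - e\<up>[2,4,5]))"
proof -
  have cartan: "cp7 m e = cp_general ((!) [0, 6/5, 3/5, 3/5, 6/5, 6/5, 3/5]) (2/5) 0 0 0 (2/5) (2/5) m e"
    by (simp add: cp7_def cp_general_def fun_eq_iff form_scale_def)
  have pos: "0 < 1 - 14/5 * m\<^sup>2 * t" if "t < 5 / (14 * m\<^sup>2)" for t
    using that assms(1) by (simp add: field_simps)
  show ?thesis
  proof (rule cp_flow[OF assms(2,3,4)[unfolded cartan], where \<kappa> = "14/5"
        and q = "(!) [0, 13/14, 5/7, 5/7, 13/14, 13/14, 5/7, 1/2]"], goal_cases)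
    case (22 t)
    then show ?case using pos by simp
  next
    case (23 t)
    define r where "r = 1 - 14/5 * m\<^sup>2 * t"
    have "r > 0" using pos[of t] 23 by (simp add: r_def)
    then show ?case
      unfolding r_def[symmetric] by (simp add: fun_eq_iff form_scale_def algebra_simps)
  qed simp_all
qed

theorem theorem3p2:
  fixes S :: "'a::{t2_space, second_countable_topology} monoid"
    and \<A> :: "'a chart set"
    and e :: "nat \<Rightarrow> 'a form"
    and m :: real
  assumes "m \<noteq> 0"
    and "lie_group \<A> S"
    and "solvable S"
    and "left_invariant_basis \<A> S e"
  shows
   "(structure_eqs \<A> e (cp2 m e) \<longrightarrow>
      left_invariant_LCP_solution \<A> S {..<3 / (10 * m\<^sup>2)} (\<lambda>t.
          (1 - 10/3 * m\<^sup>2 * t) powr (11/5) *\<^sub>f (e\<up>[1,2,7] - e\<up>[2,3,6])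
        + (1 - 10/3 * m\<^sup>2 * t) ^ 2 *\<^sub>f (e\<up>[3,4,7] + e\<up>[5,6,7])
        + (1 - 10/3 * m\<^sup>2 * t) powr (12/5) *\<^sub>f (e\<up>[1,3,5] - e\<up>[1,4,6] - e\<up>[2,4,5])))
  \<and> (structure_eqs \<A> e (cp3 m e) \<longrightarrow>
      left_invariant_LCP_solution \<A> S {..<1 / (3 * m\<^sup>2)} (\<lambda>t.
          (1 - 3 * m\<^sup>2 * t) powr (7/3) *\<^sub>f (e\<up>[1,2,7] - e\<up>[2,3,6] - e\<up>[2,4,5])
        + (1 - 3 * m\<^sup>2 * t) ^ 2 *\<^sub>f (e\<up>[3,4,7] + e\<up>[5,6,7])
        + (1 - 3 * m\<^sup>2 * t) powr (5/2) *\<^sub>f (e\<up>[1,3,5] - e\<up>[1,4,6])))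
  \<and> (structure_eqs \<A> e (cp4 m e) \<longrightarrow>
      left_invariant_LCP_solution \<A> S {..<5 / (14 * m\<^sup>2)} (\<lambda>t.
          (1 - 14/5 * m\<^sup>2 * t) powr (17/7) *\<^sub>f
            (e\<up>[1,2,7] - e\<up>[1,4,6] - e\<up>[2,3,6] - e\<up>[2,4,5])
        + (1 - 14/5 * m\<^sup>2 * t) ^ 2 *\<^sub>f (e\<up>[3,4,7] + e\<up>[5,6,7])
        + (1 - 14/5 * m\<^sup>2 * t) powr (18/7) *\<^sub>f e\<up>[1,3,5]))
  \<and> (structure_eqs \<A> e (cp5 m e) \<longrightarrow>
      left_invariant_LCP_solution \<A> S {..<1 / (3 * m\<^sup>2)} (\<lambda>t.
          (1 - 3 * m\<^sup>2 * t) powr (7/3) *\<^sub>f (e\<up>[1,2,7] - e\<up>[1,4,6] - e\<up>[2,4,5])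
        + (1 - 3 * m\<^sup>2 * t) ^ 2 *\<^sub>f (e\<up>[3,4,7] + e\<up>[5,6,7])
        + (1 - 3 * m\<^sup>2 * t) powr (5/2) *\<^sub>f (e\<up>[1,3,5] - e\<up>[2,3,6])))
  \<and> (structure_eqs \<A> e (cp6 m e) \<longrightarrow>
      left_invariant_LCP_solution \<A> S {..<3 / (8 * m\<^sup>2)} (\<lambda>t.
          (1 - 8/3 * m\<^sup>2 * t) powr (5/2) *\<^sub>f
            (e\<up>[1,2,7] + e\<up>[1,3,5] - e\<up>[1,4,6] - e\<up>[2,3,6] - e\<up>[2,4,5])
        + (1 - 8/3 * m\<^sup>2 * t) ^ 2 *\<^sub>f (e\<up>[3,4,7] + e\<up>[5,6,7])))
  \<and> (structure_eqs \<A> e (cp7 m e) \<longrightarrow>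
      left_invariant_LCP_solution \<A> S {..<5 / (14 * m\<^sup>2)} (\<lambda>t.
          (1 - 14/5 * m\<^sup>2 * t) powr (15/7) *\<^sub>f
            (e\<up>[1,2,7] + e\<up>[3,4,7] + e\<up>[5,6,7] - e\<up>[2,3,6])
        + (1 - 14/5 * m\<^sup>2 * t) powr (18/7) *\<^sub>f (e\<up>[1,3,5] - e\<up>[1,4,6] - e\<up>[2,4,5])))"
  using cp2_flow[OF assms(1,2,4)] cp3_flow[OF assms(1,2,4)] cp4_flow[OF assms(1,2,4)]
    cp5_flow[OF assms(1,2,4)] cp6_flow[OF assms(1,2,4)] cp7_flow[OF assms(1,2,4)]
  by blast

end
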